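(* (i) For every compact right $U$-orbit $Y\subset X$ there is an integer $m=m(Y)$ such that, for every $n\in\mathbb Z_{\ge0}$ with $n>m$, $$(h_K)_*\lambda^{\mathrm{per}}_{Y,n}=\mu^{\mathrm{fwd}}_{1,\,2(n-m)-1}.$$ In particular, the cutoff (depth minus root height) of this shadow is $2(n-m)-2$. (ii) Let $x=\Gamma g\in X$ and $N\in\mathbb Z_{\ge0}$. Then $$(h_K)_*\lambda^{\mathrm{den}}_{x,N}=\mu^{\varepsilon_N(x)}_{k_N(x),N}.$$ If the boundary point $\xi_g=g\infty$ is irrational, i.e. $\xi_g\notin\mathbb P^1(\mathbb F_q(t))$ (equivalently, if $xU$ is dense in $X$), then $M_N=N-k_N(x)\to\infty$ as $N\to\infty$; hence $\lambda^{\mathrm{den}}_{x,N}$ equidistributes $K$-spherically toward $\mu_X$, that is, $\|(h_K)_*\lambda^{\mathrm{den}}_{x,N}-(h_K)_*\mu_X\|_{\mathrm{TV}}\to0$. For every bounded profile $\Phi:2\mathbb Z_{\ge0}\to\mathbb C$, whenever $M_N\ge0$, $$\left|\lambda^{\mathrm{den}}_{x,N}(\Phi\circ h_K)-\langle\Phi\rangle_{\rho^{\mathrm{ev}}}\right|\ll_q\|\Phi\|_\infty q^{-M_N/2};$$ in particular, for irrational $\xi_g$ this estimate holds for all sufficiently large $N$.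
   Context: Let $q$ be a prime power, $F=\mathbb F_q((t^{-1}))$, $\mathcal O=\mathbb F_q[[t^{-1}]]$, $\pi=t^{-1}$, $G=\mathrm{SL}_2(F)$, $\Gamma=\mathrm{SL}_2(\mathbb F_q[t])$, $K=\mathrm{SL}_2(\mathcal O)$, $X=\Gamma\backslash G$, $\mu_X$ the normalized $G$-invariant probability measure on $X$. Put $u(s)=\begin{pmatrix}1&s\\0&1\end{pmatrix}$, $U=\{u(s):s\in F\}$, acting on $X$ on the right, $a_n=\mathrm{diag}(t^n,t^{-n})$ for $n\in\mathbb Z$, and let $ds$ be Haar measure on $F$ with $ds(\mathcal O)=1$. $\mathcal T$ is the Bruhat--Tits tree of $\mathrm{PGL}_2(F)$: vertices are homothety classes $[L]$ of $\mathcal O$-lattices in $F^2$, adjacent if representatives can be chosen with $\pi L\subsetneq L'\subsetneq L$, $L/L'\simeq\mathbb F_q$. Put $\bar a_n=[\mathrm{diag}(t^n,1)]\in\mathrm{PGL}_2(F)$, $v_0=[\mathcal O^2]$, $v_n=\bar a_nv_0$. The quotient of $\mathcal T$ by $\mathrm{PGL}_2(\mathbb F_q[t])$ is a ray represented by $v_0-v_1-v_2-\cdots$, and $h(v)$ is the $n\ge 0$ for which $v$ lies in the $\mathrm{PGL}_2(\mathbb F_q[t])$-orbit of $v_n$. All neighbors of a height-$0$ vertex have height $1$; a vertex of height $k\ge1$ has exactly one neighbor of height $k+1$ and exactly $q$ of height $k-1$. The spherical height map is $h_K:X\to2\mathbb Z_{\ge0}$, $h_K(\Gamma g)=h(gv_0)$.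 The boundary $\partial\mathcal T$ is identified with $\mathbb P^1(F)$, $\infty=[1:0]$. An oriented edge $e=(z_{-1},z_0)$ with $h(z_0)=k$ is forward (state $(\mathrm{fwd},k)$, $k\ge1$) if $h(z_{-1})=k-1$, backward (state $(\mathrm{bwd},k)$, $k\ge0$) if $h(z_{-1})=k+1$. $\mathrm{Desc}_N(e)$ is the set of terminal vertices $z_N$ of non-backtracking paths $z_{-1}\to z_0\to\cdots\to z_N$ ($q^N$ elements). $\mu^{\varepsilon}_{k,N}(j)$ is $q^{-N}$ times the number of vertices of height $j$ in $\mathrm{Desc}_N(e)$ for $e$ in state $(\varepsilon,k)$; this depends only on the state. Compact-orbit averages: for a compact right $U$-orbit $Y$ with normalized Haar ($U$-invariant probability) measure $\nu_Y$ and $n\ge 0$, $\lambda^{\mathrm{per}}_{Y,n}(f)=\int_Y f(ya_{-n})\,d\nu_Y(y)$. Ball averages: $\lambda^{\mathrm{den}}_{x,N}(f)=q^{-N}\int_{t^N\mathcal O}f(xu(s))\,ds$. For $x=\Gamma g$ put $y_N=g\bar a_Nv_0$ (a geodesic ray from $gv_0$ to $\xi_g=g\infty$), $k_N(x)=h(y_N)$, and $\varepsilon_N(x)=\mathrm{bwd}$ if $h(y_{N+1})=k_N(x)+1$, $\varepsilon_N(x)=\mathrm{fwd}$ if $h(y_{N+1})=k_N(x)-1$ (these are independent of the lift $g$, as is rationality of $\xi_g$). $\rho^{\mathrm{ev}}$ on $2\mathbb Z_{\ge0}$: $\rho^{\mathrm{ev}}(0)=\frac{q-1}{q}$, $\rho^{\mathrm{ev}}(2m)=(q^2-1)q^{-2m-1}$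 ($m\ge1$); $\langle\Phi\rangle_{\rho^{\mathrm{ev}}}=\sum_{m\ge0}\Phi(2m)\rho^{\mathrm{ev}}(2m)$. $\|\nu\|_{\mathrm{TV}}=\sum_j|\nu(j)|$. $A\ll_qB$ means $|A|\le C'B$ with $C'$ depending only on $q$. *)

theory Defs
  imports
    "HOL-Probability.Probability"
    "HOL-Computational_Algebra.Formal_Laurent_Series"
    "HOL-Computational_Algebra.Polynomial"
begin

section \<open>The local field and its subrings\<close>

text \<open>
  The finite field is a type \<open>'a\<close> of class \<open>{field, finite}\<close>, with \<open>q = CARD('a)\<close>.  The type
  \<open>'a fls\<close> is read as the field of Laurent series in the uniformizer \<open>fls_X\<close>, which plays the role
  of \<open>t\<^sup>-\<^sup>1\<close>; its library metric induces the valuation topology.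
\<close>

abbreviation unif :: "'a::{field,finite} fls"
  where "unif \<equiv> fls_X"

abbreviation tvar :: "'a::{field,finite} fls"
  where "tvar \<equiv> fls_X_inv"

definition O_ring :: "'a::{field,finite} fls set"
  where "O_ring = {f. \<forall>i<0. fls_nth f i = 0}"

definition Fq_poly :: "'a::{field,finite} fls set"
  where "Fq_poly = range (\<lambda>p::'a poly. poly (map_poly fls_const p) tvar)"

definition Fq_ratfun :: "'a::{field,finite} fls set"
  where "Fq_ratfun = {a / b | a b. a \<in> Fq_poly \<and> b \<in> Fq_poly \<and> b \<noteq> 0}"

definition is_haar_F :: "'a::{field,finite} fls measure \<Rightarrow> bool"
  where "is_haar_F M \<longleftrightarrow>
    sets M = sets borel \<and>
    (\<forall>a. distr M borel (\<lambda>s. a + s) = M) \<and>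
    emeasure M O_ring = 1"

section \<open>Groups and the homogeneous space\<close>

type_synonym 'a mat2 = "'a fls ^ 2 ^ 2"

definition mat2 :: "'a::{field,finite} fls \<Rightarrow> 'a fls \<Rightarrow> 'a fls \<Rightarrow> 'a fls \<Rightarrow> 'a mat2"
  where "mat2 a b c d = vector [vector [a, b], vector [c, d]]"

definition SL2 :: "'a::{field,finite} mat2 set"
  where "SL2 = {g. det g = 1}"

definition Gam :: "'a::{field,finite} mat2 set"
  where "Gam = {g \<in> SL2. \<forall>i j. g $ i $ j \<in> Fq_poly}"

definition u_mat :: "'a::{field,finite} fls \<Rightarrow> 'a mat2"
  where "u_mat s = mat2 1 s 0 1"

definition a_mat :: "int \<Rightarrow> 'a::{field,finite} mat2"
  where "a_mat n = mat2 (tvar powi n) 0 0 (tvar powi (- n))"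

text \<open>Points of \<open>X\<close> are the cosets \<open>\<Gamma> g\<close>, regarded as sets of matrices.\<close>

definition gcoset :: "'a::{field,finite} mat2 \<Rightarrow> 'a mat2 set"
  where "gcoset g = (\<lambda>\<gamma>. \<gamma> ** g) ` Gam"

definition X_space :: "'a::{field,finite} mat2 set set"
  where "X_space = gcoset ` SL2"

definition ract :: "'a::{field,finite} mat2 set \<Rightarrow> 'a mat2 \<Rightarrow> 'a mat2 set"
  where "ract x g = (\<lambda>h. h ** g) ` x"

text \<open>Quotient topology, \<open>SL2\<close> carrying the subspace topology of the \<open>2 \<times> 2\<close> matrices.\<close>

definition X_top :: "'a::{field,finite} mat2 set topology"
  where "X_top = topology (\<lambda>V. V \<subseteq> X_space \<and>
    openin (top_of_set SL2) {g \<in> SL2. gcoset g \<in> V})"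

lemma openin_X_top:
  "openin X_top V \<longleftrightarrow> V \<subseteq> X_space \<and> openin (top_of_set SL2) {g \<in> SL2. gcoset g \<in> V}"
proof -
  let ?P = "\<lambda>V. {g \<in> (SL2 :: 'a mat2 set). gcoset g \<in> V}"
  have "istopology (\<lambda>V. V \<subseteq> X_space \<and> openin (top_of_set SL2) (?P V))"
    unfolding istopology_def
  proof (intro conjI allI impI)
    fix S T :: "'a mat2 set set"
    assume S: "S \<subseteq> X_space \<and> openin (top_of_set SL2) (?P S)"
      and T: "T \<subseteq> X_space \<and> openin (top_of_set SL2) (?P T)"
    show "S \<inter> T \<subseteq> X_space"
      using S by blast
    have "?P (S \<inter> T) = ?P S \<inter> ?P T"
      by blast
    moreover have "openin (top_of_set SL2) (?P S \<inter> ?P T)"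
      using S T by (intro openin_Int) simp_all
    ultimately show "openin (top_of_set SL2) (?P (S \<inter> T))"
      by (simp only:)
  next
    fix \<K> :: "'a mat2 set set set"
    assume K: "\<forall>V\<in>\<K>. V \<subseteq> X_space \<and> openin (top_of_set SL2) (?P V)"
    then show "\<Union>\<K> \<subseteq> X_space"
      by blast
    have "?P (\<Union>\<K>) = \<Union> (?P ` \<K>)"
      by blast
    moreover have "openin (top_of_set SL2) (\<Union> (?P ` \<K>))"
      using K by (intro openin_Union) (auto simp only:)
    ultimately show "openin (top_of_set SL2) (?P (\<Union>\<K>))"
      by (simp only:)
  qed
  then show ?thesis
    unfolding X_top_def by (simp only: topology_inverse')
qed

lemma topspace_X_top: "topspace X_top = X_space"
proof
  show "topspace X_top \<subseteq> X_space"
    using openin_topspace[of X_top] unfolding openin_X_top by (rule conjunct1)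
  have eq: "{g \<in> SL2. gcoset g \<in> X_space} = SL2"
    unfolding X_space_def by blast
  have "openin X_top X_space"
    unfolding openin_X_top eq by (intro conjI subset_refl openin_subtopology_self)
  then show "X_space \<subseteq> topspace X_top"
    by (rule openin_subset)
qed

definition is_inv_prob_X :: "'a::{field,finite} mat2 set measure \<Rightarrow> bool"
  where "is_inv_prob_X M \<longleftrightarrow>
    prob_space M \<and>
    space M = X_space \<and>
    sets M = sigma_sets X_space {V. openin X_top V} \<and>
    (\<forall>g\<in>SL2. distr M M (\<lambda>x. ract x g) = M)"

definition U_orbit :: "'a::{field,finite} mat2 set \<Rightarrow> 'a mat2 set set"
  where "U_orbit x = range (\<lambda>s. ract x (u_mat s))"

definition is_compact_U_orbit :: "'a::{field,finite} mat2 set set \<Rightarrow> bool"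
  where "is_compact_U_orbit Y \<longleftrightarrow> (\<exists>x\<in>X_space. Y = U_orbit x) \<and> compactin X_top Y"

definition is_U_inv_prob :: "'a::{field,finite} mat2 set set \<Rightarrow> 'a mat2 set measure \<Rightarrow> bool"
  where "is_U_inv_prob Y M \<longleftrightarrow>
    prob_space M \<and>
    space M = Y \<and>
    sets M = sigma_sets Y {V. openin (subtopology X_top Y) V} \<and>
    (\<forall>s. distr M M (\<lambda>y. ract y (u_mat s)) = M)"

section \<open>The tree\<close>

type_synonym 'a vertex = "('a fls ^ 2) set set"

definition O2 :: "('a::{field,finite} fls ^ 2) set"
  where "O2 = {w. \<forall>i. w $ i \<in> O_ring}"

text \<open>A lattice is the \<open>\<O>\<close>-span of an \<open>F\<close>-basis, the basis being the columns of \<open>B\<close>.\<close>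

definition is_lattice :: "('a::{field,finite} fls ^ 2) set \<Rightarrow> bool"
  where "is_lattice L \<longleftrightarrow> (\<exists>B::'a mat2. invertible B \<and> L = (*v) B ` O2)"

definition hclass :: "('a::{field,finite} fls ^ 2) set \<Rightarrow> 'a vertex"
  where "hclass L = {(*s) c ` L | c. c \<noteq> 0}"

definition vertices :: "'a::{field,finite} vertex set"
  where "vertices = hclass ` {L. is_lattice L}"

text \<open>
  \<open>L / L' \<simeq> \<bbbF>\<^sub>q\<close> as \<open>\<O>\<close>-modules, \<open>\<O>\<close> acting on \<open>\<bbbF>\<^sub>q = \<O> / \<pi>\<O>\<close> through the constant coefficient:
  there is a surjective \<open>\<O>\<close>-linear map \<open>L \<rightarrow> \<bbbF>\<^sub>q\<close> with kernel \<open>L'\<close>.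
\<close>

definition quot_iso_Fq :: "('a::{field,finite} fls ^ 2) set \<Rightarrow> ('a fls ^ 2) set \<Rightarrow> bool"
  where "quot_iso_Fq L L' \<longleftrightarrow> (\<exists>\<phi> :: 'a fls ^ 2 \<Rightarrow> 'a.
    (\<forall>x\<in>L. \<forall>y\<in>L. \<phi> (x + y) = \<phi> x + \<phi> y) \<and>
    (\<forall>c\<in>O_ring. \<forall>x\<in>L. \<phi> (c *s x) = fls_nth c 0 * \<phi> x) \<and>
    \<phi> ` L = UNIV \<and>
    {x \<in> L. \<phi> x = 0} = L')"

definition adj :: "'a::{field,finite} vertex \<Rightarrow> 'a vertex \<Rightarrow> bool"
  where "adj v w \<longleftrightarrow> v \<in> vertices \<and> w \<in> vertices \<and>
    (\<exists>L\<in>v. \<exists>L'\<in>w. (*s) unif ` L \<subset> L' \<and> L' \<subset> L \<and> quot_iso_Fq L L')"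

text \<open>Elements of a projective linear group are represented by matrices; scalars act trivially.\<close>

definition vact :: "'a::{field,finite} mat2 \<Rightarrow> 'a vertex \<Rightarrow> 'a vertex"
  where "vact A v = (`) ((*v) A) ` v"

definition abar :: "nat \<Rightarrow> 'a::{field,finite} mat2"
  where "abar n = mat2 (tvar ^ n) 0 0 1"

definition v_base :: "'a::{field,finite} vertex"
  where "v_base = hclass O2"

definition v_ray :: "nat \<Rightarrow> 'a::{field,finite} vertex"
  where "v_ray n = vact (abar n) v_base"

definition GL2_poly :: "'a::{field,finite} mat2 set"
  where "GL2_poly = {A. (\<forall>i j. A $ i $ j \<in> Fq_poly) \<and>
    (\<exists>B. (\<forall>i j. B $ i $ j \<in> Fq_poly) \<and> A ** B = mat 1 \<and> B ** A = mat 1)}"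

definition height :: "'a::{field,finite} vertex \<Rightarrow> nat"
  where "height v = (THE n. \<exists>\<gamma>\<in>GL2_poly. v = vact \<gamma> (v_ray n))"

definition h_K :: "'a::{field,finite} mat2 set \<Rightarrow> nat"
  where "h_K x = (THE n. \<exists>g\<in>x. n = height (vact g v_base))"

section \<open>Descendants and shadows\<close>

datatype dir = Fwd | Bwd

fun in_state :: "dir \<Rightarrow> nat \<Rightarrow> 'a::{field,finite} vertex \<times> 'a vertex \<Rightarrow> bool"
  where
    "in_state Fwd k (z', z) \<longleftrightarrow> adj z' z \<and> height z = k \<and> height z' + 1 = k"
  | "in_state Bwd k (z', z) \<longleftrightarrow> adj z' z \<and> height z = k \<and> height z' = k + 1"

text \<open>The list entry \<open>p ! i\<close> is the vertex \<open>z\<^bsub>i-1\<^esub>\<close> of the path.\<close>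

definition nb_path :: "nat \<Rightarrow> 'a::{field,finite} vertex list \<Rightarrow> bool"
  where "nb_path N p \<longleftrightarrow> length p = N + 2 \<and>
    (\<forall>i<N+1. adj (p ! i) (p ! (i + 1))) \<and>
    (\<forall>i<N. p ! (i + 2) \<noteq> p ! i)"

definition Desc :: "nat \<Rightarrow> 'a::{field,finite} vertex \<times> 'a vertex \<Rightarrow> 'a vertex set"
  where "Desc N e = {p ! (N + 1) | p. nb_path N p \<and> p ! 0 = fst e \<and> p ! 1 = snd e}"

definition edge_shadow :: "'a::{field,finite} vertex \<times> 'a vertex \<Rightarrow> nat \<Rightarrow> nat \<Rightarrow> real"
  where "edge_shadow e N j = real (card {z \<in> Desc N e. height z = j}) / real CARD('a) ^ N"

text \<open>The value on a state is the common value on all edges in that state.\<close>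

definition shadow :: "'a::{field,finite} itself \<Rightarrow> dir \<Rightarrow> nat \<Rightarrow> nat \<Rightarrow> nat \<Rightarrow> real"
  where "shadow _ \<epsilon> k N =
    (THE d. \<exists>e :: 'a vertex \<times> 'a vertex. in_state \<epsilon> k e \<and> d = edge_shadow e N)"

definition cutoff :: "nat \<Rightarrow> nat \<Rightarrow> int"
  where "cutoff k N = int N - int k"

section \<open>Orbit averages\<close>

definition lam_per :: "'a::{field,finite} mat2 set measure \<Rightarrow> nat \<Rightarrow>
    ('a mat2 set \<Rightarrow> 'b::{banach,second_countable_topology}) \<Rightarrow> 'b"
  where "lam_per \<nu> n f = (LINT y|\<nu>. f (ract y (a_mat (- int n))))"

definition lam_den :: "'a::{field,finite} fls measure \<Rightarrow> 'a mat2 set \<Rightarrow> nat \<Rightarrow>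
    ('a mat2 set \<Rightarrow> 'b::{banach,second_countable_topology}) \<Rightarrow> 'b"
  where "lam_den ds x N f =
    (1 / real CARD('a) ^ N) *\<^sub>R
      (LINT s:(*) (tvar ^ N) ` O_ring|ds. f (ract x (u_mat s)))"

text \<open>
  Push-forward under \<open>h\<^sub>K\<close> of a measure on \<open>X\<close> given as a functional, as a mass function.  The heights
  \<open>2\<int>\<^sub>\<ge>\<^sub>0\<close> are embedded in the naturals, with mass functions extended by zero to the odd numbers.
\<close>

definition push_hK :: "(('a::{field,finite} mat2 set \<Rightarrow> real) \<Rightarrow> real) \<Rightarrow> nat \<Rightarrow> real"
  where "push_hK L j = L (indicator {y. h_K y = j})"

definition y_ray :: "'a::{field,finite} mat2 \<Rightarrow> nat \<Rightarrow> 'a vertex"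
  where "y_ray g N = vact (g ** abar N) v_base"

definition k_idx :: "'a::{field,finite} mat2 \<Rightarrow> nat \<Rightarrow> nat"
  where "k_idx g N = height (y_ray g N)"

definition eps_idx :: "'a::{field,finite} mat2 \<Rightarrow> nat \<Rightarrow> dir"
  where "eps_idx g N = (if height (y_ray g (N + 1)) = k_idx g N + 1 then Bwd else Fwd)"

definition M_idx :: "'a::{field,finite} mat2 \<Rightarrow> nat \<Rightarrow> int"
  where "M_idx g N = int N - int (k_idx g N)"

text \<open>Points of the projective line are punctured lines through the origin.\<close>

definition proj_pt :: "'a::{field,finite} fls ^ 2 \<Rightarrow> ('a fls ^ 2) set"
  where "proj_pt w = {c *s w | c. c \<noteq> 0}"

definition P1_ratfun :: "('a::{field,finite} fls ^ 2) set set"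
  where "P1_ratfun = {proj_pt w | w. w \<noteq> 0 \<and> (\<forall>i. w $ i \<in> Fq_ratfun)}"

definition xi_pt :: "'a::{field,finite} mat2 \<Rightarrow> ('a fls ^ 2) set"
  where "xi_pt g = (*v) g ` proj_pt (vector [1, 0])"

section \<open>The limiting distribution and norms\<close>

definition rho_ev :: "nat \<Rightarrow> nat \<Rightarrow> real"
  where "rho_ev q j =
    (if j = 0 then (real q - 1) / real q
     else if even j then ((real q)\<^sup>2 - 1) / real q ^ (j + 1)
     else 0)"

definition rho_mean :: "nat \<Rightarrow> (nat \<Rightarrow> complex) \<Rightarrow> complex"
  where "rho_mean q \<Phi> = (\<Sum>m. \<Phi> (2 * m) * of_real (rho_ev q (2 * m)))"

text \<open>Extended-valued, so that a divergent sum is not mistaken for a small one.\<close>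

definition tv_norm :: "(nat \<Rightarrow> real) \<Rightarrow> ennreal"
  where "tv_norm \<nu> = (\<Sum>j. ennreal \<bar>\<nu> j\<bar>)"

text \<open>Profiles live on the even naturals; their values at odd arguments are irrelevant.\<close>

definition bdd_profile :: "(nat \<Rightarrow> complex) \<Rightarrow> bool"
  where "bdd_profile \<Phi> \<longleftrightarrow> bounded (\<Phi> ` {j. even j})"

definition sup_norm :: "(nat \<Rightarrow> complex) \<Rightarrow> real"
  where "sup_norm \<Phi> = (SUP j\<in>{j. even j}. cmod (\<Phi> j))"

end

theory Submission
  imports Defs
begin

text \<open>
  Every vertex of the tree is \<open>A v\<^sub>0\<close> for an invertible matrix \<open>A\<close>, and every oriented edge is
  \<open>(A abar\<^sub>1 v\<^sub>0, A v\<^sub>0)\<close> (\<open>edge_cases\<close>).  The descendants of that edge at depth \<open>N\<close> are the vertices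
  \<open>A u(s) abar\<^bsub>-N\<^esub> v\<^sub>0\<close>, one for each class \<open>s\<close> in \<open>\<O> / \<pi>\<^sup>N \<O>\<close> (\<open>Desc_edge_at\<close>): the digits of \<open>s\<close> are the
  successive choices of a child.  Both kinds of orbit average are integrals of a function that
  is constant on cosets of a small ball of unipotent parameters, so they are finite sums over
  such digits, that is, shadows.  For \<open>\<lambda>\<^sup>d\<^sup>e\<^sup>n\<close> the matrix is \<open>A = g abar\<^sub>N\<close>, whose edge is
  \<open>(y\<^bsub>N+1\<^esub>, y\<^sub>N)\<close>; for a compact orbit, whose points are \<open>\<Gamma> u(z) diag(a, a\<^sup>-\<^sup>1)\<close>, the decomposition
  \<open>F = \<bbbF>\<^sub>q[t] + t\<^sup>-\<^sup>1 \<O>\<close> reduces it to the edge from the root to its neighbour \<open>abar\<^bsub>-1\<^esub> v\<^sub>0\<close>.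

  Heights along a random non-backtracking path form a Markov chain on the states: a backward
  path has to descend to the root, a forward one goes up with probability \<open>1/q\<close> and otherwise
  turns backward.  Solving the recursion gives the shadow of a forward edge exactly
  (\<open>state_mean_Fwd_closed\<close>): it agrees with \<open>\<rho>\<^sup>e\<^sup>v\<close> up to a height that grows with the cutoff and differs
  only in how the remaining mass is distributed.  The error bounds and the statement in total
  variation follow, the latter by testing against signs.  The push-forward of an invariant
  probability on \<open>X\<close> is \<open>\<rho>\<^sup>e\<^sup>v\<close> by the same computation (\<open>push_inv_prob\<close>): by invariance
  it is a mixture of depth \<open>2n\<close> shadows whose states have a law independent of \<open>n\<close>.

  If \<open>\<xi>\<^sub>g\<close> is rational then \<open>g\<close> is, up to \<open>\<Gamma>\<close>, upper triangular and heights are bounded on the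
  orbit.  If it is irrational, Euclid's algorithm never ends, so \<open>\<Gamma>\<close> moves the first column of \<open>g\<close>
  to vectors with arbitrarily short second entry; this makes its \<open>\<Gamma>\<close>-orbit dense in \<open>F\<^sup>2\<close> and the \<open>U\<close>-orbit dense
  in \<open>X\<close> (\<open>irrational_orbit_meets_open\<close>).  As heights are unbounded on \<open>X\<close>, dense orbits are not
  compact.  Finally \<open>N - k\<^sub>N\<close> grows by \<open>0\<close> or \<open>2\<close> at each step, and if it stopped growing the ray would
  climb forever, hence run into a cusp, which forces a rational endpoint
  (\<open>ascending_ray_rational\<close>).
\<close>

section \<open>Valuations and polynomials in the field of Laurent series\<close>

text \<open>The fractional ideal \<open>\<pi>\<^sup>n \<O>\<close>.  Coefficients are used in place of \<open>fls_subdegree\<close> because the latter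
  sends \<open>0\<close> to \<open>0\<close>, not to infinity.\<close>

definition val_ge :: "int \<Rightarrow> 'a::{field,finite} fls set"
  where "val_ge n = {f. \<forall>i<n. fls_nth f i = 0}"

text \<open>The power \<open>t\<^sup>n\<close> for an integer \<open>n\<close>; as a shift of the constant series it turns multiplication
  into a shift of coefficients.\<close>

definition tpow :: "int \<Rightarrow> 'a::{field,finite} fls"
  where "tpow n = fls_shift n 1"

lemma val_ge_iff: "f \<in> val_ge n \<longleftrightarrow> f = 0 \<or> n \<le> fls_subdegree f"
  unfolding val_ge_def by (auto intro: fls_subdegree_geI)

lemma O_ring_val_ge: "O_ring = val_ge 0"
  by (simp add: O_ring_def val_ge_def)

lemma val_ge_0 [simp]: "0 \<in> val_ge n"
  and val_ge_add: "f \<in> val_ge n \<Longrightarrow> g \<in> val_ge n \<Longrightarrow> f + g \<in> val_ge n"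
  and val_ge_diff: "f \<in> val_ge n \<Longrightarrow> g \<in> val_ge n \<Longrightarrow> f - g \<in> val_ge n"
  and val_ge_minus_iff [simp]: "- f \<in> val_ge n \<longleftrightarrow> f \<in> val_ge n"
  and val_ge_mono: "f \<in> val_ge n \<Longrightarrow> m \<le> n \<Longrightarrow> f \<in> val_ge m"
  by (auto simp: val_ge_def)

lemma val_ge_1 [simp]: "1 \<in> val_ge n \<longleftrightarrow> n \<le> 0"
  by (auto simp: val_ge_iff)

lemma val_ge_const: "n \<le> 0 \<Longrightarrow> fls_const c \<in> val_ge n"
  by (auto simp: val_ge_iff)

lemma val_ge_mult: "f \<in> val_ge m \<Longrightarrow> g \<in> val_ge n \<Longrightarrow> f * g \<in> val_ge (m + n)"
  by (cases "f = 0 \<or> g = 0") (auto simp: val_ge_iff)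

lemma val_ge_mult0: "f \<in> val_ge 0 \<Longrightarrow> g \<in> val_ge n \<Longrightarrow> f * g \<in> val_ge n"
  using val_ge_mult[of f 0 g n] by simp

lemma val_ge_succ: "f \<in> val_ge (n + 1) \<longleftrightarrow> f \<in> val_ge n \<and> fls_nth f n = 0"
  by (auto simp: val_ge_def zless_add1_eq) (metis order_le_less)

lemma val_ge_all_imp_0: "(\<And>n. n \<ge> n0 \<Longrightarrow> f \<in> val_ge n) \<Longrightarrow> f = 0"
proof (rule ccontr)
  assume *: "\<And>n. n \<ge> n0 \<Longrightarrow> f \<in> val_ge n" and "f \<noteq> 0"
  then show False
    using *[OF max.cobounded1[of n0 "fls_subdegree f + 1"]] by (simp add: val_ge_iff)
qed

lemma tpow_nz [simp]: "tpow n \<noteq> 0"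
  using fls_X_intpow_nonzero[of "- n"] by (simp add: tpow_def)

lemma subdegree_tpow [simp]: "fls_subdegree (tpow n) = - n"
  and tpow_0 [simp]: "tpow 0 = 1"
  and nth_tpow: "fls_nth (tpow n) i = (if i = - n then 1 else 0)"
  by (auto simp: tpow_def)

lemma nth_tpow_mult: "fls_nth (tpow n * f) i = fls_nth f (i + n)"
  using fls_X_intpow_times_conv_shift(1)[of "-n" f] by (simp add: tpow_def)

lemma tpow_mult_tpow: "tpow m * tpow n = tpow (m + n)"
  using fls_X_intpow_times_fls_X_intpow[of "-m" "-n"] by (simp add: tpow_def add.commute)

lemma tpow_mult_tpow_mult: "tpow m * (tpow n * f) = tpow (m + n) * f"
  by (simp add: tpow_mult_tpow flip: mult.assoc)

lemma tpow_mult_val_ge: "tpow n * f \<in> val_ge m \<longleftrightarrow> f \<in> val_ge (m + n)"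
  by (cases "f = 0") (auto simp: val_ge_iff)

lemma inverse_tpow: "inverse (tpow n) = tpow (- n)"
  by (rule inverse_unique) (simp add: tpow_mult_tpow)

lemma tvar_power: "tvar ^ n = tpow (int n)"
  by (simp add: tpow_def fls_X_inv_power_conv_shift_1)

lemma tvar_powi: "tvar powi n = tpow n"
  by (cases n rule: int_cases2) (simp_all add: power_int_minus tvar_power inverse_tpow)

lemma tvar_tpow: "tvar = tpow 1" and unif_tpow: "unif = tpow (- 1)"
  by (simp_all add: tpow_def fls_X_inv_conv_shift_1 fls_X_conv_shift_1)

lemma unit_times_tpow:
  assumes "f \<noteq> 0"
  obtains w where "w \<in> val_ge 0" "inverse w \<in> val_ge 0" "w \<noteq> 0" "f = tpow (- fls_subdegree f) * w"
proof
  let ?w = "tpow (fls_subdegree f) * f"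
  show "f = tpow (- fls_subdegree f) * ?w" by (simp add: tpow_mult_tpow_mult)
  show "?w \<in> val_ge 0" "inverse ?w \<in> val_ge 0" "?w \<noteq> 0"
    using assms by (auto simp: val_ge_iff simp del: inverse_mult_distrib)
qed

lemma nth_poly_tvar:
  "fls_nth (poly (map_poly fls_const p) tvar) i = (if i \<le> 0 then coeff p (nat (- i)) else 0)"
proof (induction p arbitrary: i)
  case (pCons a p)
  have "fls_nth (poly (map_poly fls_const (pCons a p)) tvar) i
      = (if i = 0 then a else 0) + fls_nth (poly (map_poly fls_const p) tvar) (i + 1)"
    using pCons(1) by (simp add: map_poly_pCons tvar_tpow nth_tpow_mult)
  also have "\<dots> = (if i \<le> 0 then coeff (pCons a p) (nat (- i)) else 0)"
  proof (cases "i < 0")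
    case True
    then have "nat (- i) = Suc (nat (- (i + 1)))" by simp
    then show ?thesis using True by (simp add: pCons.IH)
  qed (auto simp: pCons.IH)
  finally show ?case .
qed simp

text \<open>A Laurent series has only finitely many terms of positive degree in \<open>t\<close>, so no finiteness
  condition remains.\<close>

lemma Fq_poly_iff: "f \<in> Fq_poly \<longleftrightarrow> (\<forall>i>0. fls_nth f i = 0)"
proof
  assume "f \<in> Fq_poly"
  then show "\<forall>i>0. fls_nth f i = 0"
    by (auto simp: Fq_poly_def nth_poly_tvar)
next
  assume f: "\<forall>i>0. fls_nth f i = 0"
  let ?p = "fls_prpart f + [:fls_nth f 0:]"
  have "f = poly (map_poly fls_const ?p) tvar"
    by (rule fls_eqI) (use f in \<open>auto simp: nth_poly_tvar coeff_pCons split: nat.splits\<close>)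
  then show "f \<in> Fq_poly" unfolding Fq_poly_def by blast
qed

lemma Fq_poly_0 [simp]: "0 \<in> Fq_poly" and Fq_poly_1 [simp]: "1 \<in> Fq_poly"
  and Fq_poly_add: "f \<in> Fq_poly \<Longrightarrow> g \<in> Fq_poly \<Longrightarrow> f + g \<in> Fq_poly"
  and Fq_poly_diff: "f \<in> Fq_poly \<Longrightarrow> g \<in> Fq_poly \<Longrightarrow> f - g \<in> Fq_poly"
  and Fq_poly_minus: "f \<in> Fq_poly \<Longrightarrow> - f \<in> Fq_poly"
  and Fq_poly_const: "fls_const c \<in> Fq_poly"
  and Fq_poly_tpow: "n \<ge> 0 \<Longrightarrow> tpow n \<in> Fq_poly"
  by (auto simp: Fq_poly_iff nth_tpow)

lemma Fq_poly_mult: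
  assumes "f \<in> Fq_poly" "g \<in> Fq_poly"
  shows "f * g \<in> Fq_poly"
proof -
  obtain p where f: "f = poly (map_poly fls_const p) tvar"
    using assms(1) by (auto simp: Fq_poly_def)
  have "poly (map_poly fls_const p) tvar * g \<in> Fq_poly"
  proof (induction p)
    case (pCons a p)
    have "tvar * (poly (map_poly fls_const p) tvar * g) \<in> Fq_poly"
      using pCons.IH by (auto simp: Fq_poly_iff tvar_tpow nth_tpow_mult)
    moreover have "fls_const a * g \<in> Fq_poly"
      using assms(2) by (auto simp: Fq_poly_iff)
    moreover have "poly (map_poly fls_const (pCons a p)) tvar * g
       = fls_const a * g + tvar * (poly (map_poly fls_const p) tvar * g)"
      using pCons(1) by (simp add: map_poly_pCons algebra_simps)
    ultimately show ?case by (simp add: Fq_poly_add)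
  qed simp
  then show ?thesis by (simp add: f)
qed

text \<open>The discreteness of \<open>\<bbbF>\<^sub>q[t]\<close> in \<open>F\<close>: a nonzero polynomial has valuation at most \<open>0\<close>.\<close>

lemma Fq_poly_val_ge_1: "f \<in> Fq_poly \<Longrightarrow> f \<in> val_ge n \<Longrightarrow> n \<ge> 1 \<Longrightarrow> f = 0"
  unfolding Fq_poly_iff val_ge_def
  by (rule fls_eqI) (metis (mono_tags, lifting) fls_zero_nth linorder_not_less mem_Collect_eq order_less_le_trans zero_less_one)

text \<open>The decomposition \<open>F = \<bbbF>\<^sub>q[t] + t\<^sup>-\<^sup>1 \<O>\<close>.  It serves both to reduce unipotent parameters modulo \<open>\<Gamma>\<close> and as
  division with remainder.\<close>

lemma polynomial_part_exists:
  obtains p where "p \<in> Fq_poly" "f - p \<in> val_ge 1"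
proof
  let ?p = "poly (map_poly fls_const (fls_prpart f + [:fls_nth f 0:])) tvar"
  show "?p \<in> Fq_poly" by (auto simp: Fq_poly_def)
  show "f - ?p \<in> val_ge 1"
    unfolding val_ge_def mem_Collect_eq
  proof (intro allI impI)
    fix i :: int assume "i < 1"
    then show "fls_nth (f - ?p) i = 0"
      by (cases "i = 0") (auto simp: nth_poly_tvar coeff_pCons split: nat.splits)
  qed
qed

section \<open>Lattice classes as matrices\<close>

lemma mat2_nth [simp]:
  "mat2 a b c d $ 1 $ 1 = a" "mat2 a b c d $ 1 $ 2 = b"
  "mat2 a b c d $ 2 $ 1 = c" "mat2 a b c d $ 2 $ 2 = d"
  by (simp_all add: mat2_def)

lemma mat2_eqI:
  fixes A B :: "'a::{field,finite} mat2"
  assumes "A $ 1 $ 1 = B $ 1 $ 1" "A $ 1 $ 2 = B $ 1 $ 2" "A $ 2 $ 1 = B $ 2 $ 1" "A $ 2 $ 2 = B $ 2 $ 2"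
  shows "A = B"
  using assms by (simp add: vec_eq_iff forall_2)

lemma mat2_eq_iff [simp]: "mat2 a b c d = mat2 a' b' c' d' \<longleftrightarrow> a = a' \<and> b = b' \<and> c = c' \<and> d = d'"
  by (metis mat2_nth)

lemma mat2_cases [case_names mat2]:
  fixes A :: "'a::{field,finite} mat2"
  obtains a b c d where "A = mat2 a b c d"
  by (rule that, rule mat2_eqI) simp_all

lemma mat2_mult: "mat2 a b c d ** mat2 a' b' c' d'
    = mat2 (a * a' + b * c') (a * b' + b * d') (c * a' + d * c') (c * b' + d * d')"
  by (rule mat2_eqI) (simp_all add: matrix_matrix_mult_def sum_2)

lemma det_mat2: "det (mat2 a b c d) = a * d - b * c"
  by (simp add: det_2)

lemma mat2_one: "mat 1 = mat2 1 0 0 1"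
  by (rule mat2_eqI) (simp_all add: mat_def)

lemma vec2_eqI: "v $ 1 = w $ 1 \<Longrightarrow> v $ 2 = w $ 2 \<Longrightarrow> v = (w :: 'b ^ 2)"
  by (simp add: vec_eq_iff forall_2)

lemma mat2_vec_nth [simp]:
  "(mat2 a b c d *v v) $ 1 = a * v $ 1 + b * v $ 2" "(mat2 a b c d *v v) $ 2 = c * v $ 1 + d * v $ 2"
  by (simp_all add: matrix_vector_mult_def sum_2)

lemma entries_mat2: "(\<forall>i j. mat2 a b c d $ i $ j \<in> S) \<longleftrightarrow> a \<in> S \<and> b \<in> S \<and> c \<in> S \<and> d \<in> S"
  by (auto simp: forall_2)

definition scalar_mat :: "'a::{field,finite} fls \<Rightarrow> 'a mat2"
  where "scalar_mat c = mat2 c 0 0 c"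

lemma scalar_mat_vec: "scalar_mat c *v v = c *s v"
  by (rule vec2_eqI) (simp_all add: scalar_mat_def)

lemma invertible_iff_det: "invertible (A :: 'a::{field,finite} mat2) \<longleftrightarrow> det A \<noteq> 0"
  by (rule invertible_det_nz)

text \<open>Cramer's rule, so that integrality of the entries of an inverse can be read off.\<close>

definition inv2 :: "'a::{field,finite} mat2 \<Rightarrow> 'a mat2"
  where "inv2 A = mat2 (A $ 2 $ 2 / det A) (- A $ 1 $ 2 / det A) (- A $ 2 $ 1 / det A) (A $ 1 $ 1 / det A)"

lemma inv2_mult: 
  assumes "det A \<noteq> 0"
  shows "inv2 A ** A = mat 1" "A ** inv2 A = mat 1"
proof -
  have "inv2 A ** A = mat 1 \<and> A ** inv2 A = mat 1"
  proof (cases A rule: mat2_cases)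
    case (mat2 a b c d)
    then have "a * d - b * c \<noteq> 0" using assms by (simp add: det_mat2)
    then obtain r where r: "inverse (a * d - b * c) = r" "r * (a * d - b * c) = 1"
      by (metis left_inverse)
    then have "d * r * a - b * r * c = 1" "a * (d * r) - b * (c * r) = 1"
      "d * (a * r) - c * (b * r) = 1" "a * r * d - c * r * b = 1"
      by (simp_all add: algebra_simps)
    then show ?thesis 
      by (simp add: mat2 inv2_def mat2_mult det_mat2 mat2_one divide_inverse r)
  qed
  then show "inv2 A ** A = mat 1" "A ** inv2 A = mat 1" by auto
qed

lemma det_inv2: "det A \<noteq> 0 \<Longrightarrow> det (inv2 A) \<noteq> 0"
  using inv2_mult[of A] det_mul[of A "inv2 A"] by (auto simp: det_I)

lemma inv2_cancel:
  assumes "det A \<noteq> 0"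
  shows "inv2 A ** (A ** B) = B" "A ** (inv2 A ** B) = B"
  using inv2_mult[OF assms] by (simp_all add: matrix_mul_assoc)

lemma inv2_vec: 
  assumes "det A \<noteq> 0"
  shows "inv2 A *v (A *v x) = x" "A *v (inv2 A *v x) = x"
  using inv2_mult[OF assms] by (simp_all add: matrix_vector_mul_assoc)

text \<open>All vertices have this form, so the tree is studied through matrices, two of which give
  the same vertex if they differ on the right by the stabilizer of \<open>v_base\<close>.\<close>

definition vtx :: "'a::{field,finite} mat2 \<Rightarrow> 'a vertex"
  where "vtx A = vact A v_base"

definition lattice_of :: "'a::{field,finite} mat2 \<Rightarrow> ('a fls ^ 2) set"
  where "lattice_of A = (*v) A ` O2"

lemma vact_mult: "vact (A ** B) v = vact A (vact B v)"
  by (simp add: vact_def image_image matrix_vector_mul_assoc)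

lemma vact_one [simp]: "vact (mat 1) v = v"
  by (simp add: vact_def)

lemma vact_vtx: "vact A (vtx B) = vtx (A ** B)"
  by (simp add: vtx_def vact_mult)

lemma vact_cancel: 
  assumes "det A \<noteq> 0"
  shows "vact (inv2 A) (vact A v) = v" "vact A (vact (inv2 A) v) = v"
  using inv2_mult[OF assms] by (simp_all flip: vact_mult)

lemma vact_inject: "det A \<noteq> 0 \<Longrightarrow> vact A v = vact A w \<longleftrightarrow> v = w"
  by (metis vact_cancel(1))

lemma mult_scale: "(A :: 'a::{field,finite} mat2) *v (c *s v) = c *s (A *v v)"
  by (cases A rule: mat2_cases) (auto intro!: vec2_eqI simp: algebra_simps)

lemma scale_image: "(*v) (A :: 'a::{field,finite} mat2) ` ((*s) c ` L) = (*s) c ` ((*v) A ` L)"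
  by (simp add: image_image mult_scale)

lemma vact_hclass: "vact A (hclass L) = hclass ((*v) A ` L)"
  unfolding vact_def hclass_def setcompr_eq_image by (subst image_image) (simp only: scale_image)

lemma vtx_hclass: "vtx A = hclass (lattice_of A)"
  by (simp add: vtx_def v_base_def vact_hclass lattice_of_def)

lemma v_base_vtx: "v_base = vtx (mat 1)"
  by (simp add: vtx_def)

lemma hclass_scale: "c \<noteq> 0 \<Longrightarrow> hclass ((*s) c ` L) = hclass L"
proof -
  assume c: "c \<noteq> 0"
  have 1: "(*s) d ` L = (*s) (d / c) ` (*s) c ` L" for d
    using c by (simp add: image_image vector_smult_assoc)
  have 2: "(*s) d ` (*s) c ` L = (*s) (d * c) ` L" for d
    by (simp add: image_image vector_smult_assoc)
  show ?thesis
  proof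
    show "hclass ((*s) c ` L) \<subseteq> hclass L"
      using c unfolding hclass_def 2 by auto
    show "hclass L \<subseteq> hclass ((*s) c ` L)"
    proof
      fix M assume "M \<in> hclass L"
      then obtain d where "d \<noteq> 0" "M = (*s) d ` L" by (auto simp: hclass_def)
      then have "d / c \<noteq> 0" "M = (*s) (d / c) ` (*s) c ` L" using c 1[of d] by auto
      then show "M \<in> hclass ((*s) c ` L)" unfolding hclass_def by blast
    qed
  qed
qed

lemma hclass_self: "L \<in> hclass L"
  unfolding hclass_def by (auto intro!: exI[of _ 1])

lemma hclass_eq_iff: "hclass L = hclass L' \<longleftrightarrow> (\<exists>c. c \<noteq> 0 \<and> L = (*s) c ` L')"
proof
  assume "hclass L = hclass L'"
  then show "\<exists>c. c \<noteq> 0 \<and> L = (*s) c ` L'"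
    using hclass_self[of L] by (auto simp: hclass_def)
qed (auto simp: hclass_scale)

lemma lattice_of_scalar_mat: "lattice_of (scalar_mat c ** A) = (*s) c ` lattice_of A"
  by (simp add: lattice_of_def scalar_mat_vec image_image flip: matrix_vector_mul_assoc)

lemma vtx_scalar_mat: "c \<noteq> 0 \<Longrightarrow> vtx (scalar_mat c ** A) = vtx A"
  by (simp add: vtx_hclass lattice_of_scalar_mat hclass_scale)

text \<open>If \<open>C \<O>\<^sup>2 = \<O>\<^sup>2\<close>, the columns of \<open>C\<close> are integral and the preimages of the basis vectors form an
  integral inverse, so the determinant is a unit; the converse is Cramer's rule.\<close>

lemma lattice_of_eq_O2_iff:
  assumes "det C \<noteq> 0"
  shows "lattice_of C = O2 \<longleftrightarrow> fls_subdegree (det C) = 0 \<and> (\<forall>i j. C $ i $ j \<in> val_ge 0)"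
proof (cases C rule: mat2_cases)
  case (mat2 a b c d)
  have e: "axis 1 1 \<in> O2" "axis 2 1 \<in> (O2 :: ('a fls ^ 2) set)"
    by (auto simp: O2_def O_ring_val_ge axis_def)
  show ?thesis
  proof
    assume L: "lattice_of C = O2"
    then have "C *v axis 1 1 \<in> O2" "C *v axis 2 1 \<in> O2"
      using e by (auto simp: lattice_of_def)
    then have ent: "a \<in> val_ge 0" "b \<in> val_ge 0" "c \<in> val_ge 0" "d \<in> val_ge 0"
      by (auto simp: O2_def O_ring_val_ge forall_2 mat2 axis_def)
    have "axis 1 1 \<in> lattice_of C" "axis 2 1 \<in> lattice_of C" using e L by simp_all
    then obtain x y where x: "x \<in> O2" "C *v x = axis 1 1" and y: "y \<in> O2" "C *v y = axis 2 1"
      unfolding lattice_of_def by (fastforce simp: image_iff)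
    have "C ** mat2 (x $ 1) (y $ 1) (x $ 2) (y $ 2) = mat 1"
      using x(2) y(2) by (auto simp: mat2 mat2_mult mat2_one vec_eq_iff forall_2 axis_def)
    then have "det C * (x $ 1 * y $ 2 - y $ 1 * x $ 2) = 1"
      using det_mul[of C "mat2 (x $ 1) (y $ 1) (x $ 2) (y $ 2)"] by (simp add: det_mat2 det_I)
    moreover have "(x $ 1 * y $ 2 - y $ 1 * x $ 2) \<in> val_ge 0" "det C \<in> val_ge 0"
      using x(1) y(1) ent by (auto simp: O2_def O_ring_val_ge mat2 det_mat2 intro!: val_ge_diff val_ge_mult0)
    ultimately have "fls_subdegree (det C) = 0"
      using fls_subdegree_mult[of "det C" "x $ 1 * y $ 2 - y $ 1 * x $ 2"] assms
      by (cases "x $ 1 * y $ 2 - y $ 1 * x $ 2 = 0") (simp_all add: val_ge_iff)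
    then show "fls_subdegree (det C) = 0 \<and> (\<forall>i j. C $ i $ j \<in> val_ge 0)"
      using ent by (simp add: mat2 entries_mat2)
  next
    assume *: "fls_subdegree (det C) = 0 \<and> (\<forall>i j. C $ i $ j \<in> val_ge 0)"
    then have ent: "a \<in> val_ge 0" "b \<in> val_ge 0" "c \<in> val_ge 0" "d \<in> val_ge 0"
      by (auto simp: mat2 entries_mat2)
    have "inverse (det C) \<in> val_ge 0" using * by (simp add: val_ge_iff)
    then have r: "x * inverse (det C) \<in> val_ge 0" if "x \<in> val_ge 0" for x
      using that val_ge_mult0 by blast
    have "\<forall>i j. inv2 C $ i $ j \<in> val_ge 0"
      unfolding inv2_def entries_mat2 divide_inverse using ent r[unfolded mat2] by (simp add: mat2)
    then have inv: "\<And>i j. inv2 C $ i $ j \<in> val_ge 0" by blast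
    have sub: "B *v w \<in> O2" if B: "\<And>i j. B $ i $ j \<in> val_ge 0" and w: "w \<in> O2" for B :: "'a mat2" and w
    proof (cases B rule: mat2_cases)
      case (mat2 a b c d)
      then have "a \<in> val_ge 0" "b \<in> val_ge 0" "c \<in> val_ge 0" "d \<in> val_ge 0"
        using B entries_mat2[of a b c d "val_ge 0"] by auto
      then show ?thesis
        using w by (simp add: mat2 O2_def O_ring_val_ge forall_2 val_ge_add val_ge_mult0)
    qed
    show "lattice_of C = O2"
    proof
      show "lattice_of C \<subseteq> O2" using sub * by (auto simp: lattice_of_def)
      show "O2 \<subseteq> lattice_of C"
      proof
        fix w :: "'a fls ^ 2" assume "w \<in> O2"
        then have "inv2 C *v w \<in> O2" using sub inv by blast
        moreover have "w = C *v (inv2 C *v w)"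
          using inv2_mult(2)[OF assms] by (simp add: matrix_vector_mul_assoc)
        ultimately show "w \<in> lattice_of C" unfolding lattice_of_def by blast
      qed
    qed
  qed
qed

lemma scalar_mat_mult_nth: "(scalar_mat c ** (A :: 'a::{field,finite} mat2)) $ i $ j = c * A $ i $ j"
  by (cases A rule: mat2_cases, use exhaust_2[of i] exhaust_2[of j] in \<open>auto simp: scalar_mat_def mat2_mult\<close>)

lemma det_scalar_mat_mult: "det (scalar_mat c ** A) = c\<^sup>2 * det A"
  by (simp add: det_mul scalar_mat_def det_mat2 power2_eq_square)

text \<open>The stabilizer of the base vertex is \<open>F\<^sup>\<times> GL\<^sub>2(\<O>)\<close>.  For \<open>C = c C'\<close> with \<open>C'\<close> in \<open>GL\<^sub>2(\<O>)\<close> the determinant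
  has twice the valuation \<open>e\<close> of \<open>c\<close>, so the scalar need not appear in the criterion.\<close>

lemma stabilizer_iff:
  assumes "det C \<noteq> 0"
  shows "vtx C = v_base \<longleftrightarrow> (\<exists>e. fls_subdegree (det C) = 2 * e \<and> (\<forall>i j. C $ i $ j \<in> val_ge e))"
proof
  assume "vtx C = v_base"
  then obtain c where c: "c \<noteq> 0" "O2 = (*s) c ` lattice_of C"
    unfolding vtx_hclass v_base_def by (metis hclass_eq_iff)
  then have "lattice_of (scalar_mat c ** C) = O2" by (simp add: lattice_of_scalar_mat)
  then have *: "fls_subdegree (c\<^sup>2 * det C) = 0" "\<And>i j. c * C $ i $ j \<in> val_ge 0"
    using c assms lattice_of_eq_O2_iff[of "scalar_mat c ** C"] by (auto simp: det_scalar_mat_mult scalar_mat_mult_nth)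
  have "fls_subdegree (det C) = 2 * (- fls_subdegree c)"
    using *(1) c assms by (simp add: fls_subdegree_pow)
  moreover have "C $ i $ j \<in> val_ge (- fls_subdegree c)" for i j
    using *(2)[of i j] c by (cases "C $ i $ j = 0") (auto simp: val_ge_iff)
  ultimately show "\<exists>e. fls_subdegree (det C) = 2 * e \<and> (\<forall>i j. C $ i $ j \<in> val_ge e)" by blast
next
  assume "\<exists>e. fls_subdegree (det C) = 2 * e \<and> (\<forall>i j. C $ i $ j \<in> val_ge e)"
  then obtain e where e: "fls_subdegree (det C) = 2 * e" "\<And>i j. C $ i $ j \<in> val_ge e" by blast
  have "lattice_of (scalar_mat (tpow e) ** C) = O2"
    using e assms lattice_of_eq_O2_iff[of "scalar_mat (tpow e) ** C"]
    by (auto simp: det_scalar_mat_mult scalar_mat_mult_nth tpow_mult_val_ge fls_subdegree_pow)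
  then have "vtx (scalar_mat (tpow e) ** C) = v_base"
    by (simp add: vtx_hclass v_base_def)
  then show "vtx C = v_base" by (simp add: vtx_scalar_mat)
qed

lemma vtx_mult_stabilizer:
  assumes "vtx C = v_base"
  shows "vtx (A ** C) = vtx A"
  using assms by (metis vact_vtx vtx_def)

text \<open>The matrix \<open>diag(t\<^sup>n, 1)\<close>, with negative \<open>n\<close> allowed: descending paths use these.\<close>

definition abarz :: "int \<Rightarrow> 'a::{field,finite} mat2"
  where "abarz n = mat2 (tpow n) 0 0 1"

definition swap2 :: "'a::{field,finite} mat2"
  where "swap2 = mat2 0 1 1 0"

lemma abar_abarz: "abar n = abarz (int n)"
  by (simp add: abar_def abarz_def tvar_power)

lemma det_abarz [simp]: "det (abarz n) = tpow n" and det_u_mat [simp]: "det (u_mat s) = 1"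
  and det_swap2 [simp]: "det swap2 = - 1"
  by (simp_all add: abarz_def u_mat_def swap2_def det_mat2)

lemma abarz_mult: "abarz m ** abarz n = abarz (m + n)"
  by (simp add: abarz_def mat2_mult tpow_mult_tpow)

lemma abarz_0: "abarz 0 = mat 1" and u_mat_0: "u_mat 0 = mat 1"
  by (simp_all add: abarz_def u_mat_def mat2_one)

lemma u_mat_add: "u_mat s ** u_mat s' = u_mat (s + s')"
  by (simp add: u_mat_def mat2_mult add.commute)

lemma abarz_u_mat: "abarz n ** u_mat s = u_mat (tpow n * s) ** abarz n"
  by (simp add: u_mat_def abarz_def mat2_mult)

lemma u_mat_abarz: "u_mat s ** abarz n = abarz n ** u_mat (tpow (- n) * s)"
  by (simp add: abarz_u_mat tpow_mult_tpow_mult)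

lemma vtx_u_mat_int: "s \<in> val_ge 0 \<Longrightarrow> vtx (A ** u_mat s) = vtx A"
  by (rule vtx_mult_stabilizer)
     (subst stabilizer_iff, auto simp: u_mat_def det_mat2 entries_mat2 intro!: exI[of _ 0])

lemma vtx_swap2: "vtx (A ** swap2) = vtx A"
  by (rule vtx_mult_stabilizer)
     (subst stabilizer_iff, auto simp: swap2_def det_mat2 entries_mat2 intro!: exI[of _ 0])

text \<open>Up to a scalar, \<open>swap2\<close> inverts \<open>abarz n\<close> by conjugation, and it fixes the base vertex: it exchanges
  the two ends of the standard apartment.\<close>

lemma vtx_abarz_swap2: "vtx ((A :: 'a::{field,finite} mat2) ** swap2 ** abarz n) = vtx (A ** abarz (- n))"
proof -
  have "swap2 ** abarz n ** (swap2 :: 'a mat2) = scalar_mat (tpow n) ** abarz (- n)"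
    by (simp add: swap2_def abarz_def scalar_mat_def mat2_mult tpow_mult_tpow)
  then have "vtx (A ** (swap2 ** abarz n ** swap2)) = vact A (vtx (scalar_mat (tpow n) ** abarz (- n)))"
    unfolding vact_vtx by (rule arg_cong)
  then show ?thesis by (simp add: vtx_swap2 vtx_scalar_mat vact_vtx matrix_mul_assoc)
qed

lemma vtx_u_mat_abarz: "s \<in> val_ge (- n) \<Longrightarrow> vtx (A ** u_mat s ** abarz n) = vtx (A ** abarz n)"
proof -
  assume s: "s \<in> val_ge (- n)"
  have "vtx (A ** u_mat s ** abarz n) = vtx (A ** abarz n ** u_mat (tpow (- n) * s))"
    by (simp add: u_mat_abarz matrix_mul_assoc[symmetric])
  also have "\<dots> = vtx (A ** abarz n)"
    using s by (intro vtx_u_mat_int) (simp add: tpow_mult_val_ge)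
  finally show ?thesis .
qed

lemma vertices_vtx: "v \<in> vertices \<longleftrightarrow> (\<exists>A. det A \<noteq> 0 \<and> v = vtx A)"
  unfolding vertices_def is_lattice_def vtx_hclass lattice_of_def invertible_iff_det by auto

section \<open>Neighbours in the tree\<close>

lemma vact_vertices: "det A \<noteq> 0 \<Longrightarrow> v \<in> vertices \<Longrightarrow> vact A v \<in> vertices"
  unfolding vertices_vtx by (auto simp: vact_vtx) (metis det_mul mult_eq_0_iff)

lemma inj_mult: "det (A :: 'a::{field,finite} mat2) \<noteq> 0 \<Longrightarrow> inj ((*v) A)"
  by (metis injI inv2_vec(1))

lemma adj_vactI:
  assumes A: "det A \<noteq> 0" and "adj v w"
  shows "adj (vact A v) (vact A w)"
proof -
  from assms(2) obtain L L' where vw: "v \<in> vertices" "w \<in> vertices" and L: "L \<in> v" "L' \<in> w"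
    "(*s) unif ` L \<subset> L'" "L' \<subset> L" and "quot_iso_Fq L L'"
    unfolding adj_def by (elim exE conjE bexE)
  then obtain \<phi> where phi': "(\<forall>x\<in>L. \<forall>y\<in>L. \<phi> (x + y) = \<phi> x + \<phi> y)"
    "(\<forall>c\<in>O_ring. \<forall>x\<in>L. \<phi> (c *s x) = fls_nth c 0 * \<phi> x)" and phi_ker: "\<phi> ` L = UNIV" "{x \<in> L. \<phi> x = 0} = L'"
    unfolding quot_iso_Fq_def by (elim exE conjE) 
  have phi: "\<And>x y. x \<in> L \<Longrightarrow> y \<in> L \<Longrightarrow> \<phi> (x + y) = \<phi> x + \<phi> y"
    "\<And>c x. c \<in> O_ring \<Longrightarrow> x \<in> L \<Longrightarrow> \<phi> (c *s x) = fls_nth c 0 * \<phi> x"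
    "\<phi> ` L = UNIV" "{x \<in> L. \<phi> x = 0} = L'"
    using phi' phi_ker by simp_all
  let ?I = "(*v) (inv2 A)"
  have I: "?I (A *v x) = x" for x
    by (rule inv2_vec(1)[OF A])
  have "quot_iso_Fq ((*v) A ` L) ((*v) A ` L')"
    unfolding quot_iso_Fq_def
  proof (intro exI[of _ "\<phi> \<circ> ?I"] conjI ballI)
    show "(\<phi> \<circ> ?I) ` (*v) A ` L = UNIV"
      unfolding image_comp using phi(3) I by (simp add: comp_def)
    show "{x \<in> (*v) A ` L. (\<phi> \<circ> ?I) x = 0} = (*v) A ` L'"
      unfolding phi(4)[symmetric] by (auto simp: I)
  qed (auto simp: I phi matrix_vector_right_distrib mult_scale)
  moreover have "(*s) unif ` (*v) A ` L \<subset> (*v) A ` L'" "(*v) A ` L' \<subset> (*v) A ` L"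
    using L(3,4) unfolding psubset_eq
    by (simp_all add: inj_image_subset_iff[OF inj_mult[OF A]] inj_image_eq_iff[OF inj_mult[OF A]] scale_image[symmetric])
  moreover have "(*v) A ` L \<in> vact A v" "(*v) A ` L' \<in> vact A w"
    using L by (auto simp: vact_def)
  ultimately show ?thesis
    unfolding adj_def using vact_vertices[OF A] vw by blast
qed

lemma adj_vact: "det A \<noteq> 0 \<Longrightarrow> adj (vact A v) (vact A w) \<longleftrightarrow> adj v w"
  using adj_vactI[of A v w] adj_vactI[OF det_inv2, of A "vact A v" "vact A w"]
  by (auto simp: vact_cancel)

lemma nth_0_mult:
  assumes "f \<in> val_ge 0" "g \<in> val_ge 0"
  shows "fls_nth (f * g) 0 = fls_nth f 0 * fls_nth g 0"
proof -
  have f: "f - fls_const (fls_nth f 0) \<in> val_ge (0 + 1)"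
    using assms(1) unfolding val_ge_succ by (auto intro: val_ge_diff val_ge_const)
  have "(f - fls_const (fls_nth f 0)) * g \<in> val_ge (0 + 1)"
    using val_ge_mult[OF f assms(2)] by simp
  then have "fls_nth ((f - fls_const (fls_nth f 0)) * g) 0 = 0"
    unfolding val_ge_succ by simp
  then show ?thesis by (simp add: algebra_simps)
qed

lemma lattice_of_iff: "det A \<noteq> 0 \<Longrightarrow> x \<in> lattice_of A \<longleftrightarrow> inv2 A *v x \<in> O2"
  unfolding lattice_of_def image_iff by (metis inv2_vec)

lemma O2_iff: "x \<in> O2 \<longleftrightarrow> x $ 1 \<in> val_ge 0 \<and> x $ 2 \<in> val_ge 0"
  by (simp add: O2_def O_ring_val_ge forall_2)

text \<open>The sublattices of index \<open>q\<close> of \<open>\<O>\<^sup>2\<close> are cut out by one linear condition on the residues modulo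
  \<open>\<pi>\<close>; this one corresponds to the finite point \<open>c\<close> of the projective line over \<open>\<bbbF>\<^sub>q\<close>.\<close>

lemma lattice_of_neighbour:
  "lattice_of (u_mat (fls_const c) ** abarz (- 1)) = {x \<in> O2. fls_nth (x $ 1) 0 = c * fls_nth (x $ 2) 0}"
proof -
  let ?A = "u_mat (fls_const c) ** abarz (- 1)"
  have A: "?A = mat2 (tpow (-1)) (fls_const c) 0 1" by (simp add: u_mat_def abarz_def mat2_mult)
  have eq: "inv2 ?A *v x \<in> O2 \<longleftrightarrow> x \<in> O2 \<and> fls_nth (x $ 1) 0 = c * fls_nth (x $ 2) 0" for x
  proof -
    have "inv2 ?A *v x \<in> O2 \<longleftrightarrow> tpow 1 * (x $ 1 - fls_const c * x $ 2) \<in> val_ge 0 \<and> x $ 2 \<in> val_ge 0"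
      by (simp add: A inv2_def det_mat2 O2_iff divide_inverse inverse_tpow tpow_mult_tpow algebra_simps)
    also have "\<dots> \<longleftrightarrow> (x $ 1 - fls_const c * x $ 2 \<in> val_ge 0 \<and> fls_nth (x $ 1 - fls_const c * x $ 2) 0 = 0) \<and> x $ 2 \<in> val_ge 0"
      by (simp only: tpow_mult_val_ge val_ge_succ)
    also have "\<dots> \<longleftrightarrow> x \<in> O2 \<and> fls_nth (x $ 1) 0 = c * fls_nth (x $ 2) 0"
    proof -
      have "x $ 1 - fls_const c * x $ 2 \<in> val_ge 0 \<longleftrightarrow> x $ 1 \<in> val_ge 0" if "x $ 2 \<in> val_ge 0"
        using val_ge_mult0[OF val_ge_const[of 0 c] that] val_ge_add[of _ 0 "fls_const c * x $ 2"] val_ge_diff[of _ 0 "fls_const c * x $ 2"]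
        by (metis diff_add_cancel order_refl)
      then show ?thesis by (auto simp: O2_iff)
    qed
    finally show ?thesis .
  qed
  have "det ?A \<noteq> 0" by (simp add: det_mul)
  from lattice_of_iff[OF this] eq show ?thesis by blast
qed

lemma lattice_of_neighbour_infinity: "lattice_of (swap2 ** abarz (- 1)) = {x \<in> O2. fls_nth (x $ 2) 0 = 0}"
proof -
  have *: "lattice_of (abarz (- 1)) = {x \<in> O2. fls_nth (x $ 1) 0 = (0::'a)}"
    using lattice_of_neighbour[of "0::'a"] by (simp add: u_mat_0)
  have sw: "swap2 *v (swap2 *v x) = x" for x :: "'a fls ^ 2"
    by (rule vec2_eqI) (simp_all add: swap2_def)
  have "lattice_of (swap2 ** abarz (- 1)) = (*v) swap2 ` (lattice_of (abarz (- 1)) :: ('a fls ^ 2) set)"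
    by (simp add: lattice_of_def image_image matrix_vector_mul_assoc)
  also have "\<dots> = {x. swap2 *v x \<in> lattice_of (abarz (- 1))}"
    using sw by (auto simp: image_iff) metis
  also have "\<dots> = {x \<in> O2. fls_nth (x $ 2) 0 = 0}"
    unfolding * by (auto simp: O2_iff swap2_def)
  finally show ?thesis .
qed

lemma adj_base_finite: "adj v_base (vtx (u_mat (fls_const c) ** abarz (- 1)))"
proof -
  let ?A = "u_mat (fls_const c) ** abarz (- 1)"
  let ?\<phi> = "\<lambda>x :: 'a fls ^ 2. fls_nth (x $ 1) 0 - c * fls_nth (x $ 2) 0"
  have "quot_iso_Fq O2 (lattice_of ?A)"
    unfolding quot_iso_Fq_def
  proof (intro exI[of _ ?\<phi>] conjI ballI)
    have "?\<phi> (vector [fls_const a, 0]) = a" "vector [fls_const a, 0] \<in> O2" for a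
      by (simp_all add: O2_iff val_ge_const)
    then have "a \<in> ?\<phi> ` O2" for a
      by (intro image_eqI[of a ?\<phi> "vector [fls_const a, 0]"]) simp_all
    then show "?\<phi> ` O2 = UNIV" by blast
  qed (auto simp: lattice_of_neighbour algebra_simps O_ring_val_ge O2_iff nth_0_mult)
  moreover have "(*s) unif ` O2 \<subset> lattice_of ?A"
  proof
    show "(*s) unif ` O2 \<subseteq> lattice_of ?A"
    proof
      fix x :: "'a fls ^ 2" assume "x \<in> (*s) unif ` O2"
      then obtain y where y: "y \<in> O2" "x = unif *s y" by blast
      then have "fls_nth (y $ 1) (- 1) = 0" "fls_nth (y $ 2) (- 1) = 0" by (simp_all add: O2_iff val_ge_def)
      moreover have "y $ 1 \<in> val_ge (- 1)" "y $ 2 \<in> val_ge (- 1)" 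
        using y(1) by (auto simp: O2_iff intro: val_ge_mono)
      ultimately show "x \<in> lattice_of ?A"
        by (simp add: y(2) lattice_of_neighbour O2_iff unif_tpow tpow_mult_val_ge nth_tpow_mult)
    qed
    have "vector [fls_const c, 1] \<in> lattice_of ?A"
      by (simp add: lattice_of_neighbour O2_iff val_ge_const)
    moreover have "vector [fls_const c, 1] \<notin> (*s) unif ` O2"
    proof
      assume "vector [fls_const c, 1] \<in> (*s) unif ` O2"
      then obtain y where y: "y \<in> O2" "vector [fls_const c, 1] = unif *s y" by blast
      then have "tpow (- 1) * y $ 2 \<in> val_ge 1" by (simp add: tpow_mult_val_ge O2_iff)
      moreover have "tpow (- 1) * y $ 2 = 1"
        using y(2) by (metis unif_tpow vector_2(2) vector_smult_component)
      ultimately show False by simp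
    qed
    ultimately show "(*s) unif ` O2 \<noteq> lattice_of ?A" by blast
  qed
  moreover have "lattice_of ?A \<subset> O2"
  proof
    have "vector [1, 0] \<in> O2" "vector [1, 0] \<notin> lattice_of ?A"
      by (simp_all add: lattice_of_neighbour O2_iff)
    then show "lattice_of ?A \<noteq> O2" by blast
  qed (auto simp: lattice_of_neighbour)
  moreover have "v_base \<in> vertices" "vtx ?A \<in> vertices"
    unfolding vertices_vtx v_base_vtx by (metis det_I zero_neq_one, metis det_mul det_abarz det_u_mat mult_eq_0_iff tpow_nz zero_neq_one)
  ultimately show ?thesis
    unfolding adj_def using hclass_self[of O2] hclass_self[of "lattice_of ?A"] unfolding v_base_def[symmetric] vtx_hclass[symmetric]
    by blast
qed

lemma vtx_abarz_1: "vtx (abarz 1 :: 'a::{field,finite} mat2) = vtx (swap2 ** abarz (- 1))"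
  using vtx_abarz_swap2[of "mat 1 :: 'a mat2" "- 1"] by simp

lemma vact_swap2_base: "vact swap2 v_base = v_base"
  using vtx_swap2[of "mat 1"] by (simp add: vtx_def)

lemma adj_base_infinity: "adj v_base (vtx (abarz 1))"
  using adj_vactI[of swap2, OF _ adj_base_finite[of 0]]
  by (simp add: vact_swap2_base vact_vtx u_mat_0 vtx_abarz_1)

text \<open>After scaling, the larger lattice is \<open>\<O>\<^sup>2\<close>.  The map onto \<open>\<bbbF>\<^sub>q\<close> kills \<open>\<pi> \<O>\<^sup>2\<close>, hence is a nonzero linear form in
  the two residues, and its kernel is a point of the projective line over \<open>\<bbbF>\<^sub>q\<close>.\<close>

lemma adj_base_cases:
  assumes "adj v_base w"
  shows "w = vtx (abarz 1) \<or> (\<exists>c. w = vtx (u_mat (fls_const c) ** abarz (- 1)))"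
proof -
  from assms obtain L L' where w: "w \<in> vertices" and L: "L \<in> v_base" "L' \<in> w" and "quot_iso_Fq L L'"
    unfolding adj_def by (elim exE conjE bexE)
  then obtain \<phi> where phi': "(\<forall>x\<in>L. \<forall>y\<in>L. \<phi> (x + y) = \<phi> x + \<phi> y)"
    "(\<forall>c\<in>O_ring. \<forall>x\<in>L. \<phi> (c *s x) = fls_nth c 0 * \<phi> x)" and phi_ker: "\<phi> ` L = UNIV" "{x \<in> L. \<phi> x = 0} = L'"
    unfolding quot_iso_Fq_def by (elim exE conjE) 
  have phi: "\<And>x y. x \<in> L \<Longrightarrow> y \<in> L \<Longrightarrow> \<phi> (x + y) = \<phi> x + \<phi> y"
    "\<And>c x. c \<in> O_ring \<Longrightarrow> x \<in> L \<Longrightarrow> \<phi> (c *s x) = fls_nth c 0 * \<phi> x"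
    "\<phi> ` L = UNIV" "{x \<in> L. \<phi> x = 0} = L'"
    using phi' phi_ker by simp_all
  obtain c where c: "c \<noteq> 0" "L = (*s) c ` O2"
    using L(1) by (auto simp: v_base_def hclass_def)
  have wL: "w = hclass L'"
  proof -
    obtain M where "w = hclass M" using w by (auto simp: vertices_def)
    moreover then obtain d where "d \<noteq> 0" "L' = (*s) d ` M" using L(2) by (auto simp: hclass_def)
    ultimately show ?thesis by (simp add: hclass_scale)
  qed
  define L'' where "L'' = (*s) (inverse c) ` L'"
  have wL'': "w = hclass L''" unfolding L''_def wL using c by (simp add: hclass_scale)
  define \<psi> where "\<psi> = (\<lambda>x. \<phi> (c *s x))"
  have mem: "c *s x \<in> L \<longleftrightarrow> x \<in> O2" for x
    using c by (auto simp: image_iff)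
  have add: "\<psi> (x + y) = \<psi> x + \<psi> y" if "x \<in> O2" "y \<in> O2" for x y
    using that phi(1) mem by (simp add: \<psi>_def vector_add_ldistrib)
  have smult: "\<psi> (d *s x) = fls_nth d 0 * \<psi> x" if "x \<in> O2" "d \<in> O_ring" for x d
    using that phi(2)[of d "c *s x"] mem by (simp add: \<psi>_def vector_smult_assoc mult.commute)
  have surj: "\<psi> ` O2 = UNIV"
    using phi(3) unfolding c(2) \<psi>_def by (simp add: image_image)
  have ker: "L'' = {x \<in> O2. \<psi> x = 0}"
  proof -
    have "x \<in> L'' \<longleftrightarrow> c *s x \<in> L'" for x
      using c by (auto simp: L''_def image_iff vector_smult_assoc) (metis left_inverse mult.commute vector_smult_assoc vector_smult_lid)
    then show ?thesis unfolding phi(4)[symmetric] by (auto simp: mem \<psi>_def)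
  qed
  define e1 e2 where "e1 = (vector [1, 0] :: 'a fls ^ 2)" and "e2 = (vector [0, 1] :: 'a fls ^ 2)"
  have psi: "\<psi> x = fls_nth (x $ 1) 0 * \<psi> e1 + fls_nth (x $ 2) 0 * \<psi> e2" if "x \<in> O2" for x
  proof -
    have "x = x $ 1 *s e1 + x $ 2 *s e2"
      by (rule vec2_eqI) (simp_all add: e1_def e2_def)
    moreover have "e1 \<in> O2" "e2 \<in> O2" "x $ 1 *s e1 \<in> O2" "x $ 2 *s e2 \<in> O2" "x $ 1 \<in> O_ring" "x $ 2 \<in> O_ring"
      using that by (simp_all add: e1_def e2_def O2_iff O_ring_val_ge)
    ultimately show ?thesis using add smult by metis
  qed
  show ?thesis
  proof (cases "\<psi> e1 = 0")
    case True
    then have "\<psi> e2 \<noteq> 0"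
    proof -
      have "(1::'a) \<in> \<psi> ` O2" using surj by simp
      then show ?thesis using psi True by auto
    qed
    then have "L'' = lattice_of (swap2 ** abarz (- 1))"
      unfolding ker lattice_of_neighbour_infinity using psi True by auto
    then have "w = vtx (swap2 ** abarz (- 1))" by (simp add: wL'' vtx_hclass)
    then show ?thesis by (simp add: vtx_abarz_1)
  next
    case False
    have "\<psi> x = 0 \<longleftrightarrow> fls_nth (x $ 1) 0 = (- \<psi> e2 / \<psi> e1) * fls_nth (x $ 2) 0" if "x \<in> O2" for x
      using False by (simp add: psi[OF that] field_simps eq_neg_iff_add_eq_0)
    then have "L'' = lattice_of (u_mat (fls_const (- \<psi> e2 / \<psi> e1)) ** abarz (- 1))"
      unfolding ker lattice_of_neighbour by auto
    then have "w = vtx (u_mat (fls_const (- \<psi> e2 / \<psi> e1)) ** abarz (- 1))" by (simp only: wL'' vtx_hclass)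
    then show ?thesis by blast
  qed
qed

text \<open>The \<open>q + 1\<close> neighbours.  The one at infinity, \<open>A abar\<^sub>1 v\<^sub>0\<close>, will be the predecessor of \<open>A v\<^sub>0\<close> on a path,
  and the \<open>q\<close> finite ones its possible successors.\<close>

lemma adj_vtx_iff:
  assumes A: "det A \<noteq> 0"
  shows "adj (vtx A) w \<longleftrightarrow> w = vtx (A ** abarz 1) \<or> (\<exists>c. w = vtx (A ** u_mat (fls_const c) ** abarz (- 1)))"
proof -
  have "adj (vtx A) w \<longleftrightarrow> adj v_base (vact (inv2 A) w)"
    using adj_vact[OF A, of v_base "vact (inv2 A) w"] by (simp add: vact_cancel A vtx_def)
  also have "\<dots> \<longleftrightarrow> vact (inv2 A) w = vtx (abarz 1) \<or> (\<exists>c. vact (inv2 A) w = vtx (u_mat (fls_const c) ** abarz (- 1)))"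
    using adj_base_cases adj_base_finite adj_base_infinity by metis
  also have "\<dots> \<longleftrightarrow> w = vact A (vtx (abarz 1)) \<or> (\<exists>c. w = vact A (vtx (u_mat (fls_const c) ** abarz (- 1))))"
    by (metis vact_cancel[OF A])
  finally show ?thesis by (simp add: vact_vtx matrix_mul_assoc)
qed

lemma adj_vtx_finite: "det A \<noteq> 0 \<Longrightarrow> adj (vtx A) (vtx (A ** u_mat (fls_const c) ** abarz (- 1)))"
  unfolding adj_vtx_iff by blast

lemma adj_vtx_infinity: "det A \<noteq> 0 \<Longrightarrow> adj (vtx A) (vtx (A ** abarz 1))"
  unfolding adj_vtx_iff by blast

lemma vtx_mult_cancel: "det A \<noteq> 0 \<Longrightarrow> vtx (A ** B) = vtx (A ** C) \<longleftrightarrow> vtx B = vtx C"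
  by (simp add: vact_inject flip: vact_vtx)

lemma vtx_u_abarz_eq_iff:
  assumes A: "det A \<noteq> 0"
  shows "vtx (A ** u_mat s ** abarz n) = vtx (A ** u_mat s' ** abarz n) \<longleftrightarrow> s' - s \<in> val_ge (- n)"
proof -
  have "abarz n ** u_mat (tpow (- n) * (s' - s)) = u_mat (s' - s) ** abarz n"
    by (simp add: abarz_u_mat tpow_mult_tpow_mult)
  then have "(A ** u_mat s ** abarz n) ** u_mat (tpow (- n) * (s' - s)) = A ** (u_mat s ** u_mat (s' - s)) ** abarz n"
    unfolding matrix_mul_assoc[symmetric] by (rule arg_cong)
  then have "A ** u_mat s' ** abarz n = (A ** u_mat s ** abarz n) ** u_mat (tpow (- n) * (s' - s))"
    by (simp add: u_mat_add)
  then have "vtx (A ** u_mat s ** abarz n) = vtx (A ** u_mat s' ** abarz n) \<longleftrightarrow>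
      vtx ((A ** u_mat s ** abarz n) ** mat 1) = vtx ((A ** u_mat s ** abarz n) ** u_mat (tpow (- n) * (s' - s)))"
    by simp
  also have "\<dots> \<longleftrightarrow> v_base = vtx (u_mat (tpow (- n) * (s' - s)))"
    by (subst vtx_mult_cancel) (simp_all add: A det_mul v_base_vtx)
  also have "\<dots> \<longleftrightarrow> s' - s \<in> val_ge (- n)"
    by (subst eq_commute, subst stabilizer_iff) (simp_all add: u_mat_def det_mat2 entries_mat2 tpow_mult_val_ge)
  finally show ?thesis .
qed

lemma vtx_u_abarz_neq:
  assumes A: "det A \<noteq> 0"
  shows "vtx (A ** abarz 1) \<noteq> vtx (A ** u_mat s ** abarz (- 1))"
proof
  assume *: "vtx (A ** abarz 1) = vtx (A ** u_mat s ** abarz (- 1))"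
  let ?C = "mat2 (tpow (- 2)) (tpow (- 1) * s) 0 1"
  have "A ** u_mat s ** abarz (- 1) = A ** abarz 1 ** ?C"
    by (simp add: u_mat_def abarz_def mat2_mult tpow_mult_tpow tpow_mult_tpow_mult flip: matrix_mul_assoc)
  with * have "vtx (A ** abarz 1 ** mat 1) = vtx (A ** abarz 1 ** ?C)" by simp
  then have "v_base = vtx ?C"
    by (subst (asm) vtx_mult_cancel) (simp_all add: A det_mul v_base_vtx)
  then have "vtx ?C = v_base" by simp
  then show False
    by (subst (asm) stabilizer_iff) (auto simp: det_mat2 entries_mat2)
qed

text \<open>Transitivity of the group on oriented edges, in the normal form on which the descendants of an
  edge have coordinates.\<close>

lemma edge_cases:
  assumes "adj z' z"
  obtains A where "det A \<noteq> 0" "z = vtx A" "z' = vtx (A ** abarz 1)"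
proof -
  obtain B where B: "det B \<noteq> 0" "z' = vtx B"
    using assms by (auto simp: adj_def vertices_vtx)
  then consider "z = vtx (B ** abarz 1)" | c where "z = vtx (B ** u_mat (fls_const c) ** abarz (- 1))"
    using assms adj_vtx_iff by blast
  then show ?thesis
  proof cases
    case 1
    let ?A = "B ** swap2 ** abarz (- 1)"
    have "vtx ?A = vtx (B ** abarz 1)" using vtx_abarz_swap2[of B "-1"] by simp
    moreover have "?A ** abarz 1 = B ** swap2" by (simp add: abarz_mult abarz_0 flip: matrix_mul_assoc)
    ultimately show ?thesis using 1 B that[of ?A] by (simp add: det_mul vtx_swap2)
  next
    case (2 c)
    let ?A = "B ** u_mat (fls_const c) ** abarz (- 1)"
    have "?A ** abarz 1 = B ** u_mat (fls_const c)" by (simp add: abarz_mult abarz_0 flip: matrix_mul_assoc)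
    then show ?thesis using 2 B that[of ?A] by (simp add: det_mul vtx_u_mat_int val_ge_const)
  qed
qed

lemma adj_edge: "det A \<noteq> 0 \<Longrightarrow> adj (vtx (A ** abarz 1)) (vtx A)"
proof -
  assume A: "det A \<noteq> 0"
  have "A ** abarz 1 ** u_mat (fls_const 0) ** abarz (- 1) = A"
    by (simp add: abarz_mult abarz_0 u_mat_0 flip: matrix_mul_assoc)
  then have "\<exists>c. vtx A = vtx (A ** abarz 1 ** u_mat (fls_const c) ** abarz (- 1))"
    by (intro exI[of _ 0]) simp
  then show ?thesis using adj_vtx_iff[of "A ** abarz 1" "vtx A"] A by (simp add: det_mul)
qed

section \<open>Heights modulo the polynomial matrices\<close>

text \<open>The determinant and its inverse are both polynomials, so they have degree zero.\<close>

lemma GL2_polyD: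
  fixes A :: "'a::{field,finite} mat2"
  assumes "A \<in> GL2_poly"
  shows "A $ i $ j \<in> Fq_poly" "det A \<noteq> 0" "fls_subdegree (det A) = 0" "inv2 A \<in> GL2_poly"
proof -
  from assms obtain B :: "'a mat2" where A: "\<And>i j. A $ i $ j \<in> Fq_poly" and B: "\<And>i j. B $ i $ j \<in> Fq_poly"
    and AB: "A ** B = mat 1" "B ** A = mat 1"
    unfolding GL2_poly_def by blast
  show "A $ i $ j \<in> Fq_poly" by (rule A)
  have det_poly: "det C \<in> Fq_poly" if "\<And>i j. C $ i $ j \<in> Fq_poly" for C :: "'a mat2"
    using that by (auto simp: det_2 intro!: Fq_poly_diff Fq_poly_mult)
  have prod: "det A * det B = 1" using AB(1) by (metis det_mul det_I)
  then show nz: "det A \<noteq> 0" by auto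
  have nz': "det B \<noteq> 0" using prod by auto
  have neg: "fls_subdegree f \<le> 0" if "f \<in> Fq_poly" for f
    by (rule ccontr) (use Fq_poly_val_ge_1[OF that, of "fls_subdegree f"] in \<open>auto simp: val_ge_iff\<close>)
  have "fls_subdegree (det A) + fls_subdegree (det B) = 0"
    using fls_subdegree_mult[OF nz nz'] prod by simp
  then show "fls_subdegree (det A) = 0"
    using neg[OF det_poly, of A] neg[OF det_poly, of B] A B by simp
  have "inv2 A = inv2 A ** (A ** B)" using AB by simp
  also have "\<dots> = B" using nz by (rule inv2_cancel(1))
  finally show "inv2 A \<in> GL2_poly" unfolding GL2_poly_def using A B AB by auto
qed

lemma GL2_poly_mult:
  fixes A B :: "'a::{field,finite} mat2"
  assumes "A \<in> GL2_poly" "B \<in> GL2_poly"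
  shows "A ** B \<in> GL2_poly"
proof -
  from assms obtain A' B' :: "'a mat2" where A: "\<And>i j. A $ i $ j \<in> Fq_poly" "\<And>i j. A' $ i $ j \<in> Fq_poly"
    "A ** A' = mat 1" "A' ** A = mat 1"
    and B: "\<And>i j. B $ i $ j \<in> Fq_poly" "\<And>i j. B' $ i $ j \<in> Fq_poly"
    "B ** B' = mat 1" "B' ** B = mat 1"
    unfolding GL2_poly_def by blast
  have m: "(C ** D) $ i $ j \<in> Fq_poly" if "\<And>i j. C $ i $ j \<in> Fq_poly" "\<And>i j. D $ i $ j \<in> Fq_poly" for C D :: "'a mat2" and i j
    using that by (auto simp: matrix_matrix_mult_def sum_2 intro!: Fq_poly_add Fq_poly_mult)
  have "A ** B ** (B' ** A') = A ** (B ** B') ** A'" by (simp only: matrix_mul_assoc)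
  then have 1: "A ** B ** (B' ** A') = mat 1" by (simp add: B A)
  have "B' ** A' ** (A ** B) = B' ** (A' ** A) ** B" by (simp only: matrix_mul_assoc)
  then have 2: "B' ** A' ** (A ** B) = mat 1" by (simp add: B A)
  show ?thesis unfolding GL2_poly_def
    using m[OF A(1) B(1)] m[OF B(2) A(2)] 1 2 by blast
qed

lemma GL2_polyI:
  fixes A :: "'a::{field,finite} mat2"
  assumes "det A = 1 \<or> det A = - 1" "A $ 1 $ 1 \<in> Fq_poly" "A $ 1 $ 2 \<in> Fq_poly" "A $ 2 $ 1 \<in> Fq_poly" "A $ 2 $ 2 \<in> Fq_poly"
  shows "A \<in> GL2_poly"
proof -
  have d: "det A \<noteq> 0" using assms(1) by auto
  have "\<forall>i j. inv2 A $ i $ j \<in> Fq_poly"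
    unfolding inv2_def entries_mat2 using assms by (auto intro: Fq_poly_minus)
  moreover have "\<forall>i j. A $ i $ j \<in> Fq_poly"
    using assms by (simp add: forall_2)
  ultimately show ?thesis unfolding GL2_poly_def using inv2_mult[OF d] by blast
qed

lemma u_mat_GL2_poly: "p \<in> Fq_poly \<Longrightarrow> u_mat p \<in> GL2_poly"
  by (rule GL2_polyI) (simp_all add: u_mat_def det_mat2)

lemma swap2_GL2_poly: "swap2 \<in> GL2_poly"
  by (rule GL2_polyI) (simp_all add: swap2_def det_mat2)

lemma one_GL2_poly: "mat 1 \<in> GL2_poly"
  by (rule GL2_polyI) (simp_all add: mat2_one det_mat2)

lemma Gam_GL2_poly: "A \<in> Gam \<Longrightarrow> A \<in> GL2_poly"
  by (rule GL2_polyI) (auto simp: Gam_def SL2_def)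

lemma v_ray_vtx: "v_ray n = vtx (abarz (int n))"
  by (simp add: v_ray_def vtx_def abar_abarz)

text \<open>The relation whose functionality makes the definite description in \<open>height\<close> meaningful.\<close>

definition has_height :: "'a::{field,finite} vertex \<Rightarrow> nat \<Rightarrow> bool"
  where "has_height v n \<longleftrightarrow> (\<exists>\<gamma>\<in>GL2_poly. v = vtx (\<gamma> ** abarz (int n)))"

lemma height_THE: "height v = (THE n. has_height v n)"
  by (simp add: height_def has_height_def v_ray_vtx vact_vtx)

lemma has_height_vactI:
  assumes "\<gamma> \<in> GL2_poly" "has_height v n"
  shows "has_height (vact \<gamma> v) n"
proof -
  obtain \<gamma>' where "\<gamma>' \<in> GL2_poly" "v = vtx (\<gamma>' ** abarz (int n))"
    using assms(2) unfolding has_height_def by blast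
  then show ?thesis
    using GL2_poly_mult[OF assms(1)] unfolding has_height_def
    by (intro bexI[of _ "\<gamma> ** \<gamma>'"]) (simp_all add: vact_vtx matrix_mul_assoc)
qed

lemma has_height_vact:
  assumes "\<gamma> \<in> GL2_poly"
  shows "has_height (vact \<gamma> v) n \<longleftrightarrow> has_height v n"
  using has_height_vactI[OF assms, of v n] has_height_vactI[OF GL2_polyD(4)[OF assms], of "vact \<gamma> v" n]
  by (auto simp: vact_cancel GL2_polyD(2)[OF assms])

lemma height_vact: "\<gamma> \<in> GL2_poly \<Longrightarrow> height (vact \<gamma> v) = height v"
  by (simp add: height_THE has_height_vact)

text \<open>If \<open>\<gamma> v\<^sub>n = v\<^sub>m\<close> with \<open>m < n\<close>, the stabilizer criterion bounds the degrees of the entries in the first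
  column of \<open>\<gamma>\<close> by negative numbers, so this column vanishes.\<close>

lemma ray_inequivalent_aux:
  assumes g: "\<gamma> \<in> GL2_poly" and eq: "vtx (\<gamma> ** abarz (int n)) = vtx (abarz (int m))"
  shows "n \<le> m"
proof (rule ccontr)
  assume "\<not> n \<le> m"
  then have nm: "m < n" by simp
  let ?C = "abarz (- int m) ** \<gamma> ** abarz (int n)"
  have d: "det \<gamma> \<noteq> 0" "fls_subdegree (det \<gamma>) = 0" using GL2_polyD[OF g] by auto
  have "vtx ?C = vact (abarz (- int m)) (vtx (abarz (int m)))"
    unfolding eq[symmetric] vact_vtx by (simp add: matrix_mul_assoc)
  then have "vtx ?C = v_base" by (simp add: vact_vtx abarz_mult abarz_0 v_base_vtx)
  moreover have "det ?C \<noteq> 0" by (simp add: det_mul d)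
  ultimately obtain e where e: "fls_subdegree (det ?C) = 2 * e" "\<And>i j. ?C $ i $ j \<in> val_ge e"
    using stabilizer_iff by blast
  obtain a b c d' where abcd: "\<gamma> = mat2 a b c d'" by (cases \<gamma> rule: mat2_cases)
  have poly: "a \<in> Fq_poly" "c \<in> Fq_poly"
    using GL2_polyD(1)[OF g, of 1 1] GL2_polyD(1)[OF g, of 2 1] by (simp_all add: abcd)
  have "tpow (- int m) * a * tpow (int n) = a * (tpow (int n) * tpow (- int m))" by (simp add: algebra_simps)
  then have "tpow (- int m) * a * tpow (int n) = tpow (int n - int m) * a" by (simp add: tpow_mult_tpow mult.commute)
  then have C: "?C = mat2 (tpow (int n - int m) * a) (tpow (- int m) * b) (tpow (int n) * c) d'"
    by (simp add: abcd abarz_def mat2_mult mult.commute)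
  have e2: "2 * e = int m - int n"
    using e(1) d by (simp add: det_mul)
  have "tpow (int n - int m) * a \<in> val_ge e" "tpow (int n) * c \<in> val_ge e"
    using e(2)[of 1 1] e(2)[of 2 1] unfolding C by simp_all
  then have "a \<in> val_ge (e + (int n - int m))" "c \<in> val_ge (e + int n)"
    by (simp_all add: tpow_mult_val_ge)
  moreover have "e + (int n - int m) \<ge> 1" "e + int n \<ge> 1" using e2 nm by linarith+
  ultimately have "a = 0" "c = 0" using poly Fq_poly_val_ge_1 by blast+
  then show False using d by (simp add: abcd det_mat2)
qed

lemma has_height_unique:
  assumes "has_height v n" "has_height v m"
  shows "n = m"
proof -
  have "n \<le> m" if "has_height v n" "has_height v m" for n m
  proof -
    from that obtain \<gamma> \<gamma>' where g: "\<gamma> \<in> GL2_poly" "\<gamma>' \<in> GL2_poly" "v = vtx (\<gamma> ** abarz (int n))" "v = vtx (\<gamma>' ** abarz (int m))"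
      unfolding has_height_def by blast
    have d: "det \<gamma>' \<noteq> 0" using GL2_polyD(2)[OF g(2)] .
    have "vact (inv2 \<gamma>') (vtx (\<gamma> ** abarz (int n))) = vact (inv2 \<gamma>') (vtx (\<gamma>' ** abarz (int m)))"
      using g by simp
    then have "vtx (inv2 \<gamma>' ** \<gamma> ** abarz (int n)) = vtx (abarz (int m))"
      unfolding vact_vtx by (simp add: matrix_mul_assoc inv2_mult[OF d])
    then show ?thesis
      using ray_inequivalent_aux GL2_poly_mult[OF GL2_polyD(4)[OF g(2)] g(1)] by blast
  qed
  then show ?thesis using assms by (simp add: antisym)
qed

lemma height_eqI: "has_height v n \<Longrightarrow> height v = n"
  unfolding height_THE using has_height_unique by blast

lemma has_height_ray: "has_height (vtx (abarz (int n))) n"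
  unfolding has_height_def using one_GL2_poly by (metis matrix_mul_lid)

lemma has_height_u_mat: "p \<in> Fq_poly \<Longrightarrow> has_height (vtx (u_mat p ** A)) n \<longleftrightarrow> has_height (vtx A) n"
  using has_height_vact[OF u_mat_GL2_poly, of p "vtx A" n] by (simp add: vact_vtx)

lemma neighbour_down:
  assumes "n \<ge> 1"
  shows "has_height (vtx (abarz (int n) ** u_mat (fls_const c) ** abarz (- 1))) (n - 1)"
proof -
  have "abarz (int n) ** u_mat (fls_const c) ** abarz (- 1) = u_mat (tpow (int n) * fls_const c) ** abarz (int (n - 1))"
    using assms by (simp add: abarz_u_mat abarz_mult of_nat_diff flip: matrix_mul_assoc)
  moreover have "tpow (int n) * fls_const c \<in> Fq_poly" by (simp add: Fq_poly_mult Fq_poly_tpow Fq_poly_const)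
  ultimately show ?thesis by (simp only: has_height_u_mat has_height_ray)
qed

lemma neighbour_root:
  "has_height (vtx (u_mat (fls_const c) ** abarz (- 1))) 1"
proof -
  have "vtx (u_mat (fls_const c) ** abarz (- 1)) = vtx (u_mat (fls_const c) ** swap2 ** abarz 1)"
    by (rule vtx_abarz_swap2[symmetric])
  moreover have "u_mat (fls_const c) ** swap2 \<in> GL2_poly"
    by (intro GL2_poly_mult u_mat_GL2_poly swap2_GL2_poly Fq_poly_const)
  ultimately show ?thesis unfolding has_height_def by (intro bexI) simp_all
qed

text \<open>Translating by \<open>\<gamma>\<close> moves the vertex to \<open>v\<^sub>n\<close>.  Its neighbour at infinity is \<open>v\<^bsub>n+1\<^esub>\<close>; the finite ones are
  \<open>u(c t\<^sup>n) v\<^bsub>n-1\<^esub>\<close> with a polynomial parameter, or for \<open>n = 0\<close> the images of \<open>v\<^sub>1\<close> under \<open>u(c) swap2\<close>.\<close>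

lemma has_height_adj:
  assumes "adj z w" "has_height z n"
  shows "has_height w (n + 1) \<or> n \<ge> 1 \<and> has_height w (n - 1)"
proof -
  obtain \<gamma> where g: "\<gamma> \<in> GL2_poly" "z = vtx (\<gamma> ** abarz (int n))"
    using assms(2) unfolding has_height_def by blast
  have d: "det (\<gamma> ** abarz (int n)) \<noteq> 0" using GL2_polyD(2)[OF g(1)] by (simp add: det_mul)
  then consider "w = vtx (\<gamma> ** abarz (int n) ** abarz 1)"
    | c where "w = vtx (\<gamma> ** abarz (int n) ** u_mat (fls_const c) ** abarz (- 1))"
    using assms(1) adj_vtx_iff[OF d] unfolding g(2) by blast
  then show ?thesis
  proof cases
    case 1
    then have "w = vact \<gamma> (vtx (abarz (int (n + 1))))"
      by (simp add: vact_vtx abarz_mult add.commute flip: matrix_mul_assoc)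
    then show ?thesis using has_height_vact[OF g(1)] has_height_ray by metis
  next
    case (2 c)
    then have w: "w = vact \<gamma> (vtx (abarz (int n) ** u_mat (fls_const c) ** abarz (- 1)))"
      by (simp add: vact_vtx matrix_mul_assoc)
    show ?thesis
    proof (cases "n = 0")
      case True
      then show ?thesis
        using w has_height_vact[OF g(1)] neighbour_root[of c] by (simp add: abarz_0)
    next
      case False
      then show ?thesis
        using w has_height_vact[OF g(1)] neighbour_down[of n c] by simp
    qed
  qed
qed

text \<open>Each step away from \<open>v\<^sub>0\<close> changes the height by one.  The bound \<open>N\<close> is what later confines the heights
  on an orbit with rational endpoint.\<close>

lemma has_height_below:
  fixes s :: "'a::{field,finite} fls"
  assumes "s \<in> val_ge 0"
  shows "\<exists>k\<le>N. has_height (vtx (u_mat s ** abarz (- int N))) k"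
proof (induction N)
  case 0
  have "vtx (u_mat s ** abarz (- int 0)) = vtx (abarz (int 0))"
    using vtx_u_mat_int[OF assms, of "mat 1"] by (simp add: abarz_0)
  then show ?case using has_height_ray[of 0] by auto
next
  case (Suc N)
  then obtain k where k: "k \<le> N" "has_height (vtx (u_mat s ** abarz (- int N))) k" by blast
  have "u_mat s ** abarz (- int (Suc N)) = u_mat s ** abarz (- int N) ** u_mat (fls_const 0) ** abarz (- 1)"
  proof -
    have "abarz (- int (Suc N)) = abarz (- int N) ** (abarz (- 1) :: 'a mat2)" by (simp add: abarz_mult algebra_simps)
    then show ?thesis by (simp add: u_mat_0 matrix_mul_assoc)
  qed
  then have "adj (vtx (u_mat s ** abarz (- int N))) (vtx (u_mat s ** abarz (- int (Suc N))))"
    using adj_vtx_finite[of "u_mat s ** abarz (- int N)" 0] by (simp only: det_mul det_abarz det_u_mat) simp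
  from has_height_adj[OF this k(2)] show ?case
  proof
    assume "has_height (vtx (u_mat s ** abarz (- int (Suc N)))) (k + 1)"
    then show ?case using k(1) by (intro exI[of _ "k + 1"]) simp
  next
    assume "k \<ge> 1 \<and> has_height (vtx (u_mat s ** abarz (- int (Suc N)))) (k - 1)"
    then show ?case using k(1) by (intro exI[of _ "k - 1"]) simp
  qed
qed

text \<open>Column operations over \<open>\<O>\<close> clear the lower left entry once the larger entry of the second row
  stands on the right.\<close>

lemma vertex_Iwasawa:
  assumes "det A \<noteq> 0"
  obtains s n where "vtx A = vtx (u_mat s ** abarz n)"
proof -
  have main: "\<exists>s n. vtx (mat2 a b c d) = vtx (u_mat s ** abarz n)"
    if det: "det (mat2 a b c d) \<noteq> 0" and d: "d \<noteq> 0" and cd: "c / d \<in> val_ge 0" for a b c d :: "'a fls"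
  proof -
    define a' where "a' = a - b * (c / d)"
    \<comment> \<open>an integral column operation clears the lower left entry; then the scalar \<open>d\<close> is divided out\<close>
    have "mat2 a b c d ** mat2 1 0 (- (c / d)) 1 = scalar_mat d ** mat2 (a' / d) (b / d) 0 1"
      using d by (simp add: mat2_mult scalar_mat_def a'_def field_simps)
    moreover have "vtx (mat2 a b c d ** mat2 1 0 (- (c / d)) 1) = vtx (mat2 a b c d)"
      by (rule vtx_mult_stabilizer)
        (subst stabilizer_iff, use cd in \<open>auto simp: det_mat2 entries_mat2 intro!: exI[of _ 0]\<close>)
    ultimately have 1: "vtx (mat2 a b c d) = vtx (mat2 (a' / d) (b / d) 0 1)"
      using vtx_scalar_mat[OF d] by simp
    have "a' / d \<noteq> 0"
      using det d by (auto simp: a'_def det_mat2 field_simps)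
    then obtain w where w: "w \<in> val_ge 0" "inverse w \<in> val_ge 0" "w \<noteq> 0" 
        "a' / d = tpow (- fls_subdegree (a' / d)) * w"
      by (rule unit_times_tpow)
    let ?n = "- fls_subdegree (a' / d)"
    have "mat2 (a' / d) (b / d) 0 1 = u_mat (b / d) ** abarz ?n ** mat2 w 0 0 1"
      using w(4) by (simp add: u_mat_def abarz_def mat2_mult)
    moreover have "fls_subdegree w = 0" using w(1,2,3) by (auto simp: val_ge_iff)
    then have "vtx (u_mat (b / d) ** abarz ?n ** mat2 w 0 0 1) = vtx (u_mat (b / d) ** abarz ?n)"
      by (intro vtx_mult_stabilizer)
        (subst stabilizer_iff, use w in \<open>auto simp: det_mat2 entries_mat2 intro!: exI[of _ 0]\<close>)
    ultimately show ?thesis using 1 by metis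
  qed
  obtain a b c d where A: "A = mat2 a b c d" by (cases A rule: mat2_cases)
  have "\<exists>s n. vtx A = vtx (u_mat s ** abarz n)"
  proof (cases "d \<noteq> 0 \<and> c / d \<in> val_ge 0")
    case True
    then show ?thesis using main assms unfolding A by blast
  next
    case False
    have c: "c \<noteq> 0" using assms False by (auto simp: A det_mat2)
    then have "d / c \<in> val_ge 0"
      using False by (auto simp: val_ge_iff fls_divide_subdegree)
    moreover have "vtx (mat2 b a d c) = vtx A"
      using vtx_swap2[of A] by (simp add: A swap2_def mat2_mult)
    moreover have "det (mat2 b a d c) \<noteq> 0" using assms by (simp add: A det_mat2 mult.commute)
    ultimately show ?thesis using main[of b a d c] c by metis
  qed
  then show ?thesis using that by blast
qed

lemma has_height_exists:
  assumes "det A \<noteq> 0"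
  shows "\<exists>n. has_height (vtx A) n"
proof -
  obtain s n where sn: "vtx A = vtx (u_mat s ** abarz n)" using vertex_Iwasawa[OF assms] .
  obtain p where p: "p \<in> Fq_poly" "s - p \<in> val_ge 1" by (rule polynomial_part_exists)
  have "u_mat s ** abarz n = u_mat p ** (u_mat (s - p) ** abarz n)"
    by (simp add: matrix_mul_assoc u_mat_add)
  then have eq: "has_height (vtx A) k \<longleftrightarrow> has_height (vtx (u_mat (s - p) ** abarz n)) k" for k
    using has_height_u_mat[OF p(1)] sn by simp
  show ?thesis
  proof (cases "n \<ge> 0")
    case True
    then have "vtx (mat 1 ** u_mat (s - p) ** abarz n) = vtx (mat 1 ** abarz n)"
      using val_ge_mono[OF p(2), of "- n"] by (intro vtx_u_mat_abarz) simp
    then have "has_height (vtx (u_mat (s - p) ** abarz n)) (nat n)"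
      using has_height_ray[of "nat n"] True by simp
    then show ?thesis using eq by blast
  next
    case False
    have "\<exists>k\<le>nat (- n). has_height (vtx (u_mat (s - p) ** abarz (- int (nat (- n))))) k"
      using val_ge_mono[OF p(2), of 0] by (intro has_height_below) simp
    then show ?thesis using eq False by auto
  qed
qed

lemma has_height_height: "det A \<noteq> 0 \<Longrightarrow> has_height (vtx A) (height (vtx A))"
  using has_height_exists height_eqI by metis

lemma height_ray: "height (vtx (abarz (int n))) = n"
  by (rule height_eqI, rule has_height_ray)

lemma height_base: "height v_base = 0"
  using height_ray[of 0] by (simp add: abarz_0 v_base_vtx)

text \<open>The stabilizer criterion fixes the parity of the valuation of the determinant.\<close>

lemma height_parity:
  assumes "det A \<noteq> 0"
  shows "even (int (height (vtx A)) + fls_subdegree (det A))"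
proof -
  obtain \<gamma> where g: "\<gamma> \<in> GL2_poly" "vtx A = vtx (\<gamma> ** abarz (int (height (vtx A))))"
    using has_height_height[OF assms] unfolding has_height_def by blast
  let ?C = "inv2 A ** (\<gamma> ** abarz (int (height (vtx A))))"
  have dg: "det \<gamma> \<noteq> 0" "fls_subdegree (det \<gamma>) = 0" using GL2_polyD[OF g(1)] by auto
  have "vtx (A ** ?C) = vtx (A ** mat 1)" using g(2) by (simp add: inv2_cancel[OF assms])
  then have "vtx ?C = v_base" using vtx_mult_cancel[OF assms] by (metis v_base_vtx)
  moreover have "det ?C \<noteq> 0" using dg det_inv2[OF assms] by (simp add: det_mul)
  ultimately obtain e where e: "fls_subdegree (det ?C) = 2 * e" using stabilizer_iff by blast
  have "det (A ** ?C) = det \<gamma> * tpow (int (height (vtx A)))" by (simp add: inv2_cancel[OF assms] det_mul)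
  then have "fls_subdegree (det A * det ?C) = - int (height (vtx A))"
    using dg by (simp add: det_mul[of A])
  then have "fls_subdegree (det A) + 2 * e = - int (height (vtx A))"
    using e assms \<open>det ?C \<noteq> 0\<close> by simp
  then have "int (height (vtx A)) + fls_subdegree (det A) = 2 * (- e)" by simp
  then show ?thesis by simp
qed

lemma adj_vertex: "adj z w \<Longrightarrow> z \<in> vertices" "adj z w \<Longrightarrow> w \<in> vertices"
  by (auto simp: adj_def)

lemma height_adj:
  assumes "adj z w"
  shows "height w = height z + 1 \<or> height z = height w + 1"
proof -
  obtain A where A: "det A \<noteq> 0" "z = vtx A" using adj_vertex(1)[OF assms] by (auto simp: vertices_vtx)
  have "has_height z (height z)" using has_height_height[OF A(1)] A(2) by simp
  from has_height_adj[OF assms this] show ?thesis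
    by (auto dest: height_eqI)
qed

text \<open>At \<open>v\<^sub>n\<close> with \<open>n \<ge> 1\<close> only the neighbour at infinity goes up.\<close>

lemma unique_up_neighbour:
  assumes "z \<in> vertices" "height z \<ge> 1"
  shows "\<exists>!w. adj z w \<and> height w = height z + 1"
proof -
  obtain A where A: "det A \<noteq> 0" "z = vtx A" using assms by (auto simp: vertices_vtx)
  let ?n = "height z"
  obtain \<gamma> where g: "\<gamma> \<in> GL2_poly" "z = vtx (\<gamma> ** abarz (int ?n))"
    using has_height_height[OF A(1)] unfolding has_height_def A(2) by blast
  have d: "det (\<gamma> ** abarz (int ?n)) \<noteq> 0" using GL2_polyD(2)[OF g(1)] by (simp add: det_mul)
  let ?w = "vtx (\<gamma> ** abarz (int ?n) ** abarz 1)"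
  have adj: "adj z w \<longleftrightarrow> w = ?w \<or> (\<exists>c. w = vtx (\<gamma> ** abarz (int ?n) ** u_mat (fls_const c) ** abarz (- 1)))" for w
    using adj_vtx_iff[OF d] g(2) by metis
  have "?w = vact \<gamma> (vtx (abarz (int (?n + 1))))"
    by (simp add: vact_vtx abarz_mult add.commute flip: matrix_mul_assoc)
  then have up: "height ?w = ?n + 1"
    using height_vact[OF g(1)] height_ray by metis
  have "height (vtx (\<gamma> ** abarz (int ?n) ** u_mat (fls_const c) ** abarz (- 1))) = ?n - 1" for c
  proof -
    have "vtx (\<gamma> ** abarz (int ?n) ** u_mat (fls_const c) ** abarz (- 1)) = vact \<gamma> (vtx (abarz (int ?n) ** u_mat (fls_const c) ** abarz (- 1)))"
      by (simp add: vact_vtx matrix_mul_assoc)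
    then show ?thesis using height_vact[OF g(1)] height_eqI[OF neighbour_down[OF assms(2)]] by metis
  qed
  then show ?thesis using adj up by (intro ex1I[of _ ?w]) auto
qed

section \<open>Descendants, digits and shadows\<close>

text \<open>Representatives of \<open>\<O> / \<pi>\<^sup>N \<O>\<close>: polynomials of degree below \<open>N\<close> in \<open>\<pi>\<close>.  They are built from the constant
  coefficient outwards, since this digit decides the first step of a descending path.\<close>

primrec digit_reps :: "nat \<Rightarrow> 'a::{field,finite} fls set" where
  "digit_reps 0 = {0}"
| "digit_reps (Suc N) = (\<lambda>(c, s). fls_const c + tpow (- 1) * s) ` (UNIV \<times> digit_reps N)"

lemma digit_reps_val_ge: "s \<in> digit_reps N \<Longrightarrow> s \<in> val_ge 0"
proof (induction N arbitrary: s)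
  case (Suc N)
  then obtain c s' where s': "s' \<in> digit_reps N" "s = fls_const c + tpow (- 1) * s'" by auto
  then have "s' \<in> val_ge (- 1)" using Suc.IH val_ge_mono by force
  then show ?case unfolding s'(2) by (intro val_ge_add val_ge_const) (simp_all add: tpow_mult_val_ge)
qed simp

lemma digit_nth:
  assumes "s \<in> val_ge 0"
  shows "fls_nth (fls_const c + tpow (- 1) * s) 0 = c"
  using assms by (simp add: nth_tpow_mult val_ge_def)

lemma digit_inj: "inj_on (\<lambda>(c, s). fls_const c + tpow (- 1) * s) (UNIV \<times> digit_reps N)"
proof (rule inj_onI, clarsimp)
  fix c s c' s' assume s: "s \<in> digit_reps N" "s' \<in> digit_reps N"
    and eq: "fls_const c + tpow (- 1) * s = fls_const c' + tpow (- 1) * s'"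
  then have "c = c'" using digit_nth[OF digit_reps_val_ge, of s N c] digit_nth[OF digit_reps_val_ge, of s' N c'] by simp
  with eq show "c = c' \<and> s = s'" by simp
qed

lemma sum_digit_reps_Suc:
  "sum F (digit_reps (Suc N)) = (\<Sum>c\<in>UNIV. \<Sum>s\<in>digit_reps N. F (fls_const c + tpow (- 1) * s))"
  unfolding digit_reps.simps by (subst sum.reindex[OF digit_inj]) (simp add: case_prod_unfold sum.cartesian_product comp_def)

lemma finite_digit_reps [simp]: "finite (digit_reps N)"
  by (induction N) auto

lemma card_digit_reps: "card (digit_reps N :: 'a::{field,finite} fls set) = CARD('a) ^ N"
proof (induction N)
  case (Suc N)
  then show ?case unfolding digit_reps.simps by (subst card_image[OF digit_inj]) (simp add: card_cartesian_product)
qed simp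

lemma digit_reps_cong_imp_eq:
  "r \<in> digit_reps N \<Longrightarrow> r' \<in> digit_reps N \<Longrightarrow> r - r' \<in> val_ge (int N) \<Longrightarrow> r = r'"
proof (induction N arbitrary: r r')
  case (Suc N)
  then obtain c s c' s' where s: "s \<in> digit_reps N" "r = fls_const c + tpow (- 1) * s"
    "s' \<in> digit_reps N" "r' = fls_const c' + tpow (- 1) * s'" by auto
  have "fls_nth (r - r') 0 = 0" using Suc.prems(3) by (simp add: val_ge_def)
  then have c: "c = c'"
    using digit_nth[OF digit_reps_val_ge[OF s(1)], of c] digit_nth[OF digit_reps_val_ge[OF s(3)], of c'] s(2,4) by simp
  then have "r - r' = tpow (- 1) * (s - s')" using s by (simp add: algebra_simps)
  then have "s - s' \<in> val_ge (int N)" using Suc.prems(3) by (simp add: tpow_mult_val_ge)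
  then show ?case using Suc.IH s c by blast
qed simp

lemma digit_reps_exists:
  "f \<in> val_ge 0 \<Longrightarrow> \<exists>r\<in>digit_reps N. f - r \<in> val_ge (int N)"
proof (induction N arbitrary: f)
  case (Suc N)
  define f' where "f' = tpow 1 * (f - fls_const (fls_nth f 0))"
  have "f - fls_const (fls_nth f 0) \<in> val_ge (0 + 1)"
    unfolding val_ge_succ using Suc.prems by (auto intro: val_ge_diff val_ge_const)
  then have "f' \<in> val_ge 0" by (simp add: f'_def tpow_mult_val_ge)
  then obtain r' where r': "r' \<in> digit_reps N" "f' - r' \<in> val_ge (int N)" using Suc.IH by blast
  let ?r = "fls_const (fls_nth f 0) + tpow (- 1) * r'"
  have "tpow (- 1) * f' = f - fls_const (fls_nth f 0)" by (simp add: f'_def tpow_mult_tpow_mult)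
  then have "f - ?r = tpow (- 1) * (f' - r')" by (simp add: algebra_simps)
  then have "f - ?r \<in> val_ge (int (Suc N))" using r' by (simp add: tpow_mult_val_ge)
  moreover have "?r \<in> digit_reps (Suc N)" using r' by force
  ultimately show ?case by blast
qed simp

definition desc_vertex :: "'a::{field,finite} mat2 \<Rightarrow> nat \<Rightarrow> 'a fls \<Rightarrow> 'a vertex"
  where "desc_vertex A N s = vtx (A ** u_mat s ** abarz (- int N))"

abbreviation child :: "'a::{field,finite} mat2 \<Rightarrow> 'a \<Rightarrow> 'a mat2"
  where "child A c \<equiv> A ** u_mat (fls_const c) ** abarz (- 1)"

lemma desc_vertex_0: "desc_vertex A 0 0 = vtx A"
  by (simp add: desc_vertex_def u_mat_0 abarz_0)

text \<open>Removing the leading digit moves the edge one step down, because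
  \<open>u(c + \<pi> s) abar\<^bsub>-N-1\<^esub> = u(c) abar\<^bsub>-1\<^esub> u(s) abar\<^bsub>-N\<^esub>\<close>.\<close>

lemma desc_vertex_Suc: "desc_vertex A (Suc N) (fls_const c + tpow (- 1) * s) = desc_vertex (child A c) N s"
proof -
  have "u_mat (fls_const c) ** abarz (- 1) ** u_mat s ** abarz (- int N)
      = u_mat (fls_const c) ** (abarz (- 1) ** u_mat s) ** abarz (- int N)" by (simp only: matrix_mul_assoc)
  also have "\<dots> = (u_mat (fls_const c) ** u_mat (tpow (- 1) * s)) ** (abarz (- 1) ** abarz (- int N))"
    by (simp only: abarz_u_mat matrix_mul_assoc)
  also have "\<dots> = u_mat (fls_const c + tpow (- 1) * s) ** abarz (- int (Suc N))"
    by (simp add: u_mat_add abarz_mult)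
  finally have "A ** (u_mat (fls_const c) ** abarz (- 1) ** u_mat s ** abarz (- int N))
      = A ** (u_mat (fls_const c + tpow (- 1) * s) ** abarz (- int (Suc N)))" by (rule arg_cong)
  then show ?thesis by (simp only: desc_vertex_def matrix_mul_assoc)
qed

lemma det_child: "det A \<noteq> 0 \<Longrightarrow> det (child A c) \<noteq> 0"
  by (simp add: det_mul)

lemma vtx_child_back: "vtx (child A c ** abarz 1) = vtx A"
proof -
  have "child A c ** abarz 1 = A ** u_mat (fls_const c)" by (simp add: abarz_mult abarz_0 flip: matrix_mul_assoc)
  then show ?thesis by (simp add: vtx_u_mat_int val_ge_const)
qed

lemma desc_vertex_inj:
  assumes "det A \<noteq> 0"
  shows "inj_on (desc_vertex A N) (digit_reps N)"
proof (rule inj_onI)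
  fix s s' assume "s \<in> digit_reps N" "s' \<in> digit_reps N" "desc_vertex A N s = desc_vertex A N s'"
  then show "s = s'"
    using vtx_u_abarz_eq_iff[OF assms, of s "- int N" s'] digit_reps_cong_imp_eq[of s' N s]
    by (simp add: desc_vertex_def)
qed

text \<open>The normal form of an oriented edge, pointing away from the end \<open>A \<infinity>\<close>.\<close>

definition edge_at :: "'a::{field,finite} mat2 \<Rightarrow> 'a vertex \<times> 'a vertex"
  where "edge_at A = (vtx (A ** abarz 1), vtx A)"

lemma edge_at_child: "edge_at (child A c) = (vtx A, vtx (child A c))"
  by (simp add: edge_at_def vtx_child_back)

lemma Desc_0: "adj z' z \<Longrightarrow> Desc 0 (z', z) = {z}"
proof -
  assume a: "adj z' z"
  have "nb_path 0 [z', z]" using a by (simp add: nb_path_def)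
  then have "\<exists>p. z = p ! (0 + 1) \<and> nb_path 0 p \<and> p ! 0 = fst (z', z) \<and> p ! 1 = snd (z', z)"
    by (intro exI[of _ "[z', z]"]) simp
  then show ?thesis unfolding Desc_def by auto
qed

lemma nb_path_Cons:
  "nb_path (Suc N) (z' # z # w # p) \<longleftrightarrow> adj z' z \<and> w \<noteq> z' \<and> nb_path N (z # w # p)"
  unfolding nb_path_def add_2_eq_Suc' Suc_eq_plus1[symmetric] by (auto simp: All_less_Suc2)

lemma Desc_Suc:
  assumes "adj z' z"
  shows "Desc (Suc N) (z', z) = (\<Union>w\<in>{w. adj z w \<and> w \<noteq> z'}. Desc N (z, w))"
proof (intro equalityI subsetI)
  fix v assume "v \<in> Desc (Suc N) (z', z)"
  then obtain p where p: "nb_path (Suc N) p" "p ! 0 = z'" "p ! 1 = z" "v = p ! (Suc N + 1)"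
    unfolding Desc_def by auto
  then have "length p = Suc (Suc (Suc N))" by (simp add: nb_path_def)
  then obtain a b w q where pq: "p = a # b # w # q"
    by (auto simp: length_Suc_conv)
  then have ab: "a = z'" "b = z" using p by auto
  then have nb: "nb_path N (z # w # q)" "w \<noteq> z'" using p(1) nb_path_Cons unfolding pq by blast+
  then have "adj z w" unfolding nb_path_def by (auto dest: spec[of _ 0])
  moreover have "v \<in> Desc N (z, w)"
    unfolding Desc_def using nb(1) p(4) pq by (auto intro!: exI[of _ "z # w # q"])
  ultimately show "v \<in> (\<Union>w\<in>{w. adj z w \<and> w \<noteq> z'}. Desc N (z, w))" using nb(2) by blast
next
  fix v assume "v \<in> (\<Union>w\<in>{w. adj z w \<and> w \<noteq> z'}. Desc N (z, w))"
  then obtain w p where w: "adj z w" "w \<noteq> z'" and p: "nb_path N p" "p ! 0 = z" "p ! 1 = w" "v = p ! (N + 1)"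
    unfolding Desc_def by auto
  then have "length p = Suc (Suc N)" by (simp add: nb_path_def)
  then obtain a b q where pq: "p = a # b # q" by (auto simp: length_Suc_conv)
  then have "p = z # w # q" using p by auto
  then have "nb_path (Suc N) (z' # p)" using p(1) w assms nb_path_Cons by blast
  then show "v \<in> Desc (Suc N) (z', z)"
    unfolding Desc_def using p by (auto intro!: exI[of _ "z' # p"])
qed

text \<open>Induction on the depth: a non-backtracking continuation avoids the neighbour at infinity, so it
  passes through \<open>child A c\<close> for some digit \<open>c\<close>, whose own neighbour at infinity is the present vertex.\<close>

lemma Desc_edge_at:
  assumes "det A \<noteq> 0"
  shows "Desc N (edge_at A) = desc_vertex A N ` digit_reps N"
  using assms
proof (induction N arbitrary: A)
  case 0
  then show ?case using Desc_0[OF adj_edge] by (simp add: edge_at_def desc_vertex_0)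
next
  case (Suc N)
  have "{w. adj (vtx A) w \<and> w \<noteq> vtx (A ** abarz 1)} = range (\<lambda>c. vtx (child A c))"
    using adj_vtx_iff[OF Suc.prems] vtx_u_abarz_neq[OF Suc.prems] by (auto simp del: UNIV_I)
  then have "Desc (Suc N) (edge_at A) = (\<Union>c. Desc N (edge_at (child A c)))"
    unfolding edge_at_child unfolding edge_at_def using Desc_Suc[OF adj_edge[OF Suc.prems], of N] by simp
  also have "\<dots> = (\<Union>c. desc_vertex (child A c) N ` digit_reps N)"
    using Suc.IH[OF det_child[OF Suc.prems]] by simp
  also have "\<dots> = desc_vertex A (Suc N) ` digit_reps (Suc N)"
    by (auto simp: desc_vertex_Suc image_image case_prod_unfold image_iff) (metis fst_conv snd_conv)+
  finally show ?case .
qed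

text \<open>The mean of \<open>\<Phi>\<close> over the heights of the descendants, with values in a vector space so that indicators
  and complex profiles are treated together.\<close>

definition desc_mean :: "'a::{field,finite} mat2 \<Rightarrow> nat \<Rightarrow> (nat \<Rightarrow> 'b::real_vector) \<Rightarrow> 'b"
  where "desc_mean A N \<Phi> = (1 / real CARD('a) ^ N) *\<^sub>R (\<Sum>s\<in>digit_reps N. \<Phi> (height (desc_vertex A N s)))"

lemma edge_shadow_edge_at:
  assumes "det A \<noteq> 0"
  shows "edge_shadow (edge_at A) N j = desc_mean A N (\<lambda>i. of_bool (i = j))"
proof -
  have "{z \<in> Desc N (edge_at A). height z = j} = desc_vertex A N ` {s \<in> digit_reps N. height (desc_vertex A N s) = j}"
    unfolding Desc_edge_at[OF assms] by auto
  then have "card {z \<in> Desc N (edge_at A). height z = j} = card {s \<in> digit_reps N. height (desc_vertex A N s) = j}"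
    using inj_on_subset[OF desc_vertex_inj[OF assms]] by (simp add: card_image)
  then show ?thesis
    by (simp add: edge_shadow_def desc_mean_def sum.If_cases of_bool_def Int_def)
qed

lemma desc_mean_0: "desc_mean A 0 \<Phi> = \<Phi> (height (vtx A))"
  by (simp add: desc_mean_def desc_vertex_0)

lemma desc_mean_Suc:
  fixes A :: "'a::{field,finite} mat2"
  shows "desc_mean A (Suc N) \<Phi> = (1 / real CARD('a)) *\<^sub>R (\<Sum>c\<in>UNIV. desc_mean (child A c) N \<Phi>)"
  unfolding desc_mean_def sum_digit_reps_Suc desc_vertex_Suc
  by (simp add: scaleR_sum_right[symmetric] mult.commute)

text \<open>The mean of \<open>\<Phi>\<close> over the heights after \<open>N\<close> steps of the Markov chain on states.  Forward states occur only
  with \<open>k \<ge> 1\<close>, where the truncated difference is harmless.\<close>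

fun state_mean :: "real \<Rightarrow> dir \<Rightarrow> nat \<Rightarrow> nat \<Rightarrow> (nat \<Rightarrow> 'b::real_vector) \<Rightarrow> 'b" where
  "state_mean q \<epsilon> k 0 \<Phi> = \<Phi> k"
| "state_mean q Fwd k (Suc N) \<Phi> =
     (1 / q) *\<^sub>R state_mean q Fwd (k + 1) N \<Phi> + (1 - 1 / q) *\<^sub>R state_mean q Bwd (k - 1) N \<Phi>"
| "state_mean q Bwd 0 (Suc N) \<Phi> = state_mean q Fwd 1 N \<Phi>"
| "state_mean q Bwd (Suc k) (Suc N) \<Phi> = state_mean q Bwd k N \<Phi>"

lemma card_field_gt_1: "CARD('a::{field,finite}) > 1"
proof -
  have "card {0, 1 :: 'a} \<le> CARD('a)" by (intro card_mono) auto
  then show ?thesis by simp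
qed

text \<open>The unique higher neighbour is either the predecessor, and then all children are lower, or exactly
  one of the children.\<close>

lemma child_up_iff:
  assumes A: "det A \<noteq> 0" and k: "height (vtx A) = k" "k \<ge> 1"
  shows "height (vtx (A ** abarz 1)) = k + 1 \<Longrightarrow> height (vtx (child A c)) + 1 = k"
    and "height (vtx (A ** abarz 1)) + 1 = k \<Longrightarrow>
      \<exists>c0. \<forall>c. if c = c0 then height (vtx (child A c)) = k + 1 else height (vtx (child A c)) + 1 = k"
proof -
  have "vtx A \<in> vertices" using A vertices_vtx by blast
  then obtain w where w: "adj (vtx A) w" "height w = k + 1"
    and uniq: "\<And>w'. adj (vtx A) w' \<Longrightarrow> height w' = k + 1 \<Longrightarrow> w' = w"
    using unique_up_neighbour[of "vtx A"] k by auto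
  have dich: "height (vtx (child A c)) = k + 1 \<or> height (vtx (child A c)) + 1 = k" for c
    using height_adj[OF adj_vtx_finite[OF A, of c]] k by auto
  {
    assume "height (vtx (A ** abarz 1)) = k + 1"
    then have "w = vtx (A ** abarz 1)" using uniq adj_vtx_infinity[OF A] by metis
    then have "height (vtx (child A c)) \<noteq> k + 1"
      using uniq[OF adj_vtx_finite[OF A, of c]] vtx_u_abarz_neq[OF A, of "fls_const c"] by metis
    then show "height (vtx (child A c)) + 1 = k" using dich by blast
  next
    assume "height (vtx (A ** abarz 1)) + 1 = k"
    then have "w \<noteq> vtx (A ** abarz 1)" using w(2) by auto
    then obtain c0 where c0: "w = vtx (child A c0)" using w(1) adj_vtx_iff[OF A] by blast
    have "height (vtx (child A c)) + 1 = k" if "c \<noteq> c0" for c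
    proof -
      have "vtx (child A c) \<noteq> w"
        unfolding c0 using vtx_u_abarz_eq_iff[OF A, of "fls_const c" "- 1" "fls_const c0"] that
        by (auto simp: val_ge_def dest: spec[of _ 0])
      then show ?thesis using dich uniq[OF adj_vtx_finite[OF A, of c]] by metis
    qed
    then show "\<exists>c0. \<forall>c. if c = c0 then height (vtx (child A c)) = k + 1 else height (vtx (child A c)) + 1 = k"
      using w(2) c0 by (intro exI[of _ c0]) auto
  }
qed

text \<open>Averaging over the first digit is one step of the chain.\<close>

lemma desc_mean_state:
  fixes A :: "'a::{field,finite} mat2"
  assumes "det A \<noteq> 0" "in_state \<epsilon> k (edge_at A)"
  shows "desc_mean A N \<Phi> = state_mean (real CARD('a)) \<epsilon> k N \<Phi>"
  using assms
proof (induction N arbitrary: A \<epsilon> k)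
  case 0
  then show ?case by (cases \<epsilon>) (simp_all add: edge_at_def desc_mean_0)
next
  case (Suc N)
  let ?q = "real CARD('a)"
  have q: "?q > 1" using card_field_gt_1[where 'a='a] by simp
  have A: "det A \<noteq> 0" and hA: "height (vtx A) = k"
    using Suc.prems by (cases \<epsilon>, auto simp: edge_at_def)+
  have child: "desc_mean (child A c) N \<Phi> = state_mean ?q \<epsilon>' k' N \<Phi>" if "in_state \<epsilon>' k' (vtx A, vtx (child A c))" for c \<epsilon>' k'
    using Suc.IH[OF det_child[OF A]] that by (simp add: edge_at_child)
  show ?case
  proof (cases \<epsilon>)
    case Bwd
    then have up: "height (vtx (A ** abarz 1)) = k + 1" using Suc.prems by (simp add: edge_at_def)
    show ?thesis
    proof (cases k)
      case 0
      have "in_state Fwd 1 (vtx A, vtx (child A c))" for c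
        using height_adj[OF adj_vtx_finite[OF A, of c]] adj_vtx_finite[OF A, of c] hA 0 by simp
      then have "desc_mean (child A c) N \<Phi> = state_mean ?q Fwd 1 N \<Phi>" for c by (rule child)
      then show ?thesis using q by (simp add: Bwd 0 desc_mean_Suc sum_constant_scaleR)
    next
      case (Suc k')
      have "in_state Bwd k' (vtx A, vtx (child A c))" for c
        using child_up_iff(1)[OF A hA _ up, of c] adj_vtx_finite[OF A, of c] hA Suc by simp
      then have "desc_mean (child A c) N \<Phi> = state_mean ?q Bwd k' N \<Phi>" for c by (rule child)
      then show ?thesis using q by (simp add: Bwd Suc desc_mean_Suc sum_constant_scaleR)
    qed
  next
    case Fwd
    then have down: "height (vtx (A ** abarz 1)) + 1 = k" using Suc.prems by (simp add: edge_at_def)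
    then have k: "k \<ge> 1" by simp
    obtain c0 where c0: "\<And>c. if c = c0 then height (vtx (child A c)) = k + 1 else height (vtx (child A c)) + 1 = k"
      using child_up_iff(2)[OF A hA k down] by blast
    have 1: "desc_mean (child A c0) N \<Phi> = state_mean ?q Fwd (k + 1) N \<Phi>"
      using c0[of c0] adj_vtx_finite[OF A, of c0] hA by (intro child) simp
    have 2: "desc_mean (child A c) N \<Phi> = state_mean ?q Bwd (k - 1) N \<Phi>" if "c \<noteq> c0" for c
      using c0[of c] adj_vtx_finite[OF A, of c] hA that by (intro child) auto
    have "(\<Sum>c\<in>UNIV. desc_mean (child A c) N \<Phi>) 
        = desc_mean (child A c0) N \<Phi> + (\<Sum>c\<in>UNIV - {c0}. desc_mean (child A c) N \<Phi>)"
      by (rule sum.remove) auto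
    also have "\<dots> = state_mean ?q Fwd (k + 1) N \<Phi> + (\<Sum>c\<in>UNIV - {c0}. state_mean ?q Bwd (k - 1) N \<Phi>)"
      using 1 2 by simp
    also have "\<dots> = state_mean ?q Fwd (k + 1) N \<Phi> + (?q - 1) *\<^sub>R state_mean ?q Bwd (k - 1) N \<Phi>"
      using q by (simp add: sum_constant_scaleR of_nat_diff card_Diff_singleton)
    finally show ?thesis
      using q by (simp add: Fwd desc_mean_Suc scaleR_add_right diff_divide_distrib)
  qed
qed

lemma edge_at_state:
  assumes "det A \<noteq> 0"
  shows "in_state (if height (vtx (A ** abarz 1)) = height (vtx A) + 1 then Bwd else Fwd) (height (vtx A)) (edge_at A)"
  using adj_edge[OF assms] height_adj[OF adj_edge[OF assms]] by (auto simp: edge_at_def)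

text \<open>Every edge has the normal form, so all edges in one state have the same shadow and the definite
  description in \<open>shadow\<close> is met.\<close>

lemma shadow_eq:
  fixes e :: "'a::{field,finite} vertex \<times> 'a vertex"
  assumes "in_state \<epsilon> k e"
  shows "shadow TYPE('a) \<epsilon> k N = (\<lambda>j. state_mean (real CARD('a)) \<epsilon> k N (\<lambda>i. of_bool (i = j)))"
proof -
  have eq: "edge_shadow e' N = (\<lambda>j. state_mean (real CARD('a)) \<epsilon> k N (\<lambda>i. of_bool (i = j)))" if "in_state \<epsilon> k e'" for e' :: "'a vertex \<times> 'a vertex"
  proof -
    obtain z' z where e': "e' = (z', z)" by force
    then have "adj z' z" using that by (cases \<epsilon>) auto
    then obtain A where A: "det A \<noteq> 0" "z = vtx A" "z' = vtx (A ** abarz 1)" by (rule edge_cases)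
    then have e'': "e' = edge_at A" by (simp add: e' edge_at_def)
    show ?thesis
      using edge_shadow_edge_at[OF A(1)] desc_mean_state[OF A(1)] that unfolding e'' by fastforce
  qed
  show ?thesis unfolding shadow_def
  proof (rule the_equality)
    show "\<exists>e :: 'a vertex \<times> 'a vertex. in_state \<epsilon> k e \<and> (\<lambda>j. state_mean (real CARD('a)) \<epsilon> k N (\<lambda>i. of_bool (i = j))) = edge_shadow e N"
      using assms eq[OF assms] by (intro exI[of _ e]) simp
  next
    fix d assume "\<exists>e :: 'a vertex \<times> 'a vertex. in_state \<epsilon> k e \<and> d = edge_shadow e N"
    then show "d = (\<lambda>j. state_mean (real CARD('a)) \<epsilon> k N (\<lambda>i. of_bool (i = j)))" using eq by blast
  qed
qed

section \<open>The shadow distributions in closed form\<close>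

lemma state_mean_Bwd_descend: "N \<le> k \<Longrightarrow> state_mean q Bwd k N \<Phi> = \<Phi> (k - N)"
proof (induction N arbitrary: k)
  case (Suc N)
  then show ?case by (cases k) auto
qed simp

lemma state_mean_Bwd_bounce: "state_mean q Bwd k (Suc (k + M)) \<Phi> = state_mean q Fwd 1 M \<Phi>"
  by (induction k) auto

text \<open>A path too short to reach the root makes \<open>i\<close> steps up, then turns and descends; or it only
  climbs, which is the last term.\<close>

lemma state_mean_Fwd_short:
  fixes \<Phi> :: "nat \<Rightarrow> 'b::real_vector"
  assumes "N \<le> k"
  shows "state_mean q Fwd k N \<Phi>
    = (\<Sum>i<N. ((1 - 1 / q) / q ^ i) *\<^sub>R \<Phi> (k - N + 2 * i)) + (1 / q ^ N) *\<^sub>R \<Phi> (k + N)"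
  using assms
proof (induction N arbitrary: k)
  case (Suc N)
  have "state_mean q Fwd k (Suc N) \<Phi>
    = (1 / q) *\<^sub>R ((\<Sum>i<N. ((1 - 1 / q) / q ^ i) *\<^sub>R \<Phi> (k + 1 - N + 2 * i)) + (1 / q ^ N) *\<^sub>R \<Phi> (k + 1 + N))
      + (1 - 1 / q) *\<^sub>R \<Phi> (k - 1 - N)"
    using Suc by (simp add: state_mean_Bwd_descend)
  also have "(1 / q) *\<^sub>R ((\<Sum>i<N. ((1 - 1 / q) / q ^ i) *\<^sub>R \<Phi> (k + 1 - N + 2 * i)) + (1 / q ^ N) *\<^sub>R \<Phi> (k + 1 + N))
    = (\<Sum>i<N. ((1 - 1 / q) / q ^ Suc i) *\<^sub>R \<Phi> (k - Suc N + 2 * Suc i)) + (1 / q ^ Suc N) *\<^sub>R \<Phi> (k + Suc N)"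
  proof -
    have "k + 1 - N + 2 * i = k - Suc N + 2 * Suc i" for i using Suc.prems by simp
    then show ?thesis by (simp add: scaleR_add_right scaleR_sum_right mult.commute del: mult_Suc_right)
  qed
  also have "\<dots> + (1 - 1 / q) *\<^sub>R \<Phi> (k - 1 - N)
    = (\<Sum>i<Suc N. ((1 - 1 / q) / q ^ i) *\<^sub>R \<Phi> (k - Suc N + 2 * i)) + (1 / q ^ Suc N) *\<^sub>R \<Phi> (k + Suc N)"
    unfolding sum.lessThan_Suc_shift by simp
  finally show ?case .
qed simp

lemma rho_ev_even_Suc:
  assumes "q \<ge> 2"
  shows "rho_ev q (2 * Suc l) = (1 - 1 / real q) / real q ^ (2 * l + 2) + (1 - 1 / real q) / real q ^ (2 * l + 1)"
proof -
  have "real q > 0" using assms by simp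
  then show ?thesis
    by (simp add: rho_ev_def field_simps power2_eq_square)
qed

lemma rho_ev_0: "q \<ge> 2 \<Longrightarrow> rho_ev q 0 = 1 - 1 / real q"
  by (simp add: rho_ev_def field_simps)

text \<open>Up to height \<open>2 l\<close> the limit distribution is reached exactly; the remaining mass is spread
  geometrically over higher levels.  The induction works because a path that turns at once reaches
  the root and continues as a forward path of state \<open>1\<close>, covered by the induction hypothesis at
  \<open>k = 0\<close>: the two contributions to level \<open>2 (l + 1)\<close> add up to \<open>\<rho>\<^sup>e\<^sup>v\<close>.\<close>

lemma state_mean_Fwd_closed:
  fixes \<Phi> :: "nat \<Rightarrow> 'b::real_vector"
  assumes "q \<ge> 2"
  defines "r \<equiv> real q"
  shows "state_mean r Fwd (Suc k) (Suc k + 2 * l) \<Phi>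
    = (\<Sum>m\<le>l. rho_ev q (2 * m) *\<^sub>R \<Phi> (2 * m))
      + (\<Sum>i<k. ((1 - 1 / r) / r ^ (2 * l + 1 + i)) *\<^sub>R \<Phi> (2 * (l + 1 + i)))
      + (1 / r ^ (k + 1 + 2 * l)) *\<^sub>R \<Phi> (2 * (k + 1 + l))"
proof (induction l arbitrary: k)
  case 0
  have "Suc k + Suc k = 2 * (k + 1 + 0)" by simp
  then have "state_mean r Fwd (Suc k) (Suc k) \<Phi>
    = (\<Sum>i<Suc k. ((1 - 1 / r) / r ^ i) *\<^sub>R \<Phi> (2 * i)) + (1 / r ^ Suc k) *\<^sub>R \<Phi> (2 * (k + 1 + 0))"
    using state_mean_Fwd_short[of "Suc k" "Suc k" r \<Phi>]
    by (simp add: mult_2 del: state_mean.simps sum.lessThan_Suc)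
  then show ?case
    using assms by (simp add: sum.lessThan_Suc_shift rho_ev_0 del: sum.lessThan_Suc state_mean.simps)
next
  case (Suc l)
  have r: "r > 0" using assms by simp
  define S where "S = (\<Sum>m\<le>l. rho_ev q (2 * m) *\<^sub>R \<Phi> (2 * m))"
  define T where "T = (\<Sum>i<k. ((1 - 1 / r) / r ^ (2 * Suc l + 1 + i)) *\<^sub>R \<Phi> (2 * (Suc l + 1 + i)))"
  define E where "E = \<Phi> (2 * (k + 1 + Suc l))"
  \<comment> \<open>the first step goes up: state \<open>k + 2\<close> with cutoff \<open>2 l\<close>\<close>
  have IH1: "state_mean r Fwd (Suc (Suc k)) (Suc (Suc k) + 2 * l) \<Phi>
    = S + (\<Sum>i<Suc k. ((1 - 1 / r) / r ^ (2 * l + 1 + i)) *\<^sub>R \<Phi> (2 * (l + 1 + i))) + (1 / r ^ (k + 2 + 2 * l)) *\<^sub>R E"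
    using Suc.IH[of "Suc k"] by (simp add: S_def E_def del: state_mean.simps sum.lessThan_Suc sum.atMost_Suc)
  \<comment> \<open>the first step goes down: after the return to the root, state \<open>1\<close> with the cutoff again \<open>2 l\<close>\<close>
  have IH0: "state_mean r Fwd 1 (Suc (2 * l)) \<Phi> = S + (1 / r ^ (2 * l + 1)) *\<^sub>R \<Phi> (2 * Suc l)"
    using Suc.IH[of 0] by (simp add: S_def del: state_mean.simps sum.atMost_Suc)
  have "(1 / r) *\<^sub>R (\<Sum>i<Suc k. ((1 - 1 / r) / r ^ (2 * l + 1 + i)) *\<^sub>R \<Phi> (2 * (l + 1 + i)))
      = ((1 - 1 / r) / r ^ (2 * l + 2)) *\<^sub>R \<Phi> (2 * Suc l) + T"
    unfolding sum.lessThan_Suc_shift T_def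
    by (simp add: scaleR_add_right scaleR_sum_right power_add mult_ac)
  then have 1: "(1 / r) *\<^sub>R state_mean r Fwd (Suc (Suc k)) (Suc (Suc k) + 2 * l) \<Phi>
    = (1 / r) *\<^sub>R S + ((1 - 1 / r) / r ^ (2 * l + 2)) *\<^sub>R \<Phi> (2 * Suc l) + T + (1 / r ^ (k + 1 + 2 * Suc l)) *\<^sub>R E"
    unfolding IH1 scaleR_add_right by (simp add: mult_ac)
  have "state_mean r Bwd k (Suc (k + Suc (2 * l))) \<Phi> = S + (1 / r ^ (2 * l + 1)) *\<^sub>R \<Phi> (2 * Suc l)"
    unfolding state_mean_Bwd_bounce IH0 ..
  then have 2: "(1 - 1 / r) *\<^sub>R state_mean r Bwd k (Suc (k + Suc (2 * l))) \<Phi>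
     = (1 - 1 / r) *\<^sub>R S + ((1 - 1 / r) / r ^ (2 * l + 1)) *\<^sub>R \<Phi> (2 * Suc l)"
    by (simp add: scaleR_add_right)
  have N: "Suc k + 2 * Suc l = Suc (Suc (Suc k) + 2 * l)" "Suc (Suc k) + 2 * l = Suc (k + Suc (2 * l))" by simp_all
  have "state_mean r Fwd (Suc k) (Suc k + 2 * Suc l) \<Phi>
     = (1 / r) *\<^sub>R state_mean r Fwd (Suc (Suc k)) (Suc (Suc k) + 2 * l) \<Phi>
       + (1 - 1 / r) *\<^sub>R state_mean r Bwd k (Suc (k + Suc (2 * l))) \<Phi>"
    unfolding N(1) state_mean.simps(2) N(2)[symmetric] by simp
  also have "\<dots> = ((1 / r) *\<^sub>R S + (1 - 1 / r) *\<^sub>R S)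
      + (((1 - 1 / r) / r ^ (2 * l + 2)) *\<^sub>R \<Phi> (2 * Suc l) + ((1 - 1 / r) / r ^ (2 * l + 1)) *\<^sub>R \<Phi> (2 * Suc l))
      + T + (1 / r ^ (k + 1 + 2 * Suc l)) *\<^sub>R E"
    unfolding 1 2 by (simp only: add_ac)
  also have "\<dots> = (S + rho_ev q (2 * Suc l) *\<^sub>R \<Phi> (2 * Suc l)) + T + (1 / r ^ (k + 1 + 2 * Suc l)) *\<^sub>R E"
    unfolding scaleR_add_left[symmetric] rho_ev_even_Suc[OF assms(1)] by (simp add: r_def)
  also have "S + rho_ev q (2 * Suc l) *\<^sub>R \<Phi> (2 * Suc l) = (\<Sum>m\<le>Suc l. rho_ev q (2 * m) *\<^sub>R \<Phi> (2 * m))"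
    by (simp add: S_def)
  finally show ?case unfolding T_def E_def .
qed

lemma rho_ev_nonneg: "q \<ge> 2 \<Longrightarrow> rho_ev q j \<ge> 0"
proof -
  assume q: "q \<ge> 2"
  then have "(real q)\<^sup>2 \<ge> 1" by (simp add: one_le_power)
  then show ?thesis using q by (simp add: rho_ev_def)
qed

lemma rho_ev_partial_sum: "q \<ge> 2 \<Longrightarrow> (\<Sum>m\<le>l. rho_ev q (2 * m)) = 1 - 1 / real q ^ (2 * l + 1)"
proof (induction l)
  case 0 then show ?case by (simp add: rho_ev_0)
next
  case (Suc l)
  then have "real q > 0" by simp
  then show ?case using Suc by (simp add: rho_ev_even_Suc del: mult_Suc_right) (simp add: field_simps)
qed

lemma rho_ev_sums:
  assumes "q \<ge> 2"
  shows "(\<lambda>m. rho_ev q (2 * m)) sums 1"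
proof -
  have "(\<lambda>l. 1 / real q * (1 / (real q)\<^sup>2) ^ l) \<longlonglongrightarrow> 1 / real q * 0"
    using assms by (intro tendsto_mult tendsto_const LIMSEQ_realpow_zero) (simp_all add: field_simps one_less_power)
  then have "(\<lambda>l. 1 - 1 / real q * (1 / (real q)\<^sup>2) ^ l) \<longlonglongrightarrow> 1 - 0"
    by (intro tendsto_diff tendsto_const) simp
  moreover have "1 - 1 / real q * (1 / (real q)\<^sup>2) ^ l = (\<Sum>m\<le>l. rho_ev q (2 * m))" for l
    unfolding rho_ev_partial_sum[OF assms] by (simp add: power_divide power_mult[symmetric])
  ultimately show ?thesis unfolding sums_def_le by simp
qed

lemma rho_mean_summable:
  assumes "q \<ge> 2" "\<And>j. even j \<Longrightarrow> cmod (\<Phi> j) \<le> B"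
  shows "summable (\<lambda>m. \<Phi> (2 * m) * of_real (rho_ev q (2 * m)))"
proof (rule summable_comparison_test')
  show "summable (\<lambda>m. B * rho_ev q (2 * m))"
    using rho_ev_sums[OF assms(1)] by (intro summable_mult) (simp add: sums_iff)
  show "norm (\<Phi> (2 * m) * of_real (rho_ev q (2 * m))) \<le> B * rho_ev q (2 * m)" for m
    using assms rho_ev_nonneg[OF assms(1)] by (simp add: norm_mult mult_right_mono)
qed

text \<open>By the partial sums, \<open>\<rho>\<^sup>e\<^sup>v\<close> has mass \<open>q\<^sup>-\<^sup>2\<^sup>l\<^sup>-\<^sup>1\<close> above level \<open>2 l\<close>.\<close>

lemma rho_mean_tail:
  assumes "q \<ge> 2" "\<And>j. even j \<Longrightarrow> cmod (\<Phi> j) \<le> B"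
  shows "cmod (rho_mean q \<Phi> - (\<Sum>m\<le>l. rho_ev q (2 * m) *\<^sub>R \<Phi> (2 * m))) \<le> B / real q ^ (2 * l + 1)"
proof -
  let ?f = "\<lambda>m. \<Phi> (2 * m) * of_real (rho_ev q (2 * m))" and ?g = "\<lambda>m. rho_ev q (2 * m)"
  have f: "summable ?f" using rho_mean_summable[OF assms] .
  have g: "summable ?g" "suminf ?g = 1" using rho_ev_sums[OF assms(1)] by (simp_all add: sums_iff)
  have gs: "summable (\<lambda>m. ?g (m + Suc l))" using summable_iff_shift[of ?g "Suc l"] g(1) by blast
  have sf: "suminf ?f = (\<Sum>m. ?f (m + Suc l)) + sum ?f {..<Suc l}"
    by (rule suminf_split_initial_segment[OF f])
  have sg: "suminf ?g = (\<Sum>m. ?g (m + Suc l)) + sum ?g {..<Suc l}"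
    by (rule suminf_split_initial_segment[OF g(1)])
  have "rho_mean q \<Phi> - (\<Sum>m\<le>l. rho_ev q (2 * m) *\<^sub>R \<Phi> (2 * m)) = (\<Sum>m. ?f (m + Suc l))"
    unfolding rho_mean_def sf by (simp add: lessThan_Suc_atMost scaleR_conv_of_real mult.commute)
  also have "cmod \<dots> \<le> (\<Sum>m. B * ?g (m + Suc l))"
  proof (rule norm_suminf_le)
    show "norm (?f (m + Suc l)) \<le> B * ?g (m + Suc l)" for m
      using assms rho_ev_nonneg[OF assms(1)] by (simp add: norm_mult mult_right_mono)
    show "summable (\<lambda>m. B * ?g (m + Suc l))"
      by (rule summable_mult[OF gs])
  qed
  also have "\<dots> = B * (\<Sum>m. ?g (m + Suc l))"
    by (rule suminf_mult[OF gs])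
  also have "(\<Sum>m. ?g (m + Suc l)) = 1 / real q ^ (2 * l + 1)"
    using sg g(2) rho_ev_partial_sum[OF assms(1), of l] by (simp add: lessThan_Suc_atMost)
  finally show ?thesis by simp
qed

lemma geometric_partial_sum:
  fixes r :: real
  assumes "r > 0"
  shows "(\<Sum>i<k. (1 - 1 / r) / r ^ (n + i)) + 1 / r ^ (n + k) = 1 / r ^ n"
proof (induction k)
  case (Suc k)
  have "(1 - 1 / r) / r ^ (n + k) + 1 / r ^ (n + Suc k) = 1 / r ^ (n + k)"
    using assms by (simp add: field_simps)
  with Suc show ?case by simp
qed simp

text \<open>The shadow and the limit differ only above level \<open>2 l\<close>, where both have mass \<open>q\<^sup>-\<^sup>2\<^sup>l\<^sup>-\<^sup>1\<close>.\<close>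

lemma state_mean_Fwd_error:
  assumes q: "q \<ge> 2" and B: "\<And>j. even j \<Longrightarrow> cmod (\<Phi> j) \<le> B"
  shows "cmod (state_mean (real q) Fwd (Suc k) (Suc k + 2 * l) \<Phi> - rho_mean q \<Phi>) \<le> 2 * B / real q ^ (2 * l + 1)"
proof -
  let ?r = "real q"
  have r: "?r > 1" using q by simp
  let ?S = "\<Sum>m\<le>l. rho_ev q (2 * m) *\<^sub>R \<Phi> (2 * m)"
  let ?T = "(\<Sum>i<k. ((1 - 1 / ?r) / ?r ^ (2 * l + 1 + i)) *\<^sub>R \<Phi> (2 * (l + 1 + i)))
      + (1 / ?r ^ (k + 1 + 2 * l)) *\<^sub>R \<Phi> (2 * (k + 1 + l))"
  have "cmod ?T \<le> (\<Sum>i<k. ((1 - 1 / ?r) / ?r ^ (2 * l + 1 + i)) * B) + (1 / ?r ^ (k + 1 + 2 * l)) * B"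
  proof -
    have sc: "norm (c *\<^sub>R \<Phi> (2 * n)) \<le> c * B" if "c \<ge> 0" for c n
      using that B[of "2 * n"] by (simp add: mult_left_mono)
    show ?thesis
      by (intro norm_triangle_mono order_trans[OF norm_sum] sum_mono sc) (use r in simp_all)
  qed
  also have "\<dots> = ((\<Sum>i<k. (1 - 1 / ?r) / ?r ^ (2 * l + 1 + i)) + 1 / ?r ^ (k + 1 + 2 * l)) * B"
    by (simp only: sum_distrib_right distrib_right)
  also have "(\<Sum>i<k. (1 - 1 / ?r) / ?r ^ (2 * l + 1 + i)) + 1 / ?r ^ (k + 1 + 2 * l) = 1 / ?r ^ (2 * l + 1)"
    using geometric_partial_sum[of ?r "2 * l + 1" k] r by (simp add: ac_simps)
  finally have T: "cmod ?T \<le> B / ?r ^ (2 * l + 1)" by simp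
  have U: "cmod (rho_mean q \<Phi> - ?S) \<le> B / ?r ^ (2 * l + 1)"
    by (rule rho_mean_tail[OF q]) (rule B)
  have *: "a + b + c - d = (b + c) - (d - a)" for a b c d :: complex by simp
  have eq: "state_mean ?r Fwd (Suc k) (Suc k + 2 * l) \<Phi> - rho_mean q \<Phi> = ?T - (rho_mean q \<Phi> - ?S)"
    unfolding state_mean_Fwd_closed[OF q] by (rule *)
  have "cmod (?T - (rho_mean q \<Phi> - ?S)) \<le> B / ?r ^ (2 * l + 1) + B / ?r ^ (2 * l + 1)"
    by (rule order_trans[OF norm_triangle_ineq4 add_mono[OF T U]])
  then show ?thesis unfolding eq by simp
qed

lemma rho_mean_bound:
  assumes "q \<ge> 2" "\<And>j. even j \<Longrightarrow> cmod (\<Phi> j) \<le> B"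
  shows "cmod (rho_mean q \<Phi>) \<le> B"
proof -
  have g: "(\<lambda>m. B * rho_ev q (2 * m)) sums (B * 1)" by (intro sums_mult rho_ev_sums assms(1))
  have "cmod (rho_mean q \<Phi>) \<le> (\<Sum>m. B * rho_ev q (2 * m))"
    unfolding rho_mean_def
  proof (rule norm_suminf_le)
    show "norm (\<Phi> (2 * m) * of_real (rho_ev q (2 * m))) \<le> B * rho_ev q (2 * m)" for m
      using assms rho_ev_nonneg[OF assms(1)] by (simp add: norm_mult mult_right_mono)
  qed (use g in \<open>simp add: sums_iff\<close>)
  also have "\<dots> = B" using g by (simp add: sums_iff)
  finally show ?thesis .
qed

text \<open>With cutoff \<open>N - k = 2 l\<close>, a backward path reaches the root after \<open>k\<close> steps.  If \<open>l \<ge> 1\<close> it continues as a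
  forward path from state \<open>1\<close> with \<open>2 l - 1\<close> steps left, for which the bound is at least as good as
  \<open>q\<^sup>-\<^sup>l\<close>; if \<open>l = 0\<close> it stops there and the trivial bound is used.\<close>

lemma state_mean_error:
  assumes q: "q \<ge> 2" and B: "\<And>j. even j \<Longrightarrow> cmod (\<Phi> j) \<le> B"
    and kN: "k \<le> N" "even (N - k)" and eps: "\<epsilon> = Fwd \<Longrightarrow> k \<ge> 1"
  shows "cmod (state_mean (real q) \<epsilon> k N \<Phi> - rho_mean q \<Phi>) \<le> 2 * B * real q powr (- real (N - k) / 2)"
proof -
  obtain l where l: "N = k + 2 * l" using kN by (metis dvdE le_add_diff_inverse)
  have B0: "B \<ge> 0" using order_trans[OF norm_ge_zero B[of 0]] by simp
  have r: "real q > 1" using q by simp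
  have pow: "real q powr (- real (N - k) / 2) = 1 / real q ^ l"
  proof -
    have "- real (N - k) / 2 = - real l" by (simp add: l)
    moreover have "real q powr (- real l) = 1 / real q ^ l"
      using r by (simp add: powr_minus powr_realpow inverse_eq_divide)
    ultimately show ?thesis by simp
  qed
  have mono: "2 * B / real q ^ n \<le> 2 * B * (1 / real q ^ l)" if "l \<le> n" for n
  proof -
    have "real q ^ l \<le> real q ^ n" using r that by (intro power_increasing) simp_all
    then have "2 * B / real q ^ n \<le> 2 * B / real q ^ l" using r B0 by (intro divide_left_mono) simp_all
    then show ?thesis by simp
  qed
  show ?thesis unfolding pow
  proof (cases \<epsilon>)
    case Fwd
    then obtain k' where "k = Suc k'" using eps by (metis Suc_le_D One_nat_def)
    then have "cmod (state_mean (real q) \<epsilon> k N \<Phi> - rho_mean q \<Phi>) \<le> 2 * B / real q ^ (2 * l + 1)"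
      using state_mean_Fwd_error[OF q B, where l=l and k=k'] Fwd l by (simp del: state_mean.simps)
    also have "\<dots> \<le> 2 * B * (1 / real q ^ l)" by (rule mono) simp
    finally show "cmod (state_mean (real q) \<epsilon> k N \<Phi> - rho_mean q \<Phi>) \<le> 2 * B * (1 / real q ^ l)" .
  next
    case Bwd
    show "cmod (state_mean (real q) \<epsilon> k N \<Phi> - rho_mean q \<Phi>) \<le> 2 * B * (1 / real q ^ l)"
    proof (cases l)
      case 0
      have "cmod (\<Phi> 0 - rho_mean q \<Phi>) \<le> cmod (\<Phi> 0) + cmod (rho_mean q \<Phi>)" by (rule norm_triangle_ineq4)
      also have "\<dots> \<le> B + B" using rho_mean_bound[OF q B] B[of 0] by (intro add_mono) simp_all
      finally show ?thesis using 0 l Bwd by (simp add: state_mean_Bwd_descend)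
    next
      case (Suc l')
      have "N = Suc (k + (Suc 0 + 2 * l'))" using l Suc by simp
      then have "state_mean (real q) \<epsilon> k N \<Phi> = state_mean (real q) Fwd (Suc 0) (Suc 0 + 2 * l') \<Phi>"
        unfolding Bwd by (simp only: state_mean_Bwd_bounce) simp
      then have "cmod (state_mean (real q) \<epsilon> k N \<Phi> - rho_mean q \<Phi>) \<le> 2 * B / real q ^ (2 * l' + 1)"
        using state_mean_Fwd_error[OF q B, where l=l' and k=0] by simp
      also have "\<dots> \<le> 2 * B * (1 / real q ^ l)" by (rule mono) (simp add: Suc)
      finally show ?thesis .
    qed
  qed
qed

lemma state_mean_add: "state_mean q \<epsilon> k N (\<lambda>i. \<Phi> i + \<Psi> i) = state_mean q \<epsilon> k N \<Phi> + state_mean q \<epsilon> k N \<Psi>"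
  by (induction q \<epsilon> k N \<Phi> rule: state_mean.induct) (simp_all add: scaleR_add_right)

lemma state_mean_of_real:
  "state_mean q \<epsilon> k N (\<lambda>i. of_real (c * \<Phi> i) :: complex) = of_real (c * state_mean q \<epsilon> k N \<Phi>)"
  by (induction q \<epsilon> k N \<Phi> rule: state_mean.induct) (simp_all add: scaleR_conv_of_real algebra_simps)

lemma state_mean_zero: "state_mean q \<epsilon> k N (\<lambda>i. 0) = 0"
  by (induction q \<epsilon> k N "\<lambda>i::nat. 0::'b::real_vector" rule: state_mean.induct) simp_all

lemma state_mean_sum:
  "finite S \<Longrightarrow> state_mean q \<epsilon> k N (\<lambda>i. \<Sum>j\<in>S. \<Phi> j i) = (\<Sum>j\<in>S. state_mean q \<epsilon> k N (\<Phi> j))"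
  by (induction S rule: finite_induct) (simp_all add: state_mean_zero state_mean_add)

lemma rho_mean_of_bool:
  "rho_mean q (\<lambda>i. of_real (c * of_bool (i = j))) = of_real (c * rho_ev q j)"
  (is "rho_mean q ?\<Phi> = _")
proof (cases "even j")
  case True
  then obtain m where m: "j = 2 * m" by blast
  have "rho_mean q ?\<Phi> = (\<Sum>n\<in>{m}. ?\<Phi> (2 * n) * of_real (rho_ev q (2 * n)))"
    unfolding rho_mean_def by (rule suminf_finite) (auto simp: m)
  then show ?thesis by (simp add: m)
next
  case False
  then have "(\<lambda>n. ?\<Phi> (2 * n) * of_real (rho_ev q (2 * n))) = (\<lambda>n. 0)"
  proof (intro ext)
    fix n
    have "2 * n \<noteq> j" using False by auto
    then show "?\<Phi> (2 * n) * of_real (rho_ev q (2 * n)) = 0" by simp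
  qed
  moreover have "rho_ev q j = 0" using False by (auto simp: rho_ev_def odd_pos)
  ultimately show ?thesis unfolding rho_mean_def by simp
qed

text \<open>The \<open>\<ell>\<^sup>1\<close> norm of the difference, cut at height \<open>J\<close>, is its pairing with the profile of its signs, to
  which the bound for profiles of norm at most \<open>1\<close> applies.\<close>

lemma tv_state_mean_error:
  assumes q: "q \<ge> 2" and kN: "k \<le> N" "even (N - k)" and eps: "\<epsilon> = Fwd \<Longrightarrow> k \<ge> 1"
  shows "tv_norm (\<lambda>j. state_mean (real q) \<epsilon> k N (\<lambda>i. of_bool (i = j)) - rho_ev q j)
    \<le> ennreal (2 * real q powr (- real (N - k) / 2))"
proof -
  define D where "D = (\<lambda>j. state_mean (real q) \<epsilon> k N (\<lambda>i. of_bool (i = j)) - rho_ev q j)"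
  have "(\<Sum>j<J. \<bar>D j\<bar>) \<le> 2 * 1 * real q powr (- real (N - k) / 2)" for J
  proof -
    define \<Phi> where "\<Phi> = (\<lambda>i. \<Sum>j<J. complex_of_real (sgn (D j) * of_bool (i = j)))"
    have \<Phi>: "\<Phi> i = (if i < J then of_real (sgn (D i)) else 0)" for i
      by (simp add: \<Phi>_def of_bool_def if_distrib cong: if_cong)
    have 1: "state_mean (real q) \<epsilon> k N \<Phi>
        = (\<Sum>j<J. of_real (sgn (D j) * state_mean (real q) \<epsilon> k N (\<lambda>i. of_bool (i = j))))"
      unfolding \<Phi>_def by (simp only: state_mean_sum[OF finite_lessThan] state_mean_of_real)
    have 2: "rho_mean q \<Phi> = (\<Sum>j<J. of_real (sgn (D j) * rho_ev q j))"
    proof -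
      have "rho_mean q \<Phi> = (\<Sum>m. \<Sum>j<J. complex_of_real (sgn (D j) * of_bool (2 * m = j)) * of_real (rho_ev q (2 * m)))"
        by (simp add: rho_mean_def \<Phi>_def sum_distrib_right)
      also have "\<dots> = (\<Sum>j<J. \<Sum>m. complex_of_real (sgn (D j) * of_bool (2 * m = j)) * of_real (rho_ev q (2 * m)))"
        by (rule suminf_sum, rule rho_mean_summable[OF q, of _ 1])
           (auto simp: norm_mult abs_sgn_eq)
      also have "\<dots> = (\<Sum>j<J. rho_mean q (\<lambda>i. of_real (sgn (D j) * of_bool (i = j))))"
        by (simp add: rho_mean_def)
      finally show ?thesis by (simp only: rho_mean_of_bool)
    qed
    have "(\<Sum>j<J. \<bar>D j\<bar>) = (\<Sum>j<J. sgn (D j) * D j)" by (simp add: sgn_mult_self_eq abs_sgn mult.commute)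
    then have "complex_of_real (\<Sum>j<J. \<bar>D j\<bar>) = state_mean (real q) \<epsilon> k N \<Phi> - rho_mean q \<Phi>"
      unfolding 1 2 by (simp add: sum_subtractf[symmetric] D_def algebra_simps)
    then have "cmod (complex_of_real (\<Sum>j<J. \<bar>D j\<bar>)) \<le> 2 * 1 * real q powr (- real (N - k) / 2)"
      using state_mean_error[OF q _ kN eps, of \<Phi> 1] by (simp add: \<Phi> abs_sgn_eq)
    then show ?thesis by (simp only: norm_of_real)
  qed
  then have "(\<Sum>j. ennreal \<bar>D j\<bar>) \<le> ennreal (2 * real q powr (- real (N - k) / 2))"
    by (intro suminf_le_const summableI) (simp add: sum_ennreal ennreal_leI)
  then show ?thesis by (simp add: tv_norm_def D_def)
qed

section \<open>Cosets, heights and the topology of the quotient\<close>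

lemma SL2_mult: "A \<in> SL2 \<Longrightarrow> B \<in> SL2 \<Longrightarrow> A ** B \<in> SL2"
  by (simp add: SL2_def det_mul)

lemma SL2_det: "A \<in> SL2 \<Longrightarrow> det A \<noteq> 0"
  by (simp add: SL2_def)

lemma u_mat_SL2: "u_mat s \<in> SL2"
  by (simp add: SL2_def)

lemma one_Gam: "mat 1 \<in> Gam"
  by (auto simp: SL2_def Gam_def mat2_one det_mat2 forall_2)

lemma inv2_SL2: "A \<in> SL2 \<Longrightarrow> inv2 A \<in> SL2"
  by (cases A rule: mat2_cases) (simp add: SL2_def inv2_def det_mat2 algebra_simps)

lemma inv2_Gam: "A \<in> Gam \<Longrightarrow> inv2 A \<in> Gam"
  using inv2_SL2[of A] unfolding Gam_def
  by (cases A rule: mat2_cases) (auto simp: SL2_def inv2_def det_mat2 entries_mat2 intro: Fq_poly_minus)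

lemma Gam_SL2: "A \<in> Gam \<Longrightarrow> A \<in> SL2"
  by (simp add: Gam_def)

lemma Gam_mult: "A \<in> Gam \<Longrightarrow> B \<in> Gam \<Longrightarrow> A ** B \<in> Gam"
proof -
  assume AB: "A \<in> Gam" "B \<in> Gam"
  then have "\<forall>i j. ((A ** B) $ i) $ j \<in> Fq_poly"
    by (auto simp: Gam_def matrix_matrix_mult_def sum_2 intro!: Fq_poly_add Fq_poly_mult)
  then show ?thesis using AB by (simp add: Gam_def SL2_mult)
qed

lemma gcoset_self: "g \<in> gcoset g"
  unfolding gcoset_def using one_Gam by (metis image_eqI matrix_mul_lid)

lemma gcoset_Gam: 
  assumes "\<gamma> \<in> Gam"
  shows "gcoset (\<gamma> ** g) = gcoset g"
proof -
  have d: "det \<gamma> \<noteq> 0" using assms Gam_SL2 SL2_det by blast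
  have "\<delta> ** g = (\<delta> ** inv2 \<gamma>) ** (\<gamma> ** g)" for \<delta>
    using inv2_mult(1)[OF d] by (metis matrix_mul_assoc matrix_mul_rid)
  then have "\<delta> ** g \<in> gcoset (\<gamma> ** g)" if "\<delta> \<in> Gam" for \<delta>
    unfolding gcoset_def using Gam_mult[OF that inv2_Gam[OF assms]] by blast
  moreover have "\<delta> ** (\<gamma> ** g) \<in> gcoset g" if "\<delta> \<in> Gam" for \<delta>
    unfolding gcoset_def using Gam_mult[OF that assms] by (auto simp: matrix_mul_assoc)
  ultimately show ?thesis unfolding gcoset_def by blast
qed

lemma ract_gcoset: "ract (gcoset g) h = gcoset (g ** h)"
  by (simp add: ract_def gcoset_def image_image matrix_mul_assoc)

lemma h_K_gcoset: "h_K (gcoset g) = height (vtx g)"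
proof -
  have "height (vact h v_base) = height (vtx g)" if h: "h \<in> gcoset g" for h
  proof -
    obtain \<gamma> where "\<gamma> \<in> Gam" "h = \<gamma> ** g" using h unfolding gcoset_def by blast
    then show ?thesis using height_vact[OF Gam_GL2_poly, of \<gamma> "vtx g"] by (simp add: vact_vtx vtx_def[symmetric])
  qed
  then show ?thesis unfolding h_K_def using gcoset_self[of g] by (intro the_equality) auto
qed

lemma X_spaceE:
  assumes "x \<in> X_space"
  obtains g where "g \<in> SL2" "x = gcoset g"
  using assms unfolding X_space_def by blast

lemma gcoset_X_space: "g \<in> SL2 \<Longrightarrow> gcoset g \<in> X_space"
  by (simp add: X_space_def)

lemma ract_X_space: "x \<in> X_space \<Longrightarrow> g \<in> SL2 \<Longrightarrow> ract x g \<in> X_space"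
  by (auto simp: X_space_def ract_gcoset SL2_mult)

lemma ract_ract: "ract (ract x g) h = ract x (g ** h)"
  by (simp add: ract_def image_image matrix_mul_assoc)

lemma open_fls_iff: "open (S :: 'a::{field,finite} fls set) \<longleftrightarrow> (\<forall>a\<in>S. \<exists>n. \<forall>y. y - a \<in> val_ge n \<longrightarrow> y \<in> S)"
proof -
  have small: "dist y a \<le> inverse (2 ^ n)" if "y - a \<in> val_ge (int n)" for y a :: "'a fls" and n
  proof (cases "y = a")
    case False
    then have "fls_subdegree (y - a) \<ge> int n" using that by (simp add: val_ge_iff)
    then have "dist y a = inverse (2 ^ nat (fls_subdegree (y - a)))" "n \<le> nat (fls_subdegree (y - a))"
      using False by (simp_all add: dist_fls_def)
    then show ?thesis by (simp add: power_increasing)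
  qed simp
  have large: "y - a \<in> val_ge n" if d: "dist y a < inverse (2 ^ nat n)" for y a :: "'a fls" and n
  proof (rule ccontr)
    assume "y - a \<notin> val_ge n"
    then have s: "y \<noteq> a" "fls_subdegree (y - a) < n" by (auto simp: val_ge_iff)
    have "dist y a \<ge> inverse (2 ^ nat n)"
    proof (cases "fls_subdegree (y - a) \<ge> 0")
      case True
      then have "nat (fls_subdegree (y - a)) \<le> nat n" using s by simp
      then show ?thesis using s True by (simp add: dist_fls_def power_increasing)
    next
      case False
      have "inverse (2 ^ nat n) \<le> (1::real)" by (simp add: inverse_le_1_iff)
      also have "1 \<le> (2::real) ^ nat (- fls_subdegree (y - a))" by simp
      finally show ?thesis using s False by (simp add: dist_fls_def)
    qed
    then show False using d by simp
  qed
  show ?thesis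
    unfolding open_dist
  proof (intro ball_cong refl iffI)
    fix a assume "a \<in> S"
    {
      assume "\<exists>e>0. \<forall>y. dist y a < e \<longrightarrow> y \<in> S"
      then obtain e where e: "e > 0" "\<And>y. dist y a < e \<Longrightarrow> y \<in> S" by blast
      obtain n where "inverse (2 ^ n) < e"
        using real_arch_pow_inv[OF e(1), of "1 / 2"] by (auto simp: power_divide inverse_eq_divide)
      then show "\<exists>n. \<forall>y. y - a \<in> val_ge n \<longrightarrow> y \<in> S"
        using e(2) small by (metis order_le_less_trans)
    next
      assume "\<exists>n. \<forall>y. y - a \<in> val_ge n \<longrightarrow> y \<in> S"
      then obtain n where "\<And>y. y - a \<in> val_ge n \<Longrightarrow> y \<in> S" by blast
      then show "\<exists>e>0. \<forall>y. dist y a < e \<longrightarrow> y \<in> S"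
        using large by (intro exI[of _ "inverse (2 ^ nat n)"]) auto
    }
  qed
qed

lemma open_coset: "open {y. y - a \<in> val_ge n}"
  unfolding open_fls_iff
proof (intro ballI exI allI impI)
  fix b y assume b: "b \<in> {y. y - a \<in> val_ge n}" and y: "y - b \<in> val_ge n"
  have "y - a = (y - b) + (b - a)" by simp
  then show "y \<in> {y. y - a \<in> val_ge n}" using b y val_ge_add by (metis mem_Collect_eq)
qed

text \<open>Congruence of all entries modulo \<open>\<pi>\<^sup>n\<close>: a neighbourhood basis that replaces the product
  topology in computations.\<close>

definition mat_close :: "int \<Rightarrow> 'a::{field,finite} mat2 \<Rightarrow> 'a mat2 \<Rightarrow> bool"
  where "mat_close n A B \<longleftrightarrow> (\<forall>i j. (B $ i) $ j - (A $ i) $ j \<in> val_ge n)"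

lemma open_mat_close: "open {B. mat_close n A B}"
proof -
  have row: "open {r :: 'a fls ^ 2. \<forall>j. r $ j - (A $ i) $ j \<in> val_ge n}" for i
    unfolding open_vec_def
  proof (intro ballI)
    fix x :: "'a fls ^ 2" assume "x \<in> {r. \<forall>j. r $ j - (A $ i) $ j \<in> val_ge n}"
    then show "\<exists>E. (\<forall>j. open (E j) \<and> x $ j \<in> E j) \<and> (\<forall>y. (\<forall>j. y $ j \<in> E j) \<longrightarrow> y \<in> {r. \<forall>j. r $ j - (A $ i) $ j \<in> val_ge n})"
      by (intro exI[of _ "\<lambda>j. {y. y - (A $ i) $ j \<in> val_ge n}"]) (simp add: open_coset)
  qed
  show ?thesis
    unfolding open_vec_def[of "{B. mat_close n A B}"]
  proof (intro ballI)
    fix B :: "'a mat2" assume "B \<in> {B. mat_close n A B}"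
    then show "\<exists>R. (\<forall>i. open (R i) \<and> B $ i \<in> R i) \<and> (\<forall>C. (\<forall>i. C $ i \<in> R i) \<longrightarrow> C \<in> {B. mat_close n A B})"
      by (intro exI[of _ "\<lambda>i. {r. \<forall>j. r $ j - (A $ i) $ j \<in> val_ge n}"]) (simp add: row mat_close_def)
  qed
qed

lemma open_mat_nhd:
  assumes "open S" "A \<in> S"
  obtains n where "\<And>B. mat_close n A B \<Longrightarrow> B \<in> S"
proof -
  obtain R where R: "\<forall>i. open (R i) \<and> A $ i \<in> R i" "\<forall>B. (\<forall>i. B $ i \<in> R i) \<longrightarrow> B \<in> S"
    using assms unfolding open_vec_def[of S] by blast
  have "\<forall>i. \<exists>E. (\<forall>j. open (E j) \<and> (A $ i) $ j \<in> E j) \<and> (\<forall>r. (\<forall>j. r $ j \<in> E j) \<longrightarrow> r \<in> R i)"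
    using R(1) unfolding open_vec_def by blast
  from choice[OF this] obtain E where
    E: "\<forall>i. (\<forall>j. open (E i j) \<and> (A $ i) $ j \<in> E i j) \<and> (\<forall>r. (\<forall>j. r $ j \<in> E i j) \<longrightarrow> r \<in> R i)"
    by blast
  define m where "m = (\<lambda>i j. SOME n. \<forall>y. y - (A $ i) $ j \<in> val_ge n \<longrightarrow> y \<in> E i j)"
  have m: "\<forall>y. y - (A $ i) $ j \<in> val_ge (m i j) \<longrightarrow> y \<in> E i j" for i j
  proof -
    have "\<exists>n. \<forall>y. y - (A $ i) $ j \<in> val_ge n \<longrightarrow> y \<in> E i j"
      using E unfolding open_fls_iff by blast
    then show ?thesis unfolding m_def by (rule someI_ex)
  qed
  define n where "n = Max (range (\<lambda>(i, j). m i j))"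
  have n: "m i j \<le> n" for i j
    unfolding n_def by (rule Max_ge) (auto intro: rev_image_eqI[of "(i, j)"])
  have "B \<in> S" if "mat_close n A B" for B
  proof -
    have "(B $ i) $ j \<in> E i j" for i j
    proof -
      have "(B $ i) $ j - (A $ i) $ j \<in> val_ge n" using that by (simp add: mat_close_def)
      then show ?thesis using m val_ge_mono[OF _ n] by blast
    qed
    then have "B $ i \<in> R i" for i using E by blast
    then show ?thesis using R(2) by blast
  qed
  then show ?thesis by (rule that)
qed

lemma openin_SL2_iff:
  "openin (top_of_set SL2) W \<longleftrightarrow> W \<subseteq> SL2 \<and> (\<forall>A\<in>W. \<exists>n. \<forall>B\<in>SL2. mat_close n A B \<longrightarrow> B \<in> W)"
proof
  assume "openin (top_of_set SL2) W"
  then obtain T where T: "open T" "W = SL2 \<inter> T" unfolding openin_open by blast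
  have "\<exists>n. \<forall>B\<in>SL2. mat_close n A B \<longrightarrow> B \<in> W" if "A \<in> W" for A
  proof -
    have "A \<in> T" using that T by blast
    then obtain n where "\<And>B. mat_close n A B \<Longrightarrow> B \<in> T" using open_mat_nhd[OF T(1)] by blast
    then show ?thesis using T(2) by blast
  qed
  then show "W \<subseteq> SL2 \<and> (\<forall>A\<in>W. \<exists>n. \<forall>B\<in>SL2. mat_close n A B \<longrightarrow> B \<in> W)" using T by blast
next
  assume W: "W \<subseteq> SL2 \<and> (\<forall>A\<in>W. \<exists>n. \<forall>B\<in>SL2. mat_close n A B \<longrightarrow> B \<in> W)"
  then obtain n where n: "\<And>A B. A \<in> W \<Longrightarrow> B \<in> SL2 \<Longrightarrow> mat_close (n A) A B \<Longrightarrow> B \<in> W" by metis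
  have refl: "mat_close k A A" for k A by (simp add: mat_close_def)
  have "W = SL2 \<inter> (\<Union>A\<in>W. {B. mat_close (n A) A B})"
    using W n refl by blast
  moreover have "open (\<Union>A\<in>W. {B. mat_close (n A) A B})" by (intro open_UN ballI open_mat_close)
  ultimately show "openin (top_of_set SL2) W" unfolding openin_open by blast
qed

lemma entries_bounded_below:
  fixes g :: "'a::{field,finite} mat2"
  shows "\<exists>c. \<forall>i j. (g $ i) $ j \<in> val_ge c"
proof -
  define m where "m = (\<lambda>i j. fls_subdegree ((g $ i) $ j))"
  have m: "(g $ i) $ j \<in> val_ge (m i j)" for i j by (simp add: m_def val_ge_iff)
  have "Min (range (\<lambda>(i, j). m i j)) \<le> m i j" for i j
    by (rule Min_le) (auto intro: rev_image_eqI[of "(i, j)"])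
  then show ?thesis using m val_ge_mono by blast
qed

lemma mat_close_mult_right: "\<exists>m. \<forall>A B. mat_close m A B \<longrightarrow> mat_close n (A ** g) (B ** g)"
proof -
  obtain c where c: "\<And>i j. (g $ i) $ j \<in> val_ge c" using entries_bounded_below by blast
  have "mat_close n (A ** g) (B ** g)" if "mat_close (n - c) A B" for A B
    unfolding mat_close_def
  proof (intro allI)
    fix i j
    have "((B $ i) $ k - (A $ i) $ k) * (g $ k) $ j \<in> val_ge n" for k
      using val_ge_mult[of "(B $ i) $ k - (A $ i) $ k" "n - c" "(g $ k) $ j" c] that c by (simp add: mat_close_def)
    from val_ge_add[OF this[of 1] this[of 2]]
    show "((B ** g) $ i) $ j - ((A ** g) $ i) $ j \<in> val_ge n"
      by (simp add: matrix_matrix_mult_def sum_2 algebra_simps)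
  qed
  then show ?thesis by blast
qed

lemma mat_close_mult_left: "\<exists>m. \<forall>A B. mat_close m A B \<longrightarrow> mat_close n (g ** A) (g ** B)"
proof -
  obtain c where c: "\<And>i j. (g $ i) $ j \<in> val_ge c" using entries_bounded_below by blast
  have "mat_close n (g ** A) (g ** B)" if "mat_close (n - c) A B" for A B
    unfolding mat_close_def
  proof (intro allI)
    fix i j
    have "(g $ i) $ k * ((B $ k) $ j - (A $ k) $ j) \<in> val_ge n" for k
      using val_ge_mult[of "(g $ i) $ k" c "(B $ k) $ j - (A $ k) $ j" "n - c"] that c by (simp add: mat_close_def)
    from val_ge_add[OF this[of 1] this[of 2]]
    show "((g ** B) $ i) $ j - ((g ** A) $ i) $ j \<in> val_ge n"
      by (simp add: matrix_matrix_mult_def sum_2 algebra_simps)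
  qed
  then show ?thesis by blast
qed

lemma openin_X_top_iff:
  "openin X_top V \<longleftrightarrow> V \<subseteq> X_space \<and>
    (\<forall>A\<in>SL2. gcoset A \<in> V \<longrightarrow> (\<exists>n. \<forall>B\<in>SL2. mat_close n A B \<longrightarrow> gcoset B \<in> V))"
  unfolding openin_X_top openin_SL2_iff by auto

lemma openin_ract_vimage:
  assumes "openin X_top V" "g \<in> SL2"
  shows "openin X_top {x \<in> X_space. ract x g \<in> V}"
  unfolding openin_X_top_iff
proof (intro conjI ballI impI)
  fix A assume A: "A \<in> SL2" "gcoset A \<in> {x \<in> X_space. ract x g \<in> V}"
  then have "gcoset (A ** g) \<in> V" by (simp add: ract_gcoset)
  then obtain n where n: "\<And>B. B \<in> SL2 \<Longrightarrow> mat_close n (A ** g) B \<Longrightarrow> gcoset B \<in> V"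
    using assms(1) SL2_mult[OF A(1) assms(2)] unfolding openin_X_top_iff by blast
  obtain m where m: "\<And>A B. mat_close m A B \<Longrightarrow> mat_close n (A ** g) (B ** g)"
    using mat_close_mult_right by blast
  show "\<exists>n. \<forall>B\<in>SL2. mat_close n A B \<longrightarrow> gcoset B \<in> {x \<in> X_space. ract x g \<in> V}"
    using n m assms(2) by (intro exI[of _ m]) (auto simp: ract_gcoset SL2_mult gcoset_X_space)
qed auto

text \<open>A matrix congruent to \<open>A\<close> modulo a high power of \<open>\<pi>\<close> is \<open>A\<close> times an integral matrix of
  determinant one.\<close>

lemma vtx_locally_constant:
  assumes "A \<in> SL2"
  shows "\<exists>n. \<forall>B\<in>SL2. mat_close n A B \<longrightarrow> vtx B = vtx A"
proof -
  have d: "det A \<noteq> 0" using SL2_det assms by blast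
  obtain n where n: "\<And>B. mat_close n A B \<Longrightarrow> mat_close 0 (inv2 A ** A) (inv2 A ** B)"
    using mat_close_mult_left by blast
  have "vtx B = vtx A" if B: "B \<in> SL2" "mat_close n A B" for B
  proof -
    let ?C = "inv2 A ** B"
    have "mat_close 0 (mat 1) ?C" using n[OF B(2)] inv2_mult(1)[OF d] by simp
    then have "(?C $ i) $ j - (mat 1 $ i) $ j \<in> val_ge 0" for i j by (simp add: mat_close_def)
    moreover have "(mat 1 $ i) $ j \<in> (val_ge 0 :: 'a fls set)" for i j :: 2
      by (simp add: mat_def)
    ultimately have ent: "(?C $ i) $ j \<in> val_ge 0" for i j by (metis diff_add_cancel val_ge_add)
    have "det ?C = 1" using SL2_mult[OF inv2_SL2[OF assms] B(1)] by (simp add: SL2_def)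
    then have "vtx ?C = v_base"
      using stabilizer_iff[of ?C] ent by (auto intro!: exI[of _ 0])
    then have "vtx (A ** ?C) = vtx A" by (rule vtx_mult_stabilizer)
    then show ?thesis by (simp add: inv2_cancel[OF d])
  qed
  then show ?thesis by blast
qed

text \<open>The height of a coset is locally constant; this supplies all the measurability and covering
  arguments.\<close>

lemma openin_height_level: "openin X_top {x \<in> X_space. h_K x \<in> J}"
  unfolding openin_X_top_iff
proof (intro conjI ballI impI)
  fix A assume A: "A \<in> SL2" "gcoset A \<in> {x \<in> X_space. h_K x \<in> J}"
  obtain n where "\<And>B. B \<in> SL2 \<Longrightarrow> mat_close n A B \<Longrightarrow> vtx B = vtx A" using vtx_locally_constant[OF A(1)] by blast
  then show "\<exists>n. \<forall>B\<in>SL2. mat_close n A B \<longrightarrow> gcoset B \<in> {x \<in> X_space. h_K x \<in> J}"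
    using A by (intro exI[of _ n]) (auto simp: h_K_gcoset gcoset_X_space)
qed auto

section \<open>Orbit averages as shadows\<close>

lemma translation_measurable: "(\<lambda>s. a + s) \<in> borel_measurable (borel :: 'a::{field,finite} fls measure)"
proof (rule borel_measurableI)
  fix S :: "'a fls set" assume S: "open S"
  have "open ((\<lambda>s. a + s) -` S)"
    unfolding open_fls_iff
  proof
    fix b assume "b \<in> (\<lambda>s. a + s) -` S"
    then obtain n where "\<forall>y. y - (a + b) \<in> val_ge n \<longrightarrow> y \<in> S" using S unfolding open_fls_iff by blast
    then show "\<exists>n. \<forall>y. y - b \<in> val_ge n \<longrightarrow> y \<in> (\<lambda>s. a + s) -` S"
      by (intro exI[of _ n]) (auto simp: algebra_simps)
  qed
  then show "(\<lambda>s. a + s) -` S \<inter> space borel \<in> sets borel" by simp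
qed

text \<open>Translation invariance alone transports the normalization from \<open>\<O>\<close> to its cosets.\<close>

lemma haar_coset:
  assumes "is_haar_F ds"
  shows "{y. y - a \<in> val_ge 0} \<in> sets ds" "emeasure ds {y. y - a \<in> val_ge 0} = 1"
proof -
  have s: "sets ds = sets borel" and d: "distr ds borel (\<lambda>s. (- a) + s) = ds" and e: "emeasure ds O_ring = 1"
    using assms unfolding is_haar_F_def by blast+
  have sp: "space ds = UNIV" using sets_eq_imp_space_eq[OF s] by simp
  have o: "{y. y - b \<in> val_ge 0} \<in> sets borel" for b :: "'a fls"
    by (intro borel_open open_coset)
  then show "{y. y - a \<in> val_ge 0} \<in> sets ds" using s by simp
  have "(\<lambda>s. (- a) + s) \<in> measurable ds borel"
    using translation_measurable measurable_cong_sets[OF s refl] by blast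
  then have "emeasure (distr ds borel (\<lambda>s. (- a) + s)) O_ring = emeasure ds ((\<lambda>s. (- a) + s) -` O_ring \<inter> space ds)"
    using o[of 0] by (intro emeasure_distr) (simp_all add: O_ring_val_ge)
  moreover have "(\<lambda>s. (- a) + s) -` O_ring \<inter> space ds = {y. y - a \<in> val_ge 0}"
    by (auto simp: sp O_ring_val_ge)
  ultimately show "emeasure ds {y. y - a \<in> val_ge 0} = 1" using d e by simp
qed

lemma ball_eq: "(*) (tvar ^ N) ` O_ring = (val_ge (- int N) :: 'a::{field,finite} fls set)"
proof
  show "(*) (tvar ^ N) ` O_ring \<subseteq> (val_ge (- int N) :: 'a fls set)"
    by (auto simp: O_ring_val_ge tvar_power tpow_mult_val_ge)
  show "(val_ge (- int N) :: 'a fls set) \<subseteq> (*) (tvar ^ N) ` O_ring"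
  proof
    fix s :: "'a fls" assume "s \<in> val_ge (- int N)"
    then have "tpow (- int N) * s \<in> O_ring" "s = tvar ^ N * (tpow (- int N) * s)"
      by (simp_all add: O_ring_val_ge tvar_power tpow_mult_val_ge tpow_mult_tpow_mult)
    then show "s \<in> (*) (tvar ^ N) ` O_ring" by blast
  qed
qed

text \<open>The ball \<open>t\<^sup>N \<O>\<close> is the disjoint union of the \<open>q\<^sup>N\<close> cosets \<open>t\<^sup>N r + \<O>\<close> of measure one, and the integrand is
  constant on each.\<close>

lemma lam_den_finite:
  fixes ds :: "'a::{field,finite} fls measure" and f :: "'a mat2 set \<Rightarrow> 'b::{banach,second_countable_topology}"
  assumes ds: "is_haar_F ds"
    and inv: "\<And>s r. r \<in> val_ge 0 \<Longrightarrow> f (ract x (u_mat (s + r))) = f (ract x (u_mat s))"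
  shows "lam_den ds x N f = (1 / real CARD('a) ^ N) *\<^sub>R (\<Sum>r\<in>digit_reps N. f (ract x (u_mat (tpow (int N) * r))))"
proof -
  define F where "F = (\<lambda>s. f (ract x (u_mat s)))"
  define C where "C = (\<lambda>r :: 'a fls. {y. y - tpow (int N) * r \<in> val_ge 0})"
  have dec: "indicator (val_ge (- int N)) s *\<^sub>R F s = (\<Sum>r\<in>digit_reps N. indicator (C r) s *\<^sub>R F (tpow (int N) * r))" for s
  proof (cases "s \<in> val_ge (- int N)")
    case True
    then have "tpow (- int N) * s \<in> val_ge 0" by (simp add: tpow_mult_val_ge)
    then obtain r where r: "r \<in> digit_reps N" "tpow (- int N) * s - r \<in> val_ge (int N)" using digit_reps_exists by blast
    have eq: "s - tpow (int N) * r' = tpow (int N) * (tpow (- int N) * s - r')" for r'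
      by (simp add: right_diff_distrib tpow_mult_tpow_mult)
    have mem: "s \<in> C r' \<longleftrightarrow> tpow (- int N) * s - r' \<in> val_ge (int N)" for r'
      unfolding C_def mem_Collect_eq eq tpow_mult_val_ge by simp
    have uniq: "s \<in> C r' \<longleftrightarrow> r' = r" if "r' \<in> digit_reps N" for r'
    proof
      assume "s \<in> C r'"
      then have "tpow (- int N) * s - r' \<in> val_ge (int N)" using mem by simp
      from val_ge_diff[OF this r(2)] have "r - r' \<in> val_ge (int N)" by simp
      then show "r' = r" using digit_reps_cong_imp_eq r(1) that by metis
    qed (use r mem in auto)
    have "(\<Sum>r'\<in>digit_reps N. indicator (C r') s *\<^sub>R F (tpow (int N) * r')) = (\<Sum>r'\<in>digit_reps N. if r' = r then F (tpow (int N) * r') else 0)"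
      by (rule sum.cong) (auto simp: uniq indicator_def)
    also have "\<dots> = F (tpow (int N) * r)" using r(1) by simp
    also have "\<dots> = F (tpow (int N) * r + (s - tpow (int N) * r))"
      unfolding F_def using uniq[OF r(1)] by (intro inv[symmetric]) (simp add: C_def)
    finally show ?thesis using True by simp
  next
    case False
    have "s \<notin> C r" if "r \<in> digit_reps N" for r
    proof
      assume "s \<in> C r"
      then have "s - tpow (int N) * r \<in> val_ge (- int N)" unfolding C_def by (auto intro: val_ge_mono)
      moreover have "tpow (int N) * r \<in> val_ge (- int N)" using digit_reps_val_ge[OF that] by (simp add: tpow_mult_val_ge)
      ultimately have "(s - tpow (int N) * r) + tpow (int N) * r \<in> val_ge (- int N)" by (rule val_ge_add)
      then show False using False by simp
    qed
    then show ?thesis using False by simp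
  qed
  have meas: "measure ds (C r) = 1" for r
    using haar_coset(2)[OF ds, of "tpow (int N) * r"] by (simp add: C_def measure_def)
  have "has_bochner_integral ds (\<lambda>s. \<Sum>r\<in>digit_reps N. indicator (C r) s *\<^sub>R F (tpow (int N) * r))
      (\<Sum>r\<in>digit_reps N. measure ds (C r) *\<^sub>R F (tpow (int N) * r))"
    unfolding C_def using haar_coset[OF ds]
    by (intro has_bochner_integral_sum has_bochner_integral_scaleR_left has_bochner_integral_real_indicator) auto
  then have "(LINT s:(*) (tvar ^ N) ` O_ring|ds. F s) = (\<Sum>r\<in>digit_reps N. F (tpow (int N) * r))"
    unfolding set_lebesgue_integral_def ball_eq dec meas by (simp add: has_bochner_integral_integral_eq)
  then show ?thesis unfolding lam_den_def F_def by simp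
qed

lemma y_ray_vtx: "y_ray g N = vtx (g ** abarz (int N))"
  by (simp add: y_ray_def vtx_def abar_abarz)

lemma edge_at_ray: "edge_at (g ** abarz (int N)) = (y_ray g (N + 1), y_ray g N)"
  by (simp add: edge_at_def y_ray_vtx abarz_mult add.commute flip: matrix_mul_assoc)

lemma ray_state:
  assumes "det g \<noteq> 0"
  shows "in_state (eps_idx g N) (k_idx g N) (edge_at (g ** abarz (int N)))"
proof -
  have "det (g ** abarz (int N)) \<noteq> 0" using assms by (simp add: det_mul)
  from edge_at_state[OF this] show ?thesis
    unfolding eps_idx_def k_idx_def using edge_at_ray[of g N] by (simp add: edge_at_def)
qed

text \<open>Since \<open>g u(t\<^sup>N r) = (g abar\<^sub>N) u(r) abar\<^bsub>-N\<^esub>\<close>, the vertices met by the average are the descendants at depth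
  \<open>N\<close> of the edge at \<open>g abar\<^sub>N\<close>.\<close>

lemma lam_den_profile:
  fixes ds :: "'a::{field,finite} fls measure" and \<Phi> :: "nat \<Rightarrow> 'b::{banach,second_countable_topology}"
  assumes ds: "is_haar_F ds" and g: "g \<in> SL2"
  shows "lam_den ds (gcoset g) N (\<lambda>x. \<Phi> (h_K x)) = state_mean (real CARD('a)) (eps_idx g N) (k_idx g N) N \<Phi>"
proof -
  have d: "det g \<noteq> 0" "det (g ** abarz (int N)) \<noteq> 0" using SL2_det[OF g] by (simp_all add: det_mul)
  have "lam_den ds (gcoset g) N (\<lambda>x. \<Phi> (h_K x))
    = (1 / real CARD('a) ^ N) *\<^sub>R (\<Sum>r\<in>digit_reps N. \<Phi> (h_K (ract (gcoset g) (u_mat (tpow (int N) * r)))))"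
  proof (rule lam_den_finite[OF ds])
    fix s r :: "'a fls" assume "r \<in> val_ge 0"
    then have "vtx (g ** u_mat s ** u_mat r) = vtx (g ** u_mat s)" by (rule vtx_u_mat_int)
    then have "vtx (g ** u_mat (s + r)) = vtx (g ** u_mat s)" by (simp add: u_mat_add flip: matrix_mul_assoc)
    then show "\<Phi> (h_K (ract (gcoset g) (u_mat (s + r)))) = \<Phi> (h_K (ract (gcoset g) (u_mat s)))"
      by (simp add: ract_gcoset h_K_gcoset)
  qed
  also have "\<dots> = desc_mean (g ** abarz (int N)) N \<Phi>"
  proof -
    have "abarz (int N) ** u_mat r ** abarz (- int N) = u_mat (tpow (int N) * r)" for r :: "'a fls"
      by (simp add: abarz_u_mat abarz_mult abarz_0 flip: matrix_mul_assoc)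
    then have "desc_vertex (g ** abarz (int N)) N r = vtx (g ** u_mat (tpow (int N) * r))" for r
      unfolding desc_vertex_def by (metis matrix_mul_assoc)
    then show ?thesis by (simp add: desc_mean_def ract_gcoset h_K_gcoset)
  qed
  also have "\<dots> = state_mean (real CARD('a)) (eps_idx g N) (k_idx g N) N \<Phi>"
    by (rule desc_mean_state[OF d(2) ray_state[OF d(1)]])
  finally show ?thesis .
qed

lemma indicator_level: "indicator {y. h_K y = j} = (\<lambda>x. of_bool (h_K x = j))"
  by (auto simp: indicator_def)

lemma push_lam_den:
  fixes ds :: "'a::{field,finite} fls measure"
  assumes "is_haar_F ds" "g \<in> SL2"
  shows "push_hK (lam_den ds (gcoset g) N) = (\<lambda>j. state_mean (real CARD('a)) (eps_idx g N) (k_idx g N) N (\<lambda>i. of_bool (i = j)))"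
  unfolding push_hK_def indicator_level by (rule ext, rule lam_den_profile[OF assms])

lemma push_lam_den_shadow:
  fixes ds :: "'a::{field,finite} fls measure"
  assumes "is_haar_F ds" "g \<in> SL2"
  shows "push_hK (lam_den ds (gcoset g) N) = shadow TYPE('a) (eps_idx g N) (k_idx g N) N"
  unfolding push_lam_den[OF assms] shadow_eq[OF ray_state[OF SL2_det[OF assms(2)]]] ..

lemma powr_tendsto_0:
  assumes "q > 1" "filterlim M at_top F"
  shows "((\<lambda>x. q powr (- M x / 2)) \<longlongrightarrow> (0::real)) F"
proof -
  have c: "ln q / 2 > 0" using assms by simp
  have "filterlim (\<lambda>x. - (ln q / 2 * M x)) at_bot F"
    unfolding filterlim_uminus_at_top[symmetric]
    by (rule filterlim_tendsto_pos_mult_at_top[OF tendsto_const c assms(2)])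
  then have "((\<lambda>x. exp (- (ln q / 2 * M x))) \<longlongrightarrow> 0) F"
    by (rule filterlim_compose[OF exp_at_bot])
  moreover have "q powr (- M x / 2) = exp (- (ln q / 2 * M x))" for x
    using assms by (simp add: powr_def mult_ac)
  ultimately show ?thesis by simp
qed

lemma state_mean_pointwise_error:
  assumes q: "q \<ge> 2" and kN: "k \<le> N" "even (N - k)" and eps: "\<epsilon> = Fwd \<Longrightarrow> k \<ge> 1"
  shows "\<bar>state_mean (real q) \<epsilon> k N (\<lambda>i. of_bool (i = j)) - rho_ev q j\<bar> \<le> 2 * real q powr (- real (N - k) / 2)"
proof -
  let ?\<Phi> = "\<lambda>i. complex_of_real (1 * of_bool (i = j))"
  have "cmod (state_mean (real q) \<epsilon> k N ?\<Phi> - rho_mean q ?\<Phi>) \<le> 2 * 1 * real q powr (- real (N - k) / 2)"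
    by (rule state_mean_error[OF q _ kN eps]) auto
  then have "cmod (of_real (1 * state_mean (real q) \<epsilon> k N (\<lambda>i. of_bool (i = j))) - of_real (1 * rho_ev q j))
     \<le> 2 * 1 * real q powr (- real (N - k) / 2)"
    unfolding state_mean_of_real rho_mean_of_bool .
  then show ?thesis unfolding of_real_diff[symmetric] norm_of_real by simp
qed

lemma state_mean_tendsto:
  assumes q: "q \<ge> 2" and k: "even k" and eps: "\<epsilon> = Fwd \<Longrightarrow> k \<ge> 1"
  shows "(\<lambda>n. state_mean (real q) \<epsilon> k (2 * n) (\<lambda>i. of_bool (i = j))) \<longlonglongrightarrow> rho_ev q j"
proof (rule Lim_null_comparison[of _ "\<lambda>n. 2 * real q powr (- real n / 2)", THEN LIM_zero_cancel])
  have "(\<lambda>n. 2 * real q powr (- real n / 2)) \<longlonglongrightarrow> 2 * 0"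
    using q by (intro tendsto_mult tendsto_const powr_tendsto_0 filterlim_real_sequentially) simp
  then show "(\<lambda>n. 2 * real q powr (- real n / 2)) \<longlonglongrightarrow> 0" by simp
  show "\<forall>\<^sub>F n in sequentially. norm (state_mean (real q) \<epsilon> k (2 * n) (\<lambda>i. of_bool (i = j)) - rho_ev q j) \<le> 2 * real q powr (- real n / 2)"
    using eventually_ge_at_top[of k]
  proof eventually_elim
    case (elim n)
    have "\<bar>state_mean (real q) \<epsilon> k (2 * n) (\<lambda>i. of_bool (i = j)) - rho_ev q j\<bar> \<le> 2 * real q powr (- real (2 * n - k) / 2)"
      using elim k eps by (intro state_mean_pointwise_error[OF q]) auto
    also have "\<dots> \<le> 2 * real q powr (- real n / 2)"
      using q elim by (intro mult_left_mono powr_mono) auto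
    finally show ?case by simp
  qed
qed

lemma vtx_a_mat: "vtx ((A :: 'a::{field,finite} mat2) ** a_mat m) = vtx (A ** abarz (2 * m))"
proof -
  have "(a_mat m :: 'a mat2) = abarz (2 * m) ** scalar_mat (tpow (- m))"
    by (simp add: a_mat_def abarz_def scalar_mat_def mat2_mult tvar_powi tpow_mult_tpow)
  moreover have "vtx (scalar_mat (tpow (- m)) :: 'a mat2) = v_base"
    using vtx_scalar_mat[of "tpow (- m)" "mat 1 :: 'a mat2"] by (simp add: v_base_vtx)
  ultimately show ?thesis using vtx_mult_stabilizer[of "scalar_mat (tpow (- m))" "A ** abarz (2 * m)"]
    by (simp add: matrix_mul_assoc)
qed

lemma a_mat_SL2: "a_mat m \<in> SL2"
  by (simp add: SL2_def a_mat_def det_mat2 tvar_powi tpow_mult_tpow)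

lemma height_even: "g \<in> SL2 \<Longrightarrow> even (height (vtx g))"
  using height_parity[of g] by (simp add: SL2_def)

lemma edge_state_SL2:
  assumes "g \<in> SL2"
  obtains \<epsilon> where "in_state \<epsilon> (height (vtx g)) (edge_at g)" "\<epsilon> = Fwd \<Longrightarrow> height (vtx g) \<ge> 1"
proof -
  obtain \<epsilon> where e: "in_state \<epsilon> (height (vtx g)) (edge_at g)" using edge_at_state[OF SL2_det[OF assms]] by blast
  moreover have "\<epsilon> = Fwd \<Longrightarrow> height (vtx g) \<ge> 1" using e by (auto simp: edge_at_def)
  ultimately show ?thesis by (rule that)
qed

text \<open>Invariance under \<open>u(s) a\<^bsub>-n\<^esub>\<close>, averaged over the digits \<open>s\<close>, replaces the indicator of a level by the depth
  \<open>2n\<close> shadow of the edge at \<open>g\<close>, whose state has even \<open>k\<close> and does not change with \<open>n\<close>.  This shadow tends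
  to \<open>\<rho>\<^sup>e\<^sup>v\<close> at every point, and dominated convergence concludes.\<close>

lemma push_inv_prob:
  fixes \<mu> :: "'a::{field,finite} mat2 set measure"
  assumes "is_inv_prob_X \<mu>"
  shows "push_hK (integral\<^sup>L \<mu>) j = rho_ev CARD('a) j"
proof -
  interpret prob_space \<mu> using assms by (simp add: is_inv_prob_X_def)
  have sp: "space \<mu> = X_space" and sets: "sets \<mu> = sigma_sets X_space {V. openin X_top V}"
    and inv: "\<And>g. g \<in> SL2 \<Longrightarrow> distr \<mu> \<mu> (\<lambda>x. ract x g) = \<mu>"
    using assms unfolding is_inv_prob_X_def by blast+
  define f :: "'a mat2 set \<Rightarrow> real" where "f = (\<lambda>x. of_bool (h_K x = j))"
  have open_sets: "V \<in> sets \<mu>" if "openin X_top V" for V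
    unfolding sets using that by (intro sigma_sets.Basic) simp
  have "indicator {x \<in> X_space. h_K x \<in> {j}} \<in> borel_measurable \<mu>"
    by (intro borel_measurable_indicator open_sets openin_height_level)
  then have f_meas: "f \<in> borel_measurable \<mu>"
    by (rule measurable_cong[THEN iffD1, rotated]) (auto simp: f_def sp indicator_def)
  have ract_meas: "(\<lambda>x. ract x g) \<in> measurable \<mu> \<mu>" if "g \<in> SL2" for g
  proof (rule measurable_sigma_sets[OF sets])
    show "{V. openin X_top V} \<subseteq> Pow X_space" by (auto simp: openin_X_top_iff)
    show "(\<lambda>x. ract x g) \<in> space \<mu> \<rightarrow> X_space" using that ract_X_space sp by auto
    fix V :: "'a mat2 set set" assume "V \<in> {V. openin X_top V}"
    moreover have "(\<lambda>x. ract x g) -` V \<inter> space \<mu> = {x \<in> X_space. ract x g \<in> V}" using sp by auto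
    ultimately show "(\<lambda>x. ract x g) -` V \<inter> space \<mu> \<in> sets \<mu>"
      using openin_ract_vimage[OF _ that] open_sets by simp
  qed
  have f_meas': "(\<lambda>x. f (ract x g)) \<in> borel_measurable \<mu>" if "g \<in> SL2" for g
    using measurable_compose[OF ract_meas[OF that] f_meas] .
  have f_inv: "(\<integral>x. f (ract x g) \<partial>\<mu>) = integral\<^sup>L \<mu> f" if "g \<in> SL2" for g
    using integral_distr[OF ract_meas[OF that] f_meas] inv[OF that] by simp
  let ?h = "\<lambda>n s. u_mat s ** a_mat (- int n) :: 'a mat2"
  have h: "?h n s \<in> SL2" for n s by (intro SL2_mult u_mat_SL2 a_mat_SL2)
  define G where "G = (\<lambda>n x. (1 / real CARD('a) ^ (2 * n)) *\<^sub>R (\<Sum>s\<in>digit_reps (2 * n). f (ract x (?h n s))))"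
  have int: "integrable \<mu> (\<lambda>x. f (ract x (?h n s)))" for n s
    by (rule integrable_const_bound[of _ 1]) (use f_meas'[OF h] in \<open>auto simp: f_def\<close>)
  have G_int: "integral\<^sup>L \<mu> (G n) = integral\<^sup>L \<mu> f" for n
  proof -
    have "integral\<^sup>L \<mu> (G n) = (1 / real CARD('a) ^ (2 * n)) *\<^sub>R (\<Sum>s\<in>(digit_reps (2 * n) :: 'a fls set). integral\<^sup>L \<mu> f)"
      unfolding G_def using int by (simp add: f_inv[OF h])
    then show ?thesis by (simp add: card_digit_reps)
  qed
  have G_gcoset: "G n (gcoset g) = desc_mean g (2 * n) (\<lambda>i. of_bool (i = j))" for n g
  proof -
    have "h_K (ract (gcoset g) (?h n s)) = height (desc_vertex g (2 * n) s)" for s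
      using vtx_a_mat[of "g ** u_mat s" "- int n"]
      by (simp add: ract_gcoset h_K_gcoset desc_vertex_def matrix_mul_assoc)
    then show ?thesis by (simp add: G_def desc_mean_def f_def)
  qed
  have q: "CARD('a) \<ge> 2" using card_field_gt_1[where 'a='a] by simp
  have "(\<lambda>n. integral\<^sup>L \<mu> (G n)) \<longlonglongrightarrow> integral\<^sup>L \<mu> (\<lambda>x. rho_ev CARD('a) j)"
  proof (rule integral_dominated_convergence[where w = "\<lambda>x. 1"])
    show "G n \<in> borel_measurable \<mu>" for n
      unfolding G_def using f_meas'[OF h] by measurable
    show "AE x in \<mu>. (\<lambda>n. G n x) \<longlonglongrightarrow> rho_ev CARD('a) j"
    proof (rule AE_I2)
      fix x assume "x \<in> space \<mu>"
      then obtain g where g: "g \<in> SL2" "x = gcoset g" using sp X_spaceE by metis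
      obtain \<epsilon> where e: "in_state \<epsilon> (height (vtx g)) (edge_at g)" "\<epsilon> = Fwd \<Longrightarrow> height (vtx g) \<ge> 1"
        by (rule edge_state_SL2[OF g(1)]) blast
      show "(\<lambda>n. G n x) \<longlonglongrightarrow> rho_ev CARD('a) j"
        unfolding g(2) G_gcoset desc_mean_state[OF SL2_det[OF g(1)] e(1)]
        by (rule state_mean_tendsto[OF q height_even[OF g(1)] e(2)])
    qed
    show "AE x in \<mu>. norm (G n x) \<le> 1" for n
    proof (rule AE_I2)
      fix x
      have "(\<Sum>s\<in>digit_reps (2 * n). f (ract x (?h n s))) \<le> (\<Sum>s\<in>(digit_reps (2 * n) :: 'a fls set). 1)"
        by (intro sum_mono) (simp add: f_def)
      moreover have "(\<Sum>s\<in>digit_reps (2 * n). f (ract x (?h n s))) \<ge> 0"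
        by (intro sum_nonneg) (simp add: f_def)
      ultimately show "norm (G n x) \<le> 1" by (simp add: G_def card_digit_reps abs_of_nonneg)
    qed
  qed auto
  then have "integral\<^sup>L \<mu> f = rho_ev CARD('a) j"
    unfolding G_int by (simp add: LIMSEQ_const_iff prob_space)
  then show ?thesis by (simp add: push_hK_def indicator_level f_def)
qed

definition diag2 :: "'a::{field,finite} fls \<Rightarrow> 'a mat2"
  where "diag2 a = mat2 a 0 0 (inverse a)"

lemma diag2_SL2: "a \<noteq> 0 \<Longrightarrow> diag2 a \<in> SL2"
  by (simp add: diag2_def SL2_def det_mat2)

lemma diag2_u_mat: "a \<noteq> 0 \<Longrightarrow> diag2 a ** u_mat s = u_mat (a\<^sup>2 * s) ** diag2 a"
  by (simp add: diag2_def u_mat_def mat2_mult power2_eq_square)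

lemma vtx_diag2:
  fixes a :: "'a::{field,finite} fls"
  assumes "a \<noteq> 0"
  shows "vtx (A ** diag2 a) = vtx (A ** abarz (- 2 * fls_subdegree a))"
proof -
  let ?m = "fls_subdegree a"
  let ?C = "mat2 (tpow (2 * ?m) * a) 0 0 (inverse a)"
  have "diag2 a = abarz (- 2 * ?m) ** ?C"
    by (simp add: diag2_def abarz_def mat2_mult tpow_mult_tpow_mult)
  moreover have "vtx ?C = v_base"
  proof (subst stabilizer_iff)
    show "\<exists>e. fls_subdegree (det ?C) = 2 * e \<and> (\<forall>i j. ?C $ i $ j \<in> val_ge e)"
      unfolding entries_mat2 using assms by (intro exI[of _ "- ?m"]) (simp add: det_mat2 val_ge_iff)
  qed (use assms in \<open>simp add: det_mat2\<close>)
  ultimately show ?thesis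
    using vtx_mult_stabilizer[of ?C "A ** abarz (- 2 * ?m)"] by (simp add: matrix_mul_assoc)
qed

lemma height_u_mat: "p \<in> Fq_poly \<Longrightarrow> height (vtx (u_mat p ** A)) = height (vtx A)"
  using height_vact[OF u_mat_GL2_poly, of p "vtx A"] by (simp add: vact_vtx)

text \<open>The parameter \<open>z\<close> matters only modulo \<open>\<bbbF>\<^sub>q[t]\<close>, so it may be taken in \<open>t\<^sup>-\<^sup>1 \<O>\<close>.  Then \<open>u(z)\<close> fixes both ends
  of the edge from \<open>v\<^sub>0\<close> to \<open>abar\<^bsub>-1\<^esub> v\<^sub>0\<close>, which is in the forward state \<open>1\<close>, and the sum runs over
  its descendants.\<close>

lemma horocycle_mean:
  fixes z :: "'a::{field,finite} fls"
  shows "(1 / real CARD('a) ^ N) *\<^sub>R (\<Sum>r\<in>digit_reps N. \<Phi> (height (vtx (u_mat (z + tpow (- 1) * r) ** abarz (- int (N + 1))))))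
    = state_mean (real CARD('a)) Fwd 1 N \<Phi>"
    and "\<exists>e :: 'a vertex \<times> 'a vertex. in_state Fwd 1 e"
proof -
  obtain p where p: "p \<in> Fq_poly" "z - p \<in> val_ge 1" by (rule polynomial_part_exists)
  let ?A = "u_mat (z - p) ** abarz (- 1)"
  have dA: "det ?A \<noteq> 0" by (simp add: det_mul)
  have "?A ** abarz 1 = mat 1 ** u_mat (z - p)" by (simp add: abarz_mult abarz_0 flip: matrix_mul_assoc)
  then have "vtx (?A ** abarz 1) = v_base"
    using val_ge_mono[OF p(2), of 0] vtx_u_mat_int[of "z - p" "mat 1"] by (simp add: v_base_vtx)
  moreover have "vtx ?A = vtx (abarz (- 1))"
    using vtx_u_mat_abarz[of "z - p" "- 1" "mat 1"] p(2) by simp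
  moreover have "height (vtx (abarz (- 1) :: 'a mat2)) = 1"
    using height_eqI[OF neighbour_root[of "0::'a"]] by (simp add: u_mat_0)
  ultimately have st: "in_state Fwd 1 (edge_at ?A)"
    using adj_edge[OF dA] by (simp add: edge_at_def height_base)
  then show "\<exists>e :: 'a vertex \<times> 'a vertex. in_state Fwd 1 e" by blast
  have "height (vtx (u_mat (z + tpow (- 1) * r) ** abarz (- int (N + 1)))) = height (desc_vertex ?A N r)" for r
  proof -
    have "u_mat (z + tpow (- 1) * r) = u_mat p ** (u_mat (z - p) ** u_mat (tpow (- 1) * r))"
      by (simp add: u_mat_add)
    moreover have "abarz (- int (N + 1)) = (abarz (- 1) ** abarz (- int N) :: 'a mat2)" by (simp add: abarz_mult)
    ultimately have "u_mat (z + tpow (- 1) * r) ** abarz (- int (N + 1))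
        = u_mat p ** (u_mat (z - p) ** (u_mat (tpow (- 1) * r) ** abarz (- 1)) ** abarz (- int N))"
      by (simp only: matrix_mul_assoc)
    also have "\<dots> = u_mat p ** (?A ** u_mat r ** abarz (- int N))"
      unfolding abarz_u_mat[symmetric] by (simp only: matrix_mul_assoc)
    finally show ?thesis using height_u_mat[OF p(1)] by (simp add: desc_vertex_def)
  qed
  then show "(1 / real CARD('a) ^ N) *\<^sub>R (\<Sum>r\<in>digit_reps N. \<Phi> (height (vtx (u_mat (z + tpow (- 1) * r) ** abarz (- int (N + 1))))))
    = state_mean (real CARD('a)) Fwd 1 N \<Phi>"
    using desc_mean_state[OF dA st, of N \<Phi>] by (simp add: desc_mean_def)
qed

lemma U_orbit_ract: "y \<in> U_orbit x \<Longrightarrow> ract y (u_mat r) \<in> U_orbit x"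
  by (auto simp: U_orbit_def ract_ract u_mat_add)

text \<open>Invariance of \<open>\<nu>\<close> allows the integrand to be averaged over the translates by \<open>u(a\<^sup>-\<^sup>2 \<pi> r)\<close>, \<open>r\<close> a digit
  representative.  The average no longer depends on the point: conjugation by \<open>diag(a, a\<^sup>-\<^sup>1)\<close> turns it into
  the horocycle mean.\<close>

lemma push_lam_per:
  fixes a :: "'a::{field,finite} fls"
  assumes a: "a \<noteq> 0" and Y: "Y = U_orbit (gcoset (diag2 a ** u_mat s0))" and nu: "is_U_inv_prob Y \<nu>"
    and n: "int n > - fls_subdegree a"
  defines "N \<equiv> nat (2 * (int n + fls_subdegree a) - 1)"
  shows "push_hK (lam_per \<nu> n) = shadow TYPE('a) Fwd 1 N"
proof
  fix j
  interpret prob_space \<nu> using nu by (simp add: is_U_inv_prob_def)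
  have sp: "space \<nu> = Y" and sets: "sets \<nu> = sigma_sets Y {V. openin (subtopology X_top Y) V}"
    and inv: "\<And>s. distr \<nu> \<nu> (\<lambda>y. ract y (u_mat s)) = \<nu>"
    using nu unfolding is_U_inv_prob_def by blast+
  have YX: "Y \<subseteq> X_space"
    unfolding Y U_orbit_def using ract_X_space[OF gcoset_X_space] SL2_mult[OF diag2_SL2[OF a] u_mat_SL2] u_mat_SL2 by blast
  define f :: "'a mat2 set \<Rightarrow> real" where "f = (\<lambda>y. of_bool (h_K (ract y (a_mat (- int n))) = j))"
  have open_sets: "Y \<inter> V \<in> sets \<nu>" if "openin X_top V" for V
    unfolding sets using that by (intro sigma_sets.Basic) (auto simp: openin_subtopology)
  have "indicator (Y \<inter> {x \<in> X_space. ract x (a_mat (- int n)) \<in> {x \<in> X_space. h_K x \<in> {j}}}) \<in> borel_measurable \<nu>"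
    by (intro borel_measurable_indicator open_sets openin_ract_vimage openin_height_level a_mat_SL2)
  then have f_meas: "f \<in> borel_measurable \<nu>"
    by (rule measurable_cong[THEN iffD1, rotated])
       (use YX ract_X_space[OF _ a_mat_SL2] in \<open>auto simp: f_def sp indicator_def\<close>)
  have ract_meas: "(\<lambda>y. ract y (u_mat r)) \<in> measurable \<nu> \<nu>" for r
  proof (rule measurable_sigma_sets[OF sets])
    show "{V. openin (subtopology X_top Y) V} \<subseteq> Pow Y" by (auto simp: openin_subtopology)
    show "(\<lambda>y. ract y (u_mat r)) \<in> space \<nu> \<rightarrow> Y" using U_orbit_ract sp Y by blast
    fix V :: "'a mat2 set set" assume "V \<in> {V. openin (subtopology X_top Y) V}"
    then obtain W where W: "openin X_top W" "V = W \<inter> Y" by (auto simp: openin_subtopology)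
    have "(\<lambda>y. ract y (u_mat r)) -` V \<inter> space \<nu> = Y \<inter> {x \<in> X_space. ract x (u_mat r) \<in> W}"
      using sp YX U_orbit_ract[of _ "gcoset (diag2 a ** u_mat s0)"] unfolding W(2) Y[symmetric] by blast
    then show "(\<lambda>y. ract y (u_mat r)) -` V \<inter> space \<nu> \<in> sets \<nu>"
      using open_sets[OF openin_ract_vimage[OF W(1) u_mat_SL2]] by simp
  qed
  have f_inv: "(\<integral>y. f (ract y (u_mat r)) \<partial>\<nu>) = integral\<^sup>L \<nu> f" for r
    using integral_distr[OF ract_meas f_meas] inv by simp
  have f_int: "integrable \<nu> (\<lambda>y. f (ract y (u_mat r)))" for r
    by (rule integrable_const_bound[of _ 1]) (use measurable_compose[OF ract_meas f_meas] in \<open>auto simp: f_def\<close>)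
  let ?m = "fls_subdegree a" and ?c = "\<lambda>r. inverse (a\<^sup>2) * (tpow (- 1) * r)"
  have N: "int (N + 1) = 2 * (int n + ?m)" using n by (simp add: N_def)
  have const: "(1 / real CARD('a) ^ N) *\<^sub>R (\<Sum>r\<in>digit_reps N. f (ract y (u_mat (?c r))))
      = state_mean (real CARD('a)) Fwd 1 N (\<lambda>i. of_bool (i = j))" if yY: "y \<in> Y" for y
  proof -
    obtain s where y: "y = gcoset (diag2 a ** u_mat s)"
      using yY unfolding Y U_orbit_def by (auto simp: ract_gcoset u_mat_add simp flip: matrix_mul_assoc)
    have "h_K (ract (ract y (u_mat (?c r))) (a_mat (- int n)))
       = height (vtx (u_mat (a\<^sup>2 * s + tpow (- 1) * r) ** abarz (- int (N + 1))))" for r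
    proof -
      have "a\<^sup>2 * (s + ?c r) = a\<^sup>2 * s + tpow (- 1) * r"
        using a by (simp add: distrib_left flip: mult.assoc)
      then have D: "diag2 a ** u_mat (s + ?c r) = u_mat (a\<^sup>2 * s + tpow (- 1) * r) ** diag2 a"
        using diag2_u_mat[OF a] by simp
      have b: "a * tpow (- int n) \<noteq> 0" "fls_subdegree (a * tpow (- int n)) = ?m + int n" using a by simp_all
      have "diag2 a ** a_mat (- int n) = diag2 (a * tpow (- int n))"
        by (simp add: diag2_def a_mat_def mat2_mult tvar_powi tvar_power inverse_mult_distrib inverse_tpow mult.commute)
      then have "u_mat (a\<^sup>2 * s + tpow (- 1) * r) ** diag2 a ** a_mat (- int n)
        = u_mat (a\<^sup>2 * s + tpow (- 1) * r) ** diag2 (a * tpow (- int n))" by (simp flip: matrix_mul_assoc)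
      then have "vtx (diag2 a ** u_mat (s + ?c r) ** a_mat (- int n))
        = vtx (u_mat (a\<^sup>2 * s + tpow (- 1) * r) ** abarz (- int (N + 1)))"
        unfolding D N using vtx_diag2[OF b(1)] b(2) by (simp add: add.commute)
      moreover have "ract (ract y (u_mat (?c r))) (a_mat (- int n)) = gcoset (diag2 a ** u_mat (s + ?c r) ** a_mat (- int n))"
        unfolding y ract_gcoset u_mat_add[symmetric] by (simp only: matrix_mul_assoc)
      ultimately show ?thesis by (simp add: h_K_gcoset)
    qed
    then show ?thesis
      unfolding horocycle_mean(1)[of N "\<lambda>i. of_bool (i = j)" "a\<^sup>2 * s", symmetric] by (simp add: f_def)
  qed
  have "integral\<^sup>L \<nu> f = (1 / real CARD('a) ^ N) *\<^sub>R (\<Sum>r\<in>(digit_reps N :: 'a fls set). \<integral>y. f (ract y (u_mat (?c r))) \<partial>\<nu>)"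
    by (simp add: f_inv card_digit_reps)
  also have "\<dots> = (\<integral>y. (1 / real CARD('a) ^ N) *\<^sub>R (\<Sum>r\<in>digit_reps N. f (ract y (u_mat (?c r)))) \<partial>\<nu>)"
    using f_int by simp
  also have "\<dots> = (\<integral>y. state_mean (real CARD('a)) Fwd 1 N (\<lambda>i. of_bool (i = j)) \<partial>\<nu>)"
    using const sp by (intro Bochner_Integration.integral_cong) auto
  also have "\<dots> = state_mean (real CARD('a)) Fwd 1 N (\<lambda>i. of_bool (i = j))" by (simp add: prob_space)
  also have "\<dots> = shadow TYPE('a) Fwd 1 N j" using horocycle_mean(2) shadow_eq by metis
  finally show "push_hK (lam_per \<nu> n) j = shadow TYPE('a) Fwd 1 N j"
    by (simp add: push_hK_def lam_per_def indicator_level f_def)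
qed

section \<open>Rational and irrational endpoints\<close>

definition col1 :: "'a::{field,finite} mat2 \<Rightarrow> 'a fls ^ 2"
  where "col1 g = g *v vector [1, 0]"

lemma col1_nth [simp]: "col1 g $ 1 = (g $ 1) $ 1" "col1 g $ 2 = (g $ 2) $ 1"
  by (cases g rule: mat2_cases, simp add: col1_def)+

lemma col1_mult: "col1 (A ** B) = A *v col1 B"
  by (simp add: col1_def matrix_vector_mul_assoc)

lemma xi_pt_col1: "xi_pt g = proj_pt (col1 g)"
  unfolding xi_pt_def proj_pt_def col1_def setcompr_eq_image image_image mult_scale ..

lemma proj_pt_scale: "c \<noteq> 0 \<Longrightarrow> proj_pt (c *s w) = proj_pt w"
proof -
  assume c: "c \<noteq> 0"
  have "d *s w = (d / c) *s (c *s w)" "d \<noteq> 0 \<Longrightarrow> d / c \<noteq> 0" for d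
    using c by (simp_all add: vector_smult_assoc)
  moreover have "d *s (c *s w) = (d * c) *s w" "d \<noteq> 0 \<Longrightarrow> d * c \<noteq> 0" for d
    using c by (simp_all add: vector_smult_assoc)
  ultimately show ?thesis unfolding proj_pt_def by blast
qed

lemma rational_xi_ptI:
  fixes g :: "'a::{field,finite} mat2" and w :: "'a fls ^ 2"
  assumes g: "g \<in> SL2" and "col1 g = c *s w" and w: "w $ 1 \<in> Fq_poly" "w $ 2 \<in> Fq_poly"
  shows "xi_pt g \<in> P1_ratfun"
proof -
  have "col1 g \<noteq> 0"
  proof
    assume "col1 g = 0"
    then have "(g $ 1) $ 1 = 0" "(g $ 2) $ 1 = 0" using col1_nth[of g] by simp_all
    then show False using g by (simp add: SL2_def det_2)
  qed
  then have "c \<noteq> 0" "w \<noteq> 0" using assms(2) by auto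
  then have "xi_pt g = proj_pt w" by (simp add: xi_pt_col1 assms(2) proj_pt_scale)
  moreover have "\<forall>i. w $ i \<in> Fq_ratfun"
  proof -
    have "p \<in> Fq_ratfun" if "p \<in> Fq_poly" for p :: "'a fls"
      unfolding Fq_ratfun_def using that Fq_poly_1 by (intro CollectI exI[of _ p] exI[of _ 1]) auto
    then show ?thesis using w by (simp add: forall_2)
  qed
  ultimately show ?thesis unfolding P1_ratfun_def using \<open>w \<noteq> 0\<close> by blast
qed

text \<open>One step of Euclid's algorithm: \<open>(x, y)\<close> is sent to \<open>(y, p y - x)\<close>.\<close>

definition euclid_mat :: "'a::{field,finite} fls \<Rightarrow> 'a mat2"
  where "euclid_mat p = mat2 0 1 (- 1) p"

lemma euclid_mat_Gam: "p \<in> Fq_poly \<Longrightarrow> euclid_mat p \<in> Gam"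
  unfolding Gam_def SL2_def euclid_mat_def
  by (simp add: det_mat2 entries_mat2 Fq_poly_minus)

lemma u_mat_Gam: "p \<in> Fq_poly \<Longrightarrow> u_mat p \<in> Gam"
  unfolding Gam_def SL2_def u_mat_def by (simp add: det_mat2 entries_mat2)

lemma euclid_step:
  fixes v :: "'a::{field,finite} fls ^ 2"
  assumes "v $ 2 \<noteq> 0"
  obtains p where "p \<in> Fq_poly" "(euclid_mat p *v v) $ 1 = v $ 2"
    "(euclid_mat p *v v) $ 2 = p * v $ 2 - v $ 1"
    "(euclid_mat p *v v) $ 2 \<in> val_ge (fls_subdegree (v $ 2) + 1)"
proof -
  obtain p where p: "p \<in> Fq_poly" "v $ 1 / v $ 2 - p \<in> val_ge 1" by (rule polynomial_part_exists)
  have "v $ 2 * (v $ 1 / v $ 2 - p) \<in> val_ge (fls_subdegree (v $ 2) + 1)"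
    using p(2) by (intro val_ge_mult) (simp_all add: val_ge_iff)
  moreover have "p * v $ 2 - v $ 1 = - (v $ 2 * (v $ 1 / v $ 2 - p))"
    using assms by (simp add: right_diff_distrib)
  ultimately have "p * v $ 2 - v $ 1 \<in> val_ge (fls_subdegree (v $ 2) + 1)" by (simp only: val_ge_minus_iff)
  then show ?thesis using p(1) that[of p] by (simp add: euclid_mat_def)
qed

text \<open>Euclid's algorithm for polynomials, with the degree of the second entry as termination measure.\<close>

lemma bezout_Gam:
  fixes v :: "'a::{field,finite} fls ^ 2"
  assumes "v $ 1 \<in> Fq_poly" "v $ 2 \<in> Fq_poly"
  shows "\<exists>\<gamma>\<in>Gam. (\<gamma> *v v) $ 2 = 0"
proof -
  have "\<exists>\<gamma>\<in>Gam. (\<gamma> *v v) $ 2 = 0"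
    if "v $ 1 \<in> Fq_poly" "v $ 2 \<in> Fq_poly" "v $ 2 \<in> val_ge (1 - int n)" for n and v :: "'a fls ^ 2"
    using that
  proof (induction n arbitrary: v)
    case 0
    then have "v $ 2 = 0" using Fq_poly_val_ge_1 by fastforce
    then show ?case using one_Gam by (intro bexI[of _ "mat 1"]) simp_all
  next
    case (Suc n)
    show ?case
    proof (cases "v $ 2 = 0")
      case True
      then show ?thesis using one_Gam by (intro bexI[of _ "mat 1"]) simp_all
    next
      case False
      from euclid_step[OF False] obtain p where p: "p \<in> Fq_poly" "(euclid_mat p *v v) $ 1 = v $ 2"
        "(euclid_mat p *v v) $ 2 = p * v $ 2 - v $ 1"
        "(euclid_mat p *v v) $ 2 \<in> val_ge (fls_subdegree (v $ 2) + 1)" by blast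
      have "fls_subdegree (v $ 2) \<ge> 1 - int (Suc n)" using Suc.prems(3) False by (simp add: val_ge_iff)
      then have "(euclid_mat p *v v) $ 2 \<in> val_ge (1 - int n)" using p(4) by (auto intro: val_ge_mono)
      moreover have "(euclid_mat p *v v) $ 1 \<in> Fq_poly" "(euclid_mat p *v v) $ 2 \<in> Fq_poly"
        unfolding p(2,3) using Suc.prems p(1) by (auto intro: Fq_poly_diff Fq_poly_mult)
      ultimately obtain \<gamma> where g: "\<gamma> \<in> Gam" "(\<gamma> *v (euclid_mat p *v v)) $ 2 = 0" using Suc.IH by blast
      then show ?thesis
        using Gam_mult[OF g(1) euclid_mat_Gam[OF p(1)]]
        by (intro bexI[of _ "\<gamma> ** euclid_mat p"]) (simp_all add: matrix_vector_mul_assoc)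
    qed
  qed
  moreover have "\<exists>n. v $ 2 \<in> val_ge (1 - int n)"
    by (intro exI[of _ "nat (1 - fls_subdegree (v $ 2))"]) (auto simp: val_ge_iff)
  ultimately show ?thesis using assms by blast
qed

lemma upper_triangular_SL2:
  fixes A :: "'a::{field,finite} mat2"
  assumes "A \<in> SL2" "(A $ 2) $ 1 = 0"
  obtains a s where "a \<noteq> 0" "A = diag2 a ** u_mat s"
proof -
  obtain a b c d where A: "A = mat2 a b c d" by (cases A rule: mat2_cases)
  have "c = 0" "a * d = 1" using assms by (simp_all add: A SL2_def det_mat2)
  then have a: "a \<noteq> 0" "d = inverse a" by (auto simp: inverse_unique)
  have "A = diag2 a ** u_mat (b / a)"
    using a \<open>c = 0\<close> by (simp add: A diag2_def u_mat_def mat2_mult)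
  then show ?thesis using a that by blast
qed

lemma Gam_reduce:
  fixes g :: "'a::{field,finite} mat2"
  assumes "g \<in> SL2" "\<gamma> \<in> Gam" "(\<gamma> *v col1 g) $ 2 = 0"
  obtains \<delta> a s where "\<delta> \<in> Gam" "a \<noteq> 0" "g = \<delta> ** (diag2 a ** u_mat s)"
proof -
  have "\<gamma> ** g \<in> SL2" using assms SL2_mult Gam_SL2 by blast
  moreover have "((\<gamma> ** g) $ 2) $ 1 = 0" using assms(3) unfolding col1_mult[symmetric] by simp
  ultimately obtain a s where as: "a \<noteq> 0" "\<gamma> ** g = diag2 a ** u_mat s" by (rule upper_triangular_SL2)
  then have "g = inv2 \<gamma> ** (diag2 a ** u_mat s)"
    using inv2_cancel(1)[OF SL2_det[OF Gam_SL2[OF assms(2)]], of g] by simp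
  then show ?thesis using that inv2_Gam[OF assms(2)] as(1) by blast
qed

text \<open>Clear denominators and apply Euclid's algorithm: some element of \<open>\<Gamma>\<close> makes \<open>g\<close> upper triangular.\<close>

lemma rational_xi_ptE:
  fixes g :: "'a::{field,finite} mat2"
  assumes g: "g \<in> SL2" and "xi_pt g \<in> P1_ratfun"
  obtains \<delta> a s where "\<delta> \<in> Gam" "a \<noteq> 0" "g = \<delta> ** (diag2 a ** u_mat s)"
proof -
  obtain w :: "'a fls ^ 2" where w: "\<And>i. w $ i \<in> Fq_ratfun" "proj_pt (col1 g) = proj_pt w"
    using assms(2) unfolding xi_pt_col1 P1_ratfun_def by blast
  have "w \<in> proj_pt w" unfolding proj_pt_def by (intro CollectI exI[of _ 1]) simp
  then obtain c where c: "c \<noteq> 0" "w = c *s col1 g" using w(2) unfolding proj_pt_def by blast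
  obtain p1 d1 p2 d2 where p: "p1 \<in> Fq_poly" "d1 \<in> Fq_poly" "d1 \<noteq> 0" "w $ 1 = p1 / d1"
      "p2 \<in> Fq_poly" "d2 \<in> Fq_poly" "d2 \<noteq> 0" "w $ 2 = p2 / d2"
    using w(1)[of 1] w(1)[of 2] unfolding Fq_ratfun_def by blast
  let ?v = "(d1 * d2) *s w"
  have "?v $ 1 = p1 * d2" "?v $ 2 = p2 * d1" using p by (simp_all add: field_simps)
  then have "?v $ 1 \<in> Fq_poly" "?v $ 2 \<in> Fq_poly" using p by (auto intro: Fq_poly_mult)
  then obtain \<gamma> where \<gamma>: "\<gamma> \<in> Gam" "(\<gamma> *v ?v) $ 2 = 0" using bezout_Gam by blast
  have "\<gamma> *v ?v = (d1 * d2 * c) *s (\<gamma> *v col1 g)"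
    unfolding c(2) mult_scale vector_smult_assoc ..
  then have "(\<gamma> *v col1 g) $ 2 = 0" using \<gamma>(2) p c by simp
  then show ?thesis using Gam_reduce[OF g \<gamma>(1)] that by blast
qed

lemma irrational_nonzero:
  fixes g :: "'a::{field,finite} mat2"
  assumes "g \<in> SL2" "xi_pt g \<notin> P1_ratfun" "\<gamma> \<in> Gam"
  shows "(\<gamma> *v col1 g) $ 2 \<noteq> 0"
proof
  assume "(\<gamma> *v col1 g) $ 2 = 0"
  then obtain \<delta> a s where d: "\<delta> \<in> Gam" "a \<noteq> 0" "g = \<delta> ** (diag2 a ** u_mat s)" using Gam_reduce[OF assms(1,3)] by blast
  have "col1 (diag2 a ** u_mat s) = a *s vector [1, 0]"
    by (rule vec2_eqI) (simp_all add: diag2_def u_mat_def mat2_mult)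
  then have "col1 g = a *s col1 \<delta>" unfolding d(3) col1_mult mult_scale[symmetric] by (simp add: col1_def mult_scale)
  moreover have "col1 \<delta> $ 1 \<in> Fq_poly" "col1 \<delta> $ 2 \<in> Fq_poly" using d(1) by (simp_all add: Gam_def)
  ultimately show False using rational_xi_ptI[OF assms(1)] assms(2) by blast
qed

text \<open>Without a rational endpoint the algorithm never reaches \<open>0\<close>, and each step raises the valuation of the
  second entry.\<close>

lemma irrational_small_vectors:
  fixes g :: "'a::{field,finite} mat2"
  assumes g: "g \<in> SL2" "xi_pt g \<notin> P1_ratfun"
  shows "\<exists>\<gamma>\<in>Gam. (\<gamma> *v col1 g) $ 2 \<in> val_ge m"
proof -
  let ?c = "fls_subdegree (col1 g $ 2)"
  have "\<exists>\<gamma>\<in>Gam. fls_subdegree ((\<gamma> *v col1 g) $ 2) \<ge> ?c + int n" for n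
  proof (induction n)
    case 0
    show ?case using one_Gam by (intro bexI[of _ "mat 1"]) simp_all
  next
    case (Suc n)
    then obtain \<gamma> where \<gamma>: "\<gamma> \<in> Gam" "fls_subdegree ((\<gamma> *v col1 g) $ 2) \<ge> ?c + int n" by blast
    from euclid_step[OF irrational_nonzero[OF g \<gamma>(1)]] obtain p where p: "p \<in> Fq_poly"
      "(euclid_mat p *v (\<gamma> *v col1 g)) $ 2 \<in> val_ge (fls_subdegree ((\<gamma> *v col1 g) $ 2) + 1)" by blast
    have G: "euclid_mat p ** \<gamma> \<in> Gam" using Gam_mult euclid_mat_Gam p(1) \<gamma>(1) by blast
    have "((euclid_mat p ** \<gamma>) *v col1 g) $ 2 \<in> val_ge (fls_subdegree ((\<gamma> *v col1 g) $ 2) + 1)"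
      using p(2) by (simp add: matrix_vector_mul_assoc)
    then have "fls_subdegree (((euclid_mat p ** \<gamma>) *v col1 g) $ 2) \<ge> ?c + int (Suc n)"
      using irrational_nonzero[OF g G] \<gamma>(2) by (simp add: val_ge_iff)
    then show ?case using G by blast
  qed
  from this[of "nat (m - ?c)"] obtain \<gamma> where "\<gamma> \<in> Gam"
    "fls_subdegree ((\<gamma> *v col1 g) $ 2) \<ge> ?c + int (nat (m - ?c))" by blast
  moreover from this(2) have "fls_subdegree ((\<gamma> *v col1 g) $ 2) \<ge> m" by linarith
  ultimately show ?thesis by (intro bexI[of _ \<gamma>]) (simp_all add: val_ge_iff)
qed

lemma mat_vec_val_ge:
  fixes A :: "'a::{field,finite} mat2" and v :: "'a fls ^ 2"
  assumes "\<And>i j. (A $ i) $ j \<in> val_ge c" "\<And>i. v $ i \<in> val_ge n"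
  shows "(A *v v) $ i \<in> val_ge (c + n)"
proof -
  have "(A $ i) $ 1 * v $ 1 + (A $ i) $ 2 * v $ 2 \<in> val_ge (c + n)"
    using assms by (intro val_ge_add val_ge_mult)
  then show ?thesis by (simp add: matrix_vector_mult_def sum_2)
qed

text \<open>Rational directions are dense, and after a change of basis in \<open>\<Gamma>\<close> the target is \<open>(z', 0)\<close>.  A vector
  \<open>(x, y)\<close> of the orbit with \<open>y\<close> short but nonzero reaches it approximately by adding a polynomial
  multiple of \<open>y\<close> to \<open>x\<close>.\<close>

lemma irrational_orbit_dense:
  fixes g :: "'a::{field,finite} mat2"
  assumes g: "g \<in> SL2" "xi_pt g \<notin> P1_ratfun"
  shows "\<exists>\<gamma>\<in>Gam. \<forall>i. (\<gamma> *v col1 g - z) $ i \<in> val_ge n"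
proof -
  obtain P R where P: "P \<in> Fq_poly" "tpow n * z $ 1 - P \<in> val_ge 1" and R: "R \<in> Fq_poly" "tpow n * z $ 2 - R \<in> val_ge 1"
    using polynomial_part_exists by metis
  define v where "v = (vector [P, R] :: 'a fls ^ 2)"
  \<comment> \<open>the target is replaced by the nearby rational direction \<open>t\<^sup>-\<^sup>n v\<close>\<close>
  have z: "(tpow (- n) *s v - z) $ i \<in> val_ge n" for i
  proof -
    have "tpow n * (tpow (- n) * P - z $ 1) = - (tpow n * z $ 1 - P)" "tpow n * (tpow (- n) * R - z $ 2) = - (tpow n * z $ 2 - R)"
      by (simp_all add: right_diff_distrib tpow_mult_tpow_mult)
    then have "tpow (- n) * P - z $ 1 \<in> val_ge (1 + n)" "tpow (- n) * R - z $ 2 \<in> val_ge (1 + n)"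
      using P(2) R(2) by (metis tpow_mult_val_ge val_ge_minus_iff)+
    then have "\<forall>i. (tpow (- n) *s v - z) $ i \<in> val_ge n"
      unfolding forall_2 by (auto simp: v_def intro: val_ge_mono)
    then show ?thesis by blast
  qed
  obtain \<delta> where d: "\<delta> \<in> Gam" "(\<delta> *v v) $ 2 = 0"
    using bezout_Gam[of v] P(1) R(1) by (auto simp: v_def)
  let ?\<eta> = "inv2 \<delta>"
  have \<eta>: "?\<eta> \<in> Gam" using inv2_Gam[OF d(1)] .
  define z' where "z' = tpow (- n) * (\<delta> *v v) $ 1"
  have tv: "tpow (- n) *s v = ?\<eta> *v vector [z', 0]"
  proof -
    have "vector [z', 0] = tpow (- n) *s (\<delta> *v v)" by (rule vec2_eqI) (simp_all add: z'_def d(2))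
    then show ?thesis by (simp add: mult_scale inv2_vec[OF SL2_det[OF Gam_SL2[OF d(1)]]])
  qed
  obtain c where c: "\<And>i j. (?\<eta> $ i) $ j \<in> val_ge c" using entries_bounded_below by blast
  obtain \<gamma> where \<gamma>: "\<gamma> \<in> Gam" "(\<gamma> *v col1 g) $ 2 \<in> val_ge (n - c)"
    using irrational_small_vectors[OF g] by blast
  define x y where "x = (\<gamma> *v col1 g) $ 1" and "y = (\<gamma> *v col1 g) $ 2"
  have y: "y \<noteq> 0" "y \<in> val_ge (n - c)" using irrational_nonzero[OF g \<gamma>(1)] \<gamma>(2) by (simp_all add: y_def)
  obtain p where p: "p \<in> Fq_poly" "(z' - x) / y - p \<in> val_ge 1" by (rule polynomial_part_exists)
  have "y * ((z' - x) / y - p) \<in> val_ge (n - c + 1)" by (rule val_ge_mult[OF y(2) p(2)])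
  moreover have "x + p * y - z' = - (y * ((z' - x) / y - p))"
    using y(1) by (simp add: right_diff_distrib[of y "(z' - x) / y" p] mult.commute[of y p])
  ultimately have "x + p * y - z' \<in> val_ge (n - c + 1)" by (simp only: val_ge_minus_iff)
  then have "\<forall>i. (u_mat p *v (\<gamma> *v col1 g) - vector [z', 0]) $ i \<in> val_ge (n - c)"
    unfolding forall_2 using y(2) by (auto simp: u_mat_def x_def[symmetric] y_def[symmetric] intro: val_ge_mono)
  then have 1: "(?\<eta> *v (u_mat p *v (\<gamma> *v col1 g) - vector [z', 0])) $ i \<in> val_ge n" for i
    using mat_vec_val_ge[OF c, of _ "n - c"] by simp
  let ?G = "?\<eta> ** (u_mat p ** \<gamma>)"
  have "?G *v col1 g - z = ?\<eta> *v (u_mat p *v (\<gamma> *v col1 g) - vector [z', 0]) + (tpow (- n) *s v - z)"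
    unfolding tv by (simp add: matrix_vector_mult_diff_distrib matrix_vector_mul_assoc matrix_mul_assoc)
  then have "(?G *v col1 g - z) $ i \<in> val_ge n" for i
    using val_ge_add[OF 1[of i] z[of i]] by (simp only: vector_add_component)
  moreover have "?G \<in> Gam" using Gam_mult \<eta> u_mat_Gam p(1) \<gamma>(1) by blast
  ultimately show ?thesis by blast
qed

text \<open>An element of \<open>SL\<^sub>2\<close> is determined up to \<open>U\<close> by its first column, so density of the \<open>\<Gamma>\<close>-orbit of this column
  suffices.  The matrix \<open>k\<close> near the identity corrects \<open>h\<close> to have exactly the first column reached.\<close>

lemma irrational_orbit_meets_open:
  fixes g :: "'a::{field,finite} mat2"
  assumes g: "g \<in> SL2" "xi_pt g \<notin> P1_ratfun" and V: "openin X_top V" "x \<in> V"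
  shows "\<exists>y\<in>U_orbit (gcoset g). y \<in> V"
proof -
  have "x \<in> X_space" using V by (auto simp: openin_X_top_iff)
  then obtain h where h: "h \<in> SL2" "x = gcoset h" by (rule X_spaceE)
  obtain n where n: "\<And>B. B \<in> SL2 \<Longrightarrow> mat_close n h B \<Longrightarrow> gcoset B \<in> V"
    using V h unfolding openin_X_top_iff by blast
  obtain m0 where m0: "\<And>A B. mat_close m0 A B \<Longrightarrow> mat_close n (h ** A) (h ** B)"
    using mat_close_mult_left by blast
  define m where "m = max m0 1"
  obtain c where c: "\<And>i j. (inv2 h $ i) $ j \<in> val_ge c" using entries_bounded_below by blast
  obtain \<gamma> where \<gamma>: "\<gamma> \<in> Gam" "\<And>i. (\<gamma> *v col1 g - col1 h) $ i \<in> val_ge (m - c)"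
    using irrational_orbit_dense[OF g] by blast
  define w where "w = inv2 h *v (\<gamma> *v col1 g)"
  have dh: "det h \<noteq> 0" using SL2_det[OF h(1)] .
  have "inv2 h *v col1 h = vector [1, 0]" unfolding col1_def by (rule inv2_vec(1)[OF dh])
  then have "inv2 h *v (\<gamma> *v col1 g - col1 h) = w - vector [1, 0]"
    by (simp add: w_def matrix_vector_mult_diff_distrib)
  then have w: "(w - vector [1, 0]) $ i \<in> val_ge m" for i
    using mat_vec_val_ge[of "inv2 h" c "\<gamma> *v col1 g - col1 h" "m - c" i] c \<gamma>(2) by simp
  then have w1: "w $ 1 - 1 \<in> val_ge m" and w2: "w $ 2 \<in> val_ge m" using w[of 1] w[of 2] by simp_all
  have "w $ 1 - 1 \<in> val_ge 1" using w1 by (rule val_ge_mono) (simp add: m_def)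
  then have "fls_nth (w $ 1 - 1) 0 = 0" "w $ 1 - 1 \<in> val_ge 0" by (auto simp: val_ge_def)
  then have nth: "fls_nth (w $ 1) 0 = 1" by simp
  have "(w $ 1 - 1) + 1 \<in> val_ge 0" using \<open>w $ 1 - 1 \<in> val_ge 0\<close> by (intro val_ge_add) simp_all
  then have sub: "w $ 1 \<noteq> 0" "fls_subdegree (w $ 1) = 0"
    using nth by (auto intro!: fls_subdegree_eqI simp: val_ge_def)
  have "inverse (w $ 1) * (w $ 1 - 1) \<in> val_ge m"
    using w1 sub by (intro val_ge_mult0) (simp_all add: val_ge_iff)
  moreover have "inverse (w $ 1) - 1 = - (inverse (w $ 1) * (w $ 1 - 1))" using sub by (simp add: right_diff_distrib)
  ultimately have w3: "inverse (w $ 1) - 1 \<in> val_ge m" by (simp only: val_ge_minus_iff)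
  define k where "k = mat2 (w $ 1) 0 (w $ 2) (inverse (w $ 1))"
  have k: "k \<in> SL2" "col1 k = w" using sub by (auto simp: k_def SL2_def det_mat2 intro!: vec2_eqI)
  have "mat_close m (mat 1) k"
    unfolding mat_close_def k_def mat2_one forall_2 using w1 w2 w3 by simp
  then have "mat_close m0 (mat 1) k" unfolding mat_close_def m_def by (meson max.cobounded1 val_ge_mono)
  then have close: "mat_close n h (h ** k)" using m0[of "mat 1" k] by simp
  have B: "h ** k \<in> SL2" using SL2_mult h(1) k(1) by blast
  let ?A = "\<gamma> ** g"
  have A: "?A \<in> SL2" using SL2_mult Gam_SL2 \<gamma>(1) g(1) by blast
  have "col1 (h ** k) = col1 ?A" by (simp add: col1_mult k(2) w_def inv2_vec[OF dh])
  then have "col1 (inv2 ?A ** (h ** k)) = col1 (inv2 ?A ** ?A)" unfolding col1_mult[of "inv2 ?A"] by simp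
  then have e1: "col1 (inv2 ?A ** (h ** k)) = vector [1, 0]" by (simp add: inv2_mult[OF SL2_det[OF A]] col1_def)
  obtain a s where as: "a \<noteq> 0" "inv2 ?A ** (h ** k) = diag2 a ** u_mat s"
  proof (rule upper_triangular_SL2)
    show "inv2 ?A ** (h ** k) \<in> SL2" using SL2_mult inv2_SL2[OF A] B by blast
    show "((inv2 ?A ** (h ** k)) $ 2) $ 1 = 0" using arg_cong[OF e1, of "\<lambda>v :: 'a fls ^ 2. v $ 2"] by simp
  qed blast
  have "a = 1" using arg_cong[OF e1, of "\<lambda>v :: 'a fls ^ 2. v $ 1"] unfolding as(2) by (simp add: diag2_def u_mat_def mat2_mult)
  then have "inv2 ?A ** (h ** k) = u_mat s" using as(2) by (simp add: diag2_def u_mat_def mat2_mult)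
  then have "h ** k = ?A ** u_mat s" using inv2_cancel(2)[OF SL2_det[OF A], of "h ** k"] by simp
  then have "gcoset (h ** k) = ract (gcoset g) (u_mat s)"
    using gcoset_Gam[OF \<gamma>(1), of "g ** u_mat s"] by (simp add: ract_gcoset matrix_mul_assoc)
  moreover have "gcoset (h ** k) \<in> V" using n[OF B close] .
  ultimately show ?thesis unfolding U_orbit_def by auto
qed

text \<open>The orbit consists of the cosets of \<open>u(z) diag(a, a\<^sup>-\<^sup>1)\<close>, with \<open>z\<close> reducible to \<open>t\<^sup>-\<^sup>1 \<O>\<close>: its vertices lie within
  twice the valuation of \<open>a\<close> from the root.\<close>

lemma rational_orbit_height_bounded:
  fixes g :: "'a::{field,finite} mat2"
  assumes g: "g \<in> SL2" "xi_pt g \<in> P1_ratfun"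
  shows "\<exists>b. \<forall>y\<in>U_orbit (gcoset g). h_K y \<le> b"
proof -
  obtain \<delta> a s where d: "\<delta> \<in> Gam" "a \<noteq> 0" "g = \<delta> ** (diag2 a ** u_mat s)" using rational_xi_ptE[OF g] by blast
  let ?e = "- 2 * fls_subdegree a"
  have "h_K (ract (gcoset g) (u_mat r)) \<le> nat \<bar>?e\<bar>" for r
  proof -
    have "ract (gcoset g) (u_mat r) = gcoset (diag2 a ** u_mat (s + r))"
      unfolding d(3) gcoset_Gam[OF d(1)] ract_gcoset u_mat_add[symmetric] by (simp only: matrix_mul_assoc)
    then have "h_K (ract (gcoset g) (u_mat r)) = height (vtx (u_mat (a\<^sup>2 * (s + r)) ** abarz ?e))"
      using vtx_diag2[OF d(2)] by (simp add: h_K_gcoset diag2_u_mat[OF d(2)])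
    moreover obtain p where p: "p \<in> Fq_poly" "a\<^sup>2 * (s + r) - p \<in> val_ge 1" by (rule polynomial_part_exists)
    let ?z = "a\<^sup>2 * (s + r) - p"
    have "u_mat (a\<^sup>2 * (s + r)) ** abarz ?e = u_mat p ** (u_mat ?z ** abarz ?e)"
      by (simp add: u_mat_add matrix_mul_assoc)
    ultimately have eq: "h_K (ract (gcoset g) (u_mat r)) = height (vtx (u_mat ?z ** abarz ?e))"
      using height_u_mat[OF p(1)] by simp
    show ?thesis
    proof (cases "?e \<ge> 0")
      case True
      then have "vtx (mat 1 ** u_mat ?z ** abarz ?e) = vtx (mat 1 ** abarz ?e)"
        using val_ge_mono[OF p(2)] by (intro vtx_u_mat_abarz) simp
      then have "vtx (u_mat ?z ** abarz ?e) = vtx (abarz (int (nat ?e)))" using True by simp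
      then have "h_K (ract (gcoset g) (u_mat r)) = nat ?e" unfolding eq by (simp only: height_ray)
      then show ?thesis using True by simp
    next
      case False
      have "\<exists>k\<le>nat (- ?e). has_height (vtx (u_mat ?z ** abarz (- int (nat (- ?e))))) k"
        using val_ge_mono[OF p(2), of 0] by (intro has_height_below) simp
      then show ?thesis unfolding eq using False height_eqI by force
    qed
  qed
  then show ?thesis unfolding U_orbit_def by blast
qed

lemma height_unbounded: "openin X_top {x \<in> X_space. h_K x \<in> {b<..}}" "\<exists>x :: 'a::{field,finite} mat2 set. x \<in> X_space \<and> h_K x > b"
proof -
  have "h_K (gcoset (a_mat (int (b + 1)) :: 'a mat2)) = 2 * (b + 1)"
    using vtx_a_mat[of "mat 1 :: 'a mat2" "int (b + 1)"] height_ray[of "2 * (b + 1)"] by (simp add: h_K_gcoset)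
  then show "\<exists>x :: 'a mat2 set. x \<in> X_space \<and> h_K x > b"
    using gcoset_X_space[OF a_mat_SL2] by (intro exI[of _ "gcoset (a_mat (int (b + 1)))"]) simp
qed (rule openin_height_level)

lemma irrational_orbit_height_unbounded:
  fixes g :: "'a::{field,finite} mat2"
  assumes "g \<in> SL2" "xi_pt g \<notin> P1_ratfun"
  shows "\<exists>y\<in>U_orbit (gcoset g). h_K y > b"
proof -
  obtain x :: "'a mat2 set" where "x \<in> {x \<in> X_space. h_K x \<in> {b<..}}" using height_unbounded(2)[of b] by auto
  from irrational_orbit_meets_open[OF assms height_unbounded(1) this] show ?thesis by auto
qed

lemma dense_iff_irrational:
  fixes g :: "'a::{field,finite} mat2"
  assumes g: "g \<in> SL2"
  shows "xi_pt g \<notin> P1_ratfun \<longleftrightarrow> X_top closure_of U_orbit (gcoset g) = X_space"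
proof
  assume irr: "xi_pt g \<notin> P1_ratfun"
  show "X_top closure_of U_orbit (gcoset g) = X_space"
  proof
    show "X_top closure_of U_orbit (gcoset g) \<subseteq> X_space" using closure_of_subset_topspace topspace_X_top by metis
    show "X_space \<subseteq> X_top closure_of U_orbit (gcoset g)"
      using irrational_orbit_meets_open[OF g irr] unfolding in_closure_of topspace_X_top subset_iff by blast
  qed
next
  assume dense: "X_top closure_of U_orbit (gcoset g) = X_space"
  show "xi_pt g \<notin> P1_ratfun"
  proof
    assume "xi_pt g \<in> P1_ratfun"
    then obtain b where b: "\<And>y. y \<in> U_orbit (gcoset g) \<Longrightarrow> h_K y \<le> b" using rational_orbit_height_bounded[OF g] by blast
    obtain x :: "'a mat2 set" where x: "x \<in> X_space" "h_K x > b" using height_unbounded(2) by blast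
    then have "x \<in> X_top closure_of U_orbit (gcoset g)" using dense by simp
    then have cl: "\<forall>T. x \<in> T \<and> openin X_top T \<longrightarrow> (\<exists>y. y \<in> U_orbit (gcoset g) \<and> y \<in> T)"
      unfolding in_closure_of by (rule conjunct2)
    have "x \<in> {x \<in> X_space. h_K x \<in> {b<..}}" using x by simp
    then obtain y where "y \<in> U_orbit (gcoset g)" "y \<in> {x \<in> X_space. h_K x \<in> {b<..}}"
      using cl[rule_format, OF conjI, OF _ height_unbounded(1)] by meson
    then show False using b[of y] by simp
  qed
qed

text \<open>The open sets of bounded height cover a compact orbit, whereas on an irrational orbit heights are
  unbounded.\<close>

lemma compact_orbit_rational:
  fixes g :: "'a::{field,finite} mat2"
  assumes g: "g \<in> SL2" and comp: "compactin X_top (U_orbit (gcoset g))"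
  shows "xi_pt g \<in> P1_ratfun"
proof (rule ccontr)
  assume irr: "xi_pt g \<notin> P1_ratfun"
  let ?U = "range (\<lambda>b. {x \<in> X_space. h_K x \<in> {..b}}) :: 'a mat2 set set set"
  have "U_orbit (gcoset g) \<subseteq> X_space" using comp by (simp add: compactin_def topspace_X_top)
  then have "U_orbit (gcoset g) \<subseteq> \<Union> ?U" by auto
  moreover have "\<forall>W\<in>?U. openin X_top W" using openin_height_level by blast
  ultimately obtain \<F> where F: "finite \<F>" "\<F> \<subseteq> ?U" "U_orbit (gcoset g) \<subseteq> \<Union> \<F>"
    using comp unfolding compactin_def by meson
  then obtain B where B: "finite B" "\<F> = (\<lambda>b. {x \<in> X_space. h_K x \<in> {..b}}) ` B" by (meson finite_subset_image)
  obtain y where y: "y \<in> U_orbit (gcoset g)" "h_K y > Max (insert 0 B)"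
    using irrational_orbit_height_unbounded[OF g irr] by blast
  then obtain b where "b \<in> B" "h_K y \<le> b" using F(3) B(2) by auto
  then show False using y(2) B(1) Max_ge[of "insert 0 B" b] by auto
qed

lemma k_idx_Suc:
  assumes "det g \<noteq> 0"
  shows "k_idx g (Suc N) = k_idx g N + 1 \<or> k_idx g N = k_idx g (Suc N) + 1"
  using height_adj[OF adj_vtx_infinity, of "g ** abarz (int N)"] assms
  by (simp add: k_idx_def y_ray_vtx det_mul abarz_mult add.commute flip: matrix_mul_assoc)

lemma k_idx_parity:
  assumes "g \<in> SL2"
  shows "even (int N - int (k_idx g N))"
proof -
  have "fls_subdegree (det (g ** abarz (int N))) = - int N" using assms by (simp add: det_mul SL2_def)
  moreover have "det (g ** abarz (int N)) \<noteq> 0" using SL2_det[OF assms] by (simp add: det_mul)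
  ultimately have "even (int (k_idx g N) - int N)"
    using height_parity[of "g ** abarz (int N)"] by (simp add: k_idx_def y_ray_vtx)
  then show ?thesis by presburger
qed

text \<open>From its first vertex of positive height, a ray that keeps climbing has only one continuation, so
  it equals \<open>\<gamma> v\<^sub>k, \<gamma> v\<^bsub>k+1\<^esub>, \<dots>\<close>.  Then \<open>\<gamma>\<^sup>-\<^sup>1 g\<close> carries one tail of the standard ray to another, and the
  stabilizer criterion at every level forces its lower left entry \<open>c\<close> to be \<open>0\<close>.\<close>

lemma ascending_ray_rational:
  fixes g :: "'a::{field,finite} mat2"
  assumes g: "g \<in> SL2" and up: "\<And>N. N \<ge> N0 \<Longrightarrow> k_idx g (Suc N) = k_idx g N + 1"
  shows "xi_pt g \<in> P1_ratfun"
proof -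
  \<comment> \<open>one step later the height is positive, as uniqueness of the higher neighbour requires\<close>
  define N1 where "N1 = Suc N0"
  define k where "k = k_idx g N1"
  have k: "k \<ge> 1" using up[of N0] by (simp add: k_def N1_def)
  have ki: "height (y_ray g (N1 + i)) = k + i" for i
    by (induction i) (use up in \<open>auto simp: k_def N1_def k_idx_def\<close>)
  have dg: "det (g ** abarz (int N)) \<noteq> 0" for N using SL2_det[OF g] by (simp add: det_mul)
  have adj: "adj (y_ray g N) (y_ray g (Suc N))" for N
    using adj_vtx_infinity[OF dg, of N] by (simp add: y_ray_vtx abarz_mult add.commute flip: matrix_mul_assoc)
  have "has_height (y_ray g N1) k"
    using has_height_height[OF dg, of N1] ki[of 0] by (simp add: y_ray_vtx)
  then obtain \<gamma> where \<gamma>: "\<gamma> \<in> GL2_poly" "y_ray g N1 = vtx (\<gamma> ** abarz (int k))" unfolding has_height_def by blast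
  have d\<gamma>: "det \<gamma> \<noteq> 0" "fls_subdegree (det \<gamma>) = 0" using GL2_polyD[OF \<gamma>(1)] by auto
  have ray: "y_ray g (N1 + i) = vtx (\<gamma> ** abarz (int (k + i)))" for i
  proof (induction i)
    case 0 then show ?case using \<gamma>(2) by simp
  next
    case (Suc i)
    have "adj (vtx (\<gamma> ** abarz (int (k + i)))) (vtx (\<gamma> ** abarz (int (k + i)) ** abarz 1))"
      using d\<gamma> by (intro adj_vtx_infinity) (simp add: det_mul)
    then have "adj (y_ray g (N1 + i)) (vtx (\<gamma> ** abarz (int (k + Suc i))))"
      unfolding Suc.IH by (simp add: abarz_mult add.commute add.left_commute flip: matrix_mul_assoc)
    moreover have "height (vtx (\<gamma> ** abarz (int (k + Suc i)))) = k + i + 1"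
      using height_vact[OF \<gamma>(1), of "vtx (abarz (int (k + Suc i)))"] height_ray[of "k + Suc i"] by (simp add: vact_vtx)
    moreover have "adj (y_ray g (N1 + i)) (y_ray g (N1 + Suc i))" using adj by simp
    moreover have "height (y_ray g (N1 + Suc i)) = k + i + 1" using ki[of "Suc i"] by simp
    ultimately show ?case
      using unique_up_neighbour[of "y_ray g (N1 + i)"] k ki[of i] adj_vertex by auto
  qed
  let ?B = "inv2 \<gamma> ** g"
  obtain a b c d where B: "?B = mat2 a b c d" by (cases ?B rule: mat2_cases)
  have dB: "det ?B \<noteq> 0" using det_inv2[OF d\<gamma>(1)] SL2_det[OF g] by (simp add: det_mul)
  \<comment> \<open>the valuation of the determinant in the criterion, which is the same at all levels\<close>
  define e2 where "e2 = int k - int N1 + fls_subdegree (det ?B)"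
  have mem: "c \<in> val_ge (e2 div 2 + int (N1 + i))" for i
  proof -
    let ?C = "abarz (- int (k + i)) ** ?B ** abarz (int (N1 + i))"
    have "?C = (abarz (- int (k + i)) ** inv2 \<gamma>) ** (g ** abarz (int (N1 + i)))" by (simp only: matrix_mul_assoc)
    then have "vtx ?C = vact (abarz (- int (k + i)) ** inv2 \<gamma>) (y_ray g (N1 + i))" by (simp only: vact_vtx y_ray_vtx)
    also have "\<dots> = vact (abarz (- int (k + i))) (vact (inv2 \<gamma>) (vact \<gamma> (vtx (abarz (int (k + i))))))"
      unfolding ray vact_mult vact_vtx[symmetric, of \<gamma>] ..
    also have "\<dots> = vact (abarz (- int (k + i))) (vtx (abarz (int (k + i))))"
      by (simp only: vact_cancel(1)[OF d\<gamma>(1)])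
    also have "\<dots> = v_base" by (simp add: vact_vtx abarz_mult abarz_0 v_base_vtx)
    finally have "vtx ?C = v_base" .
    moreover have "det ?C \<noteq> 0" using dB by (simp add: det_mul)
    ultimately obtain e where e: "fls_subdegree (det ?C) = 2 * e" "\<And>i j. ?C $ i $ j \<in> val_ge e"
      using stabilizer_iff by blast
    have "det ?C = tpow (- int (k + i)) * det ?B * tpow (int (N1 + i))" by (simp only: det_mul det_abarz)
    then have "fls_subdegree (det ?C) = e2" using dB by (simp add: e2_def)
    then have "e = e2 div 2" using e(1) by simp
    moreover have "c * tpow (int (N1 + i)) \<in> val_ge e"
      using e(2)[of 2 1] unfolding B by (simp add: abarz_def mat2_mult)
    ultimately show ?thesis by (simp only: mult.commute[of c] tpow_mult_val_ge)
  qed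
  have "c = 0"
  proof (rule val_ge_all_imp_0)
    fix n assume "n \<ge> e2 div 2 + int N1"
    then have "n = e2 div 2 + int (N1 + nat (n - (e2 div 2 + int N1)))" by simp
    then show "c \<in> val_ge n" using mem by metis
  qed
  then have "col1 ?B = a *s vector [1, 0]" unfolding B by (intro vec2_eqI) simp_all
  then have "\<gamma> *v col1 ?B = a *s col1 \<gamma>" by (simp only: mult_scale col1_def)
  then have "col1 g = a *s col1 \<gamma>" unfolding col1_mult[symmetric] inv2_cancel(2)[OF d\<gamma>(1)] .
  then show ?thesis using GL2_polyD(1)[OF \<gamma>(1)] by (intro rational_xi_ptI[OF g]) auto
qed

text \<open>The cutoff \<open>N - k\<^sub>N\<close> is nondecreasing, and at a step where it stays constant the ray climbs.\<close>

lemma M_idx_tendsto: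
  assumes g: "g \<in> SL2" and irr: "xi_pt g \<notin> P1_ratfun"
  shows "filterlim (M_idx g) at_top sequentially"
proof -
  have step: "M_idx g N \<le> M_idx g (Suc N)" "M_idx g N = M_idx g (Suc N) \<Longrightarrow> k_idx g (Suc N) = k_idx g N + 1" for N
    using k_idx_Suc[OF SL2_det[OF g], of N] by (auto simp: M_idx_def)
  have mono: "M_idx g N \<le> M_idx g N'" if "N \<le> N'" for N N' using lift_Suc_mono_le[of "M_idx g"] step(1) that by blast
  show ?thesis
    unfolding filterlim_at_top
  proof
    fix Z :: int
    have "\<exists>N. M_idx g N \<ge> Z"
    proof (rule ccontr)
      assume "\<not> ?thesis"
      then have less: "M_idx g N < Z" for N by (simp add: not_le)
      obtain N0 where N0: "\<And>N. nat (Z - M_idx g N0) \<le> nat (Z - M_idx g N)"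
        using ex_has_least_nat[of "\<lambda>_. True" _ "\<lambda>N. nat (Z - M_idx g N)"] by auto
      have const: "M_idx g N = M_idx g N0" if "N \<ge> N0" for N
        using mono[OF that] N0[of N] less[of N] less[of N0] by simp
      have "k_idx g (Suc N) = k_idx g N + 1" if "N \<ge> N0" for N
        using step(2)[of N] const[of N] const[of "Suc N"] that by simp
      then show False using ascending_ray_rational[OF g] irr by blast
    qed
    then show "\<forall>\<^sub>F N in sequentially. Z \<le> M_idx g N"
      using mono order_trans unfolding eventually_sequentially by meson
  qed
qed

lemma M_idx_eventually_nonneg:
  assumes "g \<in> SL2" "xi_pt g \<notin> P1_ratfun"
  shows "\<forall>\<^sub>F N in sequentially. M_idx g N \<ge> 0"
  using M_idx_tendsto[OF assms] unfolding filterlim_at_top by blast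

lemma ray_cutoff:
  assumes g: "g \<in> SL2" and M: "M_idx g N \<ge> 0"
  shows "k_idx g N \<le> N" "even (N - k_idx g N)" "eps_idx g N = Fwd \<Longrightarrow> k_idx g N \<ge> 1"
    "real_of_int (M_idx g N) = real (N - k_idx g N)"
proof -
  show kN: "k_idx g N \<le> N" using M by (simp add: M_idx_def)
  then have "int N - int (k_idx g N) = int (N - k_idx g N)" by (rule of_nat_diff[symmetric])
  then have "even (int (N - k_idx g N))" using k_idx_parity[OF g, of N] by (rule subst)
  then show "even (N - k_idx g N)" by (simp only: even_of_nat_iff)
  show "k_idx g N \<ge> 1" if "eps_idx g N = Fwd"
    using ray_state[OF SL2_det[OF g], of N] that by (simp add: edge_at_def)
  show "real_of_int (M_idx g N) = real (N - k_idx g N)" using kN by (simp add: M_idx_def of_nat_diff)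
qed

lemma lam_den_error:
  fixes ds :: "'a::{field,finite} fls measure"
  assumes ds: "is_haar_F ds" and g: "g \<in> SL2" and \<Phi>: "bdd_profile \<Phi>" and M: "M_idx g N \<ge> 0"
  shows "cmod (lam_den ds (gcoset g) N (\<lambda>x. \<Phi> (h_K x)) - rho_mean CARD('a) \<Phi>)
    \<le> 2 * sup_norm \<Phi> * real CARD('a) powr (- real_of_int (M_idx g N) / 2)"
proof -
  have q: "CARD('a) \<ge> 2" using card_field_gt_1[where 'a='a] by simp
  have B: "cmod (\<Phi> j) \<le> sup_norm \<Phi>" if "even j" for j
    unfolding sup_norm_def
  proof (rule cSUP_upper)
    show "bdd_above ((\<lambda>j. cmod (\<Phi> j)) ` {j. even j})"
    proof -
      obtain a where "\<forall>x\<in>\<Phi> ` {j. even j}. cmod x \<le> a" using \<Phi> unfolding bdd_profile_def bounded_iff by blast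
      then show ?thesis by (intro bdd_aboveI2[where M = a]) auto
    qed
  qed (use that in simp)
  show ?thesis
    unfolding lam_den_profile[OF ds g] ray_cutoff(4)[OF g M]
    by (rule state_mean_error[OF q B ray_cutoff(1,2)[OF g M] ray_cutoff(3)[OF g M]])
qed

lemma lam_den_tv_tendsto:
  fixes ds :: "'a::{field,finite} fls measure" and \<mu> :: "'a mat2 set measure"
  assumes ds: "is_haar_F ds" and g: "g \<in> SL2" "xi_pt g \<notin> P1_ratfun" and \<mu>: "is_inv_prob_X \<mu>"
  shows "(\<lambda>N. tv_norm (\<lambda>j. push_hK (lam_den ds (gcoset g) N) j - push_hK (integral\<^sup>L \<mu>) j)) \<longlonglongrightarrow> 0"
proof -
  let ?q = "real CARD('a)"
  have q: "CARD('a) \<ge> 2" using card_field_gt_1[where 'a='a] by simp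
  have M: "filterlim (\<lambda>N. real_of_int (M_idx g N)) at_top sequentially"
    by (rule filterlim_compose[OF filterlim_real_of_int_at_top M_idx_tendsto[OF g]])
  have "(\<lambda>N. 2 * ?q powr (- real_of_int (M_idx g N) / 2)) \<longlonglongrightarrow> 2 * 0"
    using q by (intro tendsto_mult tendsto_const powr_tendsto_0 M) simp
  then have "(\<lambda>N. ennreal (2 * ?q powr (- real_of_int (M_idx g N) / 2))) \<longlonglongrightarrow> ennreal 0"
    by (intro tendsto_ennrealI) simp
  then have lim: "(\<lambda>N. ennreal (2 * ?q powr (- real_of_int (M_idx g N) / 2))) \<longlonglongrightarrow> 0" by simp
  have "\<forall>\<^sub>F N in sequentially. tv_norm (\<lambda>j. push_hK (lam_den ds (gcoset g) N) j - push_hK (integral\<^sup>L \<mu>) j)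
      \<le> ennreal (2 * ?q powr (- real_of_int (M_idx g N) / 2))"
    using M_idx_eventually_nonneg[OF g]
  proof eventually_elim
    case (elim N)
    show ?case
      unfolding push_lam_den[OF ds g(1)] push_inv_prob[OF \<mu>] ray_cutoff(4)[OF g(1) elim]
      by (rule tv_state_mean_error[OF q ray_cutoff(1,2)[OF g(1) elim] ray_cutoff(3)[OF g(1) elim]])
  qed
  then show ?thesis
    by (intro tendsto_sandwich[OF _ _ tendsto_const lim]) auto
qed

lemma lam_den_error_eventually:
  fixes ds :: "'a::{field,finite} fls measure"
  assumes "is_haar_F ds" "g \<in> SL2" "xi_pt g \<notin> P1_ratfun"
  shows "\<forall>\<^sub>F N in sequentially. \<forall>\<Phi>. bdd_profile \<Phi> \<longrightarrow>
    cmod (lam_den ds (gcoset g) N (\<lambda>x. \<Phi> (h_K x)) - rho_mean CARD('a) \<Phi>)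
      \<le> 2 * sup_norm \<Phi> * real CARD('a) powr (- real_of_int (M_idx g N) / 2)"
  using M_idx_eventually_nonneg[OF assms(2,3)]
  by eventually_elim (use lam_den_error[OF assms(1,2)] in blast)

theorem theorem1p3:
  shows
    "(\<forall>Y :: 'a::{field,finite} mat2 set set. is_compact_U_orbit Y \<longrightarrow>
        (\<exists>m::int. \<forall>\<nu>. is_U_inv_prob Y \<nu> \<longrightarrow>
          (\<forall>n::nat. int n > m \<longrightarrow>
            push_hK (lam_per \<nu> n) = shadow TYPE('a) Fwd 1 (nat (2 * (int n - m) - 1)) \<and>
            cutoff 1 (nat (2 * (int n - m) - 1)) = 2 * (int n - m) - 2)))
     \<and>
     (\<exists>C>0. \<forall>ds :: 'a fls measure. is_haar_F ds \<longrightarrow>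
        (\<forall>g\<in>SL2.
          (\<forall>N. push_hK (lam_den ds (gcoset g) N) =
                shadow TYPE('a) (eps_idx g N) (k_idx g N) N) \<and>
          (xi_pt g \<notin> P1_ratfun \<longleftrightarrow> X_top closure_of U_orbit (gcoset g) = X_space) \<and>
          (xi_pt g \<notin> P1_ratfun \<longrightarrow>
            filterlim (M_idx g) at_top sequentially \<and>
            (\<forall>\<mu> :: 'a mat2 set measure. is_inv_prob_X \<mu> \<longrightarrow>
              (\<lambda>N. tv_norm (\<lambda>j. push_hK (lam_den ds (gcoset g) N) j
                                 - push_hK (integral\<^sup>L \<mu>) j)) \<longlonglongrightarrow> 0)) \<and>
          (\<forall>\<Phi> N. bdd_profile \<Phi> \<longrightarrow> M_idx g N \<ge> 0 \<longrightarrow>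
            cmod (lam_den ds (gcoset g) N (\<lambda>x. \<Phi> (h_K x)) - rho_mean CARD('a) \<Phi>)
              \<le> C * sup_norm \<Phi> * real CARD('a) powr (- real_of_int (M_idx g N) / 2)) \<and>
          (xi_pt g \<notin> P1_ratfun \<longrightarrow>
            (\<forall>\<^sub>F N in sequentially. \<forall>\<Phi>. bdd_profile \<Phi> \<longrightarrow>
              cmod (lam_den ds (gcoset g) N (\<lambda>x. \<Phi> (h_K x)) - rho_mean CARD('a) \<Phi>)
                \<le> C * sup_norm \<Phi> * real CARD('a) powr (- real_of_int (M_idx g N) / 2)))))"
proof (intro conjI allI impI)
  fix Y :: "'a mat2 set set" assume "is_compact_U_orbit Y"
  then obtain x where x: "x \<in> X_space" "Y = U_orbit x" "compactin X_top Y"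
    unfolding is_compact_U_orbit_def by blast
  obtain g where g: "g \<in> SL2" "x = gcoset g" using x(1) by (rule X_spaceE)
  then have "xi_pt g \<in> P1_ratfun" using compact_orbit_rational x by blast
  then obtain \<delta> a s where d: "\<delta> \<in> Gam" "a \<noteq> 0" "g = \<delta> ** (diag2 a ** u_mat s)" using rational_xi_ptE[OF g(1)] by blast
  have Y: "Y = U_orbit (gcoset (diag2 a ** u_mat s))" using x(2) g(2) d(3) gcoset_Gam[OF d(1)] by simp
  \<comment> \<open>\<open>m\<close> is the degree of \<open>a\<close> in \<open>t\<close>, the negative of its valuation\<close>
  show "\<exists>m::int. \<forall>\<nu>. is_U_inv_prob Y \<nu> \<longrightarrow>
          (\<forall>n::nat. int n > m \<longrightarrow>
            push_hK (lam_per \<nu> n) = shadow TYPE('a) Fwd 1 (nat (2 * (int n - m) - 1)) \<and>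
            cutoff 1 (nat (2 * (int n - m) - 1)) = 2 * (int n - m) - 2)"
    using push_lam_per[OF d(2) Y] by (intro exI[of _ "- fls_subdegree a"]) (auto simp: cutoff_def)
qed (rule exI[of _ 2], intro conjI allI impI ballI,
  ((rule push_lam_den_shadow dense_iff_irrational M_idx_tendsto lam_den_tv_tendsto lam_den_error
     lam_den_error_eventually; assumption) | simp)+)

end
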